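(* Let $n\ge2$, $N\ge1$, $m=n^2-1$, and let $\{X^1,\dots,X^m\}$ be an orthonormal basis of the Lie algebra of $SU(n)$ (traceless skew-Hermitian $n\times n$ matrices) for the inner product $\langle X_1,X_2\rangle=\frac12\operatorname{tr}(X_1^\dagger X_2)$. Consider the Itô stochastic differential equation on $M=\{(\lambda_1,\dots,\lambda_n)\in\mathbb{C}^n\mid\lambda_1\lambda_2\cdots\lambda_n=1\}$, $$\frac1N\,d\lambda_j=-\frac{1}{\sqrt N}\sum_{a=1}^m\lambda_jX^a_{jj}\,dw^a-\left[\sum_{a=1}^m\big[(K^a+iJ^a)X^a_{jj}+2e_j^TX^a\Omega_jX^ae_j\big]+\frac{2(n^2-1)}{n}\right]\lambda_j\,dt,\qquad j=1,\dots,n,$$ where $X^a_{jj}$ is the $j$th diagonal entry of $X^a$, $e_j$ is the $j$th canonical unit vector, and $$\Omega_j=\operatorname{diag}\left\{\frac{\lambda_1}{\lambda_1-\lambda_j},\dots,\frac{\lambda_{j-1}}{\lambda_{j-1}-\lambda_j},0,\frac{\lambda_{j+1}}{\lambda_{j+1}-\lambda_j},\dots,\frac{\lambda_n}{\lambda_n-\lambda_j}\right\}.$$ If $J^a=0$ for all $a=1,\dots,m$, then $$\frac{d}{dt}\sum_{j=1}^n|\lambda_j|^2\le0$$ for any initial value $\lambda_1(0),\dots,\lambda_n(0)$.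
   Context: This equation describes the gauge-cooled complex Langevin dynamics of the one-dimensional $SU(n)$ lattice theory with $N$ links and periodic boundary conditions, the state being $(\lambda_1,\dots,\lambda_n)\in M$. The processes $w^1,\dots,w^m$ are independent real Brownian motions normalized by $(dw^a)^2=2\,dt$. The coefficients $K^a$ and $J^a$ are real-valued: $K^a=\frac1N\sum_{x}K^a_{x,0}$ and $J^a=\frac1N\sum_xJ^a_{x,0}$, averages over the $N$ lattice sites $x$ of $K^a_{x,0}=-\mathcal{L}_{X^a_{x,0}}\operatorname{Re}S$ and $J^a_{x,0}=-\mathcal{L}_{X^a_{x,0}}\operatorname{Im}S$, where $S$ is the action on $SL(n,\mathbb{C})^N$ and $\mathcal{L}_{X^a_{x,0}}$ is the Lie derivative with respect to the link variable at $x$ along the right-invariant vector field generated by $X^a$; they are evaluated at the current field. The basis satisfies $-\sum_{a=1}^mX^aX^a=\frac{2(n^2-1)}{n}I$. Solutions are considered as long as they are defined (in particular the $\lambda_j$ are pairwise distinct, so that $\Omega_j$ makes sense). *)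

theory Defs
  imports "HOL-Probability.Probability"
begin

text \<open>
  Dimensions are types: 'n indexes matrix entries, 's the lattice sites, 'm the basis
  of the Lie algebra; so $n$, $N$, $m$ are their cardinalities.
\<close>

definition conj_transpose :: "complex^'n^'n \<Rightarrow> complex^'n^'n" where
  "conj_transpose A = map_matrix cnj (transpose A)"

definition su :: "(complex^'n^'n) set" where
  "su = {A. trace A = 0 \<and> conj_transpose A = - A}"

text \<open>The form is complex valued on all matrices and real valued on su; the span below is the
  real one.\<close>

definition su_inner :: "complex^'n^'n \<Rightarrow> complex^'n^'n \<Rightarrow> complex" where
  "su_inner A B = trace (conj_transpose A ** B) / 2"

definition su_orthonormal_basis :: "('m::finite \<Rightarrow> complex^'n^'n) \<Rightarrow> bool" where
  "su_orthonormal_basis X \<longleftrightarrow>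
     (\<forall>a. X a \<in> su) \<and> (\<forall>a b. su_inner (X a) (X b) = (if a = b then 1 else 0)) \<and>
     span (range X) = su"

definition SL :: "(complex^'n^'n) set" where
  "SL = {A. det A = 1}"

definition mat_exp :: "complex^'n^'n \<Rightarrow> complex^'n^'n" where
  "mat_exp A = (\<Sum>k. (1 / fact k) *\<^sub>R (((**) A ^^ k) (mat 1)))"

text \<open>The right-invariant vector field generated by $Y$ takes the value $Y V$ at $V$; its flow is
  left multiplication by $\exp(sY)$. Here it acts on the link at site $x$ only.\<close>

definition link_flow ::
    "complex^'n^'n \<Rightarrow> 's \<Rightarrow> ('s \<Rightarrow> complex^'n^'n) \<Rightarrow> real \<Rightarrow> ('s \<Rightarrow> complex^'n^'n)" where
  "link_flow Y x U s = U(x := mat_exp (s *\<^sub>R Y) ** U x)"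

definition lie_derivative ::
    "complex^'n^'n \<Rightarrow> 's \<Rightarrow> (('s \<Rightarrow> complex^'n^'n) \<Rightarrow> real) \<Rightarrow> ('s \<Rightarrow> complex^'n^'n) \<Rightarrow> real" where
  "lie_derivative Y x f U = deriv (\<lambda>s. f (link_flow Y x U s)) 0"

text \<open>The action matters on fields with values in SL only; this says that the Lie derivatives
  used in the drift exist there.\<close>

definition lie_differentiable_action ::
    "('m \<Rightarrow> complex^'n^'n) \<Rightarrow> (('s \<Rightarrow> complex^'n^'n) \<Rightarrow> complex) \<Rightarrow> bool" where
  "lie_differentiable_action X S \<longleftrightarrow>
     (\<forall>U x a. (\<forall>y. U y \<in> SL) \<longrightarrow> (\<lambda>s::real. S (link_flow (X a) x U s)) differentiable (at 0))"

definition K_coeff ::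
    "('m \<Rightarrow> complex^'n^'n) \<Rightarrow> (('s::finite \<Rightarrow> complex^'n^'n) \<Rightarrow> complex) \<Rightarrow>
     ('s \<Rightarrow> complex^'n^'n) \<Rightarrow> 'm \<Rightarrow> real" where
  "K_coeff X S U a =
     (1 / real CARD('s)) * (\<Sum>x\<in>UNIV. - lie_derivative (X a) x (\<lambda>V. Re (S V)) U)"

definition J_coeff ::
    "('m \<Rightarrow> complex^'n^'n) \<Rightarrow> (('s::finite \<Rightarrow> complex^'n^'n) \<Rightarrow> complex) \<Rightarrow>
     ('s \<Rightarrow> complex^'n^'n) \<Rightarrow> 'm \<Rightarrow> real" where
  "J_coeff X S U a =
     (1 / real CARD('s)) * (\<Sum>x\<in>UNIV. - lie_derivative (X a) x (\<lambda>V. Im (S V)) U)"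

definition filtered_prob_space :: "'w measure \<Rightarrow> (real \<Rightarrow> 'w measure) \<Rightarrow> bool" where
  "filtered_prob_space P F \<longleftrightarrow>
     prob_space P \<and> filtration (space P) F \<and> (\<forall>t. subalgebra P (F t))"

text \<open>Independent Brownian motions relative to F, with variance $2(t-s)$ of the increments
  (the second parameter of normal_density is the standard deviation).\<close>

definition brownian_motions2 ::
    "'w measure \<Rightarrow> (real \<Rightarrow> 'w measure) \<Rightarrow> ('m::finite \<Rightarrow> real \<Rightarrow> 'w \<Rightarrow> real) \<Rightarrow> bool" where
  "brownian_motions2 P F w \<longleftrightarrow>
     (\<forall>a. \<forall>t\<ge>0. w a t \<in> borel_measurable (F t)) \<and>
     (AE \<omega> in P. \<forall>a. w a 0 \<omega> = 0 \<and> continuous_on {0..} (\<lambda>t. w a t \<omega>)) \<and>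
     (\<forall>s t. 0 \<le> s \<and> s < t \<longrightarrow>
        (\<forall>a. distributed P lborel (\<lambda>\<omega>. w a t \<omega> - w a s \<omega>)
               (normal_density 0 (sqrt (2 * (t - s))))) \<and>
        prob_space.indep_vars P (\<lambda>_. borel) (\<lambda>a \<omega>. w a t \<omega> - w a s \<omega>) UNIV \<and>
        prob_space.indep_set P (sets (F s))
          (sets (vimage_algebra (space P) (\<lambda>\<omega>. (\<chi> a. w a t \<omega> - w a s \<omega>) :: real^'m) borel)))"

definition lifetime ::
    "'w measure \<Rightarrow> (real \<Rightarrow> 'w measure) \<Rightarrow> ('w \<Rightarrow> ereal) \<Rightarrow> bool" where
  "lifetime P F \<tau> \<longleftrightarrow> (\<forall>t\<ge>0. {\<omega> \<in> space P. \<tau> \<omega> \<le> ereal t} \<in> sets (F t))"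

text \<open>Processes with lifetime \<tau>: only the values at times $0 \le t < \tau(\omega)$ matter.\<close>

definition adapted_before ::
    "(real \<Rightarrow> 'w measure) \<Rightarrow> ('w \<Rightarrow> ereal) \<Rightarrow> (real \<Rightarrow> 'w \<Rightarrow> 'b::real_normed_vector) \<Rightarrow> bool" where
  "adapted_before F \<tau> Z \<longleftrightarrow>
     (\<forall>t\<ge>0. (\<lambda>\<omega>. if ereal t < \<tau> \<omega> then Z t \<omega> else 0) \<in> borel_measurable (F t))"

definition continuous_before ::
    "'w measure \<Rightarrow> ('w \<Rightarrow> ereal) \<Rightarrow> (real \<Rightarrow> 'w \<Rightarrow> 'b::real_normed_vector) \<Rightarrow> bool" where
  "continuous_before P \<tau> Z \<longleftrightarrow>
     (AE \<omega> in P. continuous_on {t. 0 \<le> t \<and> ereal t < \<tau> \<omega>} (\<lambda>t. Z t \<omega>))"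

text \<open>Ito integral of a continuous adapted integrand $H$ on $[0,\tau)$: $I$ is a continuous adapted
  process such that for every $t$, on the event $t < \tau$, the value $I_t$ is the limit in
  probability of the left-endpoint sums $\sum_i H_{p_i}(b_{p_{i+1}} - b_{p_i})$ over partitions of
  $[0,t]$ with mesh tending to zero.\<close>

definition ito_integral ::
    "'w measure \<Rightarrow> (real \<Rightarrow> 'w measure) \<Rightarrow> ('w \<Rightarrow> ereal) \<Rightarrow> (real \<Rightarrow> 'w \<Rightarrow> real) \<Rightarrow>
     (real \<Rightarrow> 'w \<Rightarrow> complex) \<Rightarrow> (real \<Rightarrow> 'w \<Rightarrow> complex) \<Rightarrow> bool" where
  "ito_integral P F \<tau> b H I \<longleftrightarrow>
     adapted_before F \<tau> H \<and> continuous_before P \<tau> H \<and>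
     adapted_before F \<tau> I \<and> continuous_before P \<tau> I \<and>
     (\<forall>t\<ge>0. \<forall>\<epsilon>>0. \<exists>\<delta>>0. \<forall>(p :: nat \<Rightarrow> real) r.
        p 0 = 0 \<and> p r = t \<and> (\<forall>i<r. p i \<le> p (Suc i) \<and> p (Suc i) - p i < \<delta>) \<longrightarrow>
        measure P {\<omega> \<in> space P. ereal t < \<tau> \<omega> \<and>
          \<epsilon> < norm ((\<Sum>i<r. H (p i) \<omega> * of_real (b (p (Suc i)) \<omega> - b (p i) \<omega>)) - I t \<omega>)} < \<epsilon>)"

definition state_space :: "(complex^'n) set" where
  "state_space = {l. (\<Prod>j\<in>UNIV. l $ j) = 1}"

definition Omega_mat :: "complex^'n \<Rightarrow> 'n \<Rightarrow> complex^'n^'n" where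
  "Omega_mat l j =
     (\<chi> k k'. if k = k' \<and> k \<noteq> j then l $ k / (l $ k - l $ j) else 0)"

text \<open>The coefficients of $dw^a$ and $dt$ in the equation for $\frac1N d\lambda_j$; the first
  argument is the number $N$ of links. Note that scalar_product is bilinear.\<close>

definition noise_coeff ::
    "nat \<Rightarrow> ('m \<Rightarrow> complex^'n^'n) \<Rightarrow> complex^'n \<Rightarrow> 'n \<Rightarrow> 'm \<Rightarrow> complex" where
  "noise_coeff N X l j a = - of_real (1 / sqrt (real N)) * (l $ j * X a $ j $ j)"

definition drift_coeff ::
    "('m::finite \<Rightarrow> complex^'n^'n) \<Rightarrow> ('m \<Rightarrow> real) \<Rightarrow> ('m \<Rightarrow> real) \<Rightarrow> complex^'n \<Rightarrow> 'n \<Rightarrow> complex" where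
  "drift_coeff X K J l j =
     - ((\<Sum>a\<in>UNIV. (of_real (K a) + \<i> * of_real (J a)) * X a $ j $ j
           + 2 * scalar_product (axis j 1) ((X a ** Omega_mat l j ** X a) *v axis j 1))
        + of_real (2 * (real CARD('n) ^ 2 - 1) / real CARD('n))) * l $ j"

text \<open>Solutions in the usual integrated sense, up to the lifetime \<tau>, staying in the part of the
  state space where the drift is defined.\<close>

definition langevin_solution ::
    "'w measure \<Rightarrow> (real \<Rightarrow> 'w measure) \<Rightarrow> ('m::finite \<Rightarrow> real \<Rightarrow> 'w \<Rightarrow> real) \<Rightarrow> nat \<Rightarrow>
     ('m \<Rightarrow> complex^'n^'n) \<Rightarrow> (real \<Rightarrow> 'w \<Rightarrow> 'm \<Rightarrow> real) \<Rightarrow> (real \<Rightarrow> 'w \<Rightarrow> 'm \<Rightarrow> real) \<Rightarrow>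
     ('w \<Rightarrow> ereal) \<Rightarrow> (real \<Rightarrow> 'w \<Rightarrow> complex^'n) \<Rightarrow> bool" where
  "langevin_solution P F w N X K J \<tau> \<Lambda> \<longleftrightarrow>
     lifetime P F \<tau> \<and> adapted_before F \<tau> \<Lambda> \<and> continuous_before P \<tau> \<Lambda> \<and>
     (AE \<omega> in P. \<forall>t\<ge>0. ereal t < \<tau> \<omega> \<longrightarrow>
        \<Lambda> t \<omega> \<in> state_space \<and> inj (\<lambda>j. \<Lambda> t \<omega> $ j)) \<and>
     (AE \<omega> in P. \<forall>t\<ge>0. ereal t < \<tau> \<omega> \<longrightarrow>
        (\<forall>j. (\<lambda>s. drift_coeff X (K s \<omega>) (J s \<omega>) (\<Lambda> s \<omega>) j) absolutely_integrable_on {0..t})) \<and>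
     (\<exists>I. (\<forall>j a. ito_integral P F \<tau> (w a) (\<lambda>t \<omega>. noise_coeff N X (\<Lambda> t \<omega>) j a) (I j a)) \<and>
        (AE \<omega> in P. \<forall>t\<ge>0. ereal t < \<tau> \<omega> \<longrightarrow>
          (\<forall>j. of_real (1 / real N) * (\<Lambda> t \<omega> $ j - \<Lambda> 0 \<omega> $ j) =
             (\<Sum>a\<in>UNIV. I j a t \<omega>)
             + integral {0..t} (\<lambda>s. drift_coeff X (K s \<omega>) (J s \<omega>) (\<Lambda> s \<omega>) j))))"

end

theory Submission
  imports Defs
begin

text \<open>The diagonal entries of a skew-Hermitian matrix are imaginary. Hence, when $J^a = 0$, both the
  noise and the $K^a$ part of the drift act on $\lambda_j$ as rotations and drop out of Ito's formula
  for $|\lambda_j|^2$, which is therefore differentiable in time. By completeness of the basis,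
  $\sum_a X^a_{jk} X^a_{kj} = -2$ for $j \neq k$ and $\sum_a |X^a_{jj}|^2 = 2 (1 - 1/n)$, so that
  \[ \frac{d}{dt} |\lambda_j|^2 = 4 N \sum_{k \neq j}
     |\lambda_j|^2 \frac{|\lambda_k|^2 - |\lambda_j|^2}{|\lambda_k - \lambda_j|^2}, \]
  and symmetrizing the sum over $j$ and $k$ gives a nonpositive quantity. Ito's formula is obtained
  from second moment estimates: the sums over a uniform partition of $[0,t]$ are compared with the
  Riemann sums over finer partitions that define the stochastic integral.\<close>

section \<open>Orthonormal bases of the Lie algebra\<close>

text \<open>The definition \<open>ito_integral\<close> gives a limit in probability of left-endpoint
  sums and no moment bounds, neither for the integrand nor for the integral. Every estimate is
  therefore made for finite sums whose coefficients are truncated in an adapted way, and the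
  truncation is charged to an event of small probability. All noise of one component comes from a
  single real process \<open>B\<close> with coefficients \<open>Im (X a $ j $ j)\<close>: it equals
  \<open>- \<i> * sqrt N * \<lambda>_j * dB\<close>, so a scalar Ito formula is enough. The drift is
  only known to be integrable in time, since nothing is assumed about the regularity of
  \<open>K\<close>. A derivative at every time exists because \<open>K\<close> cancels from the
  squared modulus and leaves a continuous rate. The constants must fit exactly: per unit of squared
  modulus, and up to the factor N, the drift constant gives -4 (n^2 - 1) / n and the Ito correction
  4 (n - 1) / n. The total -4 (n - 1) is one -4 for each other component, which makes the
  interaction antisymmetric.\<close>

lemma su_inner_eq_sum:
  "su_inner A B = (\<Sum>i\<in>UNIV. \<Sum>k\<in>UNIV. cnj (A $ k $ i) * B $ k $ i) / 2"
  by (simp add: su_inner_def conj_transpose_def trace_def matrix_matrix_mult_def transpose_def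
      map_matrix_def)

lemma su_inner_add_right: "su_inner A (B + C) = su_inner A B + su_inner A C"
  by (simp add: su_inner_eq_sum algebra_simps sum.distrib add_divide_distrib)

lemma su_inner_add_left: "su_inner (A + B) C = su_inner A C + su_inner B C"
  by (simp add: su_inner_eq_sum algebra_simps sum.distrib add_divide_distrib)

lemma su_inner_scaleR_right: "su_inner A (c *\<^sub>R B) = of_real c * su_inner A B"
  by (simp add: su_inner_eq_sum sum_distrib_left scaleR_conv_of_real[where 'a=complex] mult.left_commute)

lemma su_inner_scaleR_left: "su_inner (c *\<^sub>R A) B = of_real c * su_inner A B"
  by (simp add: su_inner_eq_sum sum_distrib_left scaleR_conv_of_real[where 'a=complex] mult.assoc)

lemma su_inner_sum_right:
  "finite I \<Longrightarrow> su_inner A (\<Sum>i\<in>I. f i) = (\<Sum>i\<in>I. su_inner A (f i))"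
  by (induction I rule: finite_induct)
     (simp_all add: su_inner_add_right, simp add: su_inner_eq_sum)

lemma su_inner_sum_left:
  "finite I \<Longrightarrow> su_inner (\<Sum>i\<in>I. f i) A = (\<Sum>i\<in>I. su_inner (f i) A)"
  by (induction I rule: finite_induct)
     (simp_all add: su_inner_add_left, simp add: su_inner_eq_sum)

text \<open>\<open>su\<close> is the real span of the basis, so the coefficients of \<open>B\<close>
  are real and equal the inner products; hence squares instead of squared moduli. Applied to a few
  explicit \<open>B\<close>, this takes the role of the completeness relation.\<close>

lemma su_parseval:
  fixes X :: "'m::finite \<Rightarrow> complex^'n^'n"
  assumes X: "su_orthonormal_basis X" and B: "B \<in> su"
  shows "(\<Sum>a\<in>UNIV. (su_inner (X a) B)\<^sup>2) = su_inner B B"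
proof -
  have orth: "su_inner (X a) (X b) = (if a = b then 1 else 0)" for a b
    using X by (simp add: su_orthonormal_basis_def)
  \<comment> \<open>\<open>span_finite\<close> indexes the coefficients by vectors; injectivity
    moves the sum to the index type.\<close>
  have "inj X"
  proof (rule injI)
    fix a b assume "X a = X b"
    then show "a = b" using orth[of a a] orth[of a b] by (auto split: if_splits)
  qed
  have "B \<in> span (range X)"
    using X B by (simp add: su_orthonormal_basis_def)
  then obtain u where "B = (\<Sum>v\<in>range X. u v *\<^sub>R v)"
    using span_finite[of "range X"] by auto
  also have "\<dots> = (\<Sum>a\<in>UNIV. u (X a) *\<^sub>R X a)"
    using \<open>inj X\<close> by (simp add: sum.reindex)
  finally have Beq: "B = (\<Sum>a\<in>UNIV. u (X a) *\<^sub>R X a)" .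
  have c: "su_inner (X b) B = of_real (u (X b))" for b
    by (subst Beq) (simp add: su_inner_sum_right su_inner_scaleR_right orth if_distrib cong: if_cong)
  have "su_inner B B = (\<Sum>a\<in>UNIV. of_real (u (X a)) * su_inner (X a) B)"
    by (subst Beq) (simp add: su_inner_sum_left su_inner_scaleR_left)
  then show ?thesis by (simp add: c power2_eq_square)
qed

lemma su_entry: "A \<in> su \<Longrightarrow> A $ i $ j = - cnj (A $ j $ i)"
proof -
  assume "A \<in> su"
  then have "conj_transpose A $ i $ j = - (A $ i $ j)" by (simp add: su_def)
  then show ?thesis by (simp add: conj_transpose_def map_matrix_def transpose_def)
qed

lemma su_diag: "A \<in> su \<Longrightarrow> A $ j $ j = \<i> * of_real (Im (A $ j $ j))"
  using su_entry[of A j j] by (simp add: complex_eq_iff)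

text \<open>By skew-Hermiticity each summand is minus the squared modulus of an entry. The unit
  vectors \<open>B1\<close> and \<open>B2\<close> of \<open>su\<close> read off the real and the
  imaginary part of that entry, and \<open>su_parseval\<close> gives 1 for each of them.\<close>

lemma su_basis_offdiag:
  fixes X :: "'m::finite \<Rightarrow> complex^'n^'n"
  assumes X: "su_orthonormal_basis X" and "j \<noteq> k"
  shows "(\<Sum>a\<in>UNIV. (X a $ j $ k) * (X a $ k $ j)) = -2"
proof -
  define E :: "'n \<Rightarrow> 'n \<Rightarrow> complex \<Rightarrow> complex^'n^'n"
    where "E i l c = (\<chi> r s. if r = i \<and> s = l then c else 0)" for i l c
  have E: "su_inner A (E i l c) = cnj (A $ i $ l) * c / 2" for A i l c
  proof -
    have "(\<Sum>s\<in>UNIV. \<Sum>r\<in>UNIV. cnj (A $ r $ s) * E i l c $ r $ s)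
        = (\<Sum>s\<in>UNIV. if s = l then cnj (A $ i $ l) * c else 0)"
      by (intro sum.cong refl) (auto simp: E_def if_distrib[of "\<lambda>x. _ * x"] sum.delta' cong: if_cong)
    then show ?thesis by (simp add: su_inner_eq_sum)
  qed
  define B1 where "B1 = E j k 1 + E k j (-1)"
  define B2 where "B2 = E j k \<i> + E k j \<i>"
  have B: "B1 \<in> su" "B2 \<in> su"
    using \<open>j \<noteq> k\<close>
    by (auto simp: su_def B1_def B2_def E_def trace_def conj_transpose_def map_matrix_def
        transpose_def vec_eq_iff intro!: sum.neutral)
  have i1: "su_inner A B1 = of_real (Re (A $ j $ k))"
    and i2: "su_inner A B2 = of_real (Im (A $ j $ k))" if "A \<in> su" for A
    using su_entry[OF that, of j k]
    by (simp_all add: B1_def B2_def su_inner_add_right E complex_eq_iff)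
  have inn: "su_inner B1 B1 = 1" "su_inner B2 B2 = 1"
    using i1[OF B(1)] i2[OF B(2)] \<open>j \<noteq> k\<close> by (auto simp: B1_def B2_def E_def)
  have Xsu: "X a \<in> su" for a using X by (simp add: su_orthonormal_basis_def)
  have "X a $ j $ k * X a $ k $ j = - ((su_inner (X a) B1)\<^sup>2 + (su_inner (X a) B2)\<^sup>2)" for a
    using su_entry[OF Xsu, of a j k]
    by (simp add: i1 i2 Xsu complex_eq_iff power2_eq_square)
  then have "(\<Sum>a\<in>UNIV. (X a $ j $ k) * (X a $ k $ j))
      = - ((\<Sum>a\<in>UNIV. (su_inner (X a) B1)\<^sup>2) + (\<Sum>a\<in>UNIV. (su_inner (X a) B2)\<^sup>2))"
    by (simp add: sum_negf sum.distrib sum_subtractf)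
  then show ?thesis
    by (simp add: su_parseval[OF X] B inn)
qed

lemma su_basis_diag:
  fixes X :: "'m::finite \<Rightarrow> complex^'n^'n"
  assumes X: "su_orthonormal_basis X"
  shows "(\<Sum>a\<in>UNIV. (Im (X a $ j $ j))\<^sup>2) = 2 * (1 - 1 / real CARD('n))"
proof -
  \<comment> \<open>\<open>D\<close> is the traceless part of \<open>\<i>\<close> times the
    \<open>j\<close>-th diagonal matrix unit. Its scalar part is orthogonal to traceless matrices,
    so pairing with \<open>D\<close> gives half of \<open>Im (A $ j $ j)\<close>. \<open>D\<close>
    is not normalized: its inner square is half of 1 - 1/n.\<close>
  define d :: "'n \<Rightarrow> complex"
    where "d r = (if r = j then \<i> else 0) - \<i> / of_nat CARD('n)" for r
  define D :: "complex^'n^'n" where "D = (\<chi> r s. if r = s then d r else 0)"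
  have D: "D \<in> su"
    by (auto simp: D_def d_def su_def trace_def conj_transpose_def map_matrix_def
        transpose_def vec_eq_iff sum_subtractf)
  have inn: "su_inner A D = of_real (Im (A $ j $ j) / 2)" if A: "A \<in> su" for A
  proof -
    have tr: "(\<Sum>r\<in>UNIV. A $ r $ r) = 0" using A by (simp add: su_def trace_def)
    have "(\<Sum>s\<in>UNIV. \<Sum>r\<in>UNIV. cnj (A $ r $ s) * D $ r $ s)
        = (\<Sum>s\<in>UNIV. cnj (A $ s $ s) * d s)"
      by (intro sum.cong refl) (simp add: D_def if_distrib[of "\<lambda>x. _ * x"] cong: if_cong)
    also have "\<dots> = (\<Sum>s\<in>UNIV. (if s = j then \<i> * cnj (A $ j $ j) else 0)
        - \<i> / of_nat CARD('n) * cnj (A $ s $ s))"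
      by (intro sum.cong refl) (simp add: d_def algebra_simps)
    also have "\<dots> = \<i> * cnj (A $ j $ j) - \<i> / of_nat CARD('n) * cnj (\<Sum>s\<in>UNIV. A $ s $ s)"
      by (simp add: sum_subtractf sum_distrib_left)
    finally show ?thesis
      using su_diag[OF A, of j] tr by (simp add: su_inner_eq_sum complex_eq_iff)
  qed
  have Xsu: "X a \<in> su" for a using X by (simp add: su_orthonormal_basis_def)
  have "(\<Sum>a\<in>UNIV. (of_real (Im (X a $ j $ j) / 2))\<^sup>2) = (of_real (Im (D $ j $ j) / 2) :: complex)"
    using su_parseval[OF X D] by (simp add: inn Xsu D)
  also have "Im (D $ j $ j) = 1 - 1 / real CARD('n)"
    by (simp add: D_def d_def)
  finally have "of_real (\<Sum>a\<in>UNIV. (Im (X a $ j $ j) / 2)\<^sup>2)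
      = (of_real ((1 - 1 / real CARD('n)) / 2) :: complex)"
    by simp
  then have "(\<Sum>a\<in>UNIV. (Im (X a $ j $ j) / 2)\<^sup>2) = (1 - 1 / real CARD('n)) / 2"
    by (rule of_real_eq_iff[THEN iffD1])
  then show ?thesis
    by (simp add: power_divide sum_divide_distrib[symmetric] field_simps)
qed

section \<open>The drift of the squared modulus and its sign\<close>

lemma Re_cnj_drift:
  fixes X :: "'m::finite \<Rightarrow> complex^'n^'n"
  assumes X: "su_orthonormal_basis X" and J: "\<And>a. J a = 0"
  shows "Re (cnj (l $ j) * drift_coeff X K J l j)
    = (cmod (l $ j))\<^sup>2 * (4 * (\<Sum>k\<in>UNIV - {j}. Re (l $ k / (l $ k - l $ j)))
        - 2 * ((real CARD('n))\<^sup>2 - 1) / real CARD('n))"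
proof -
  have Xsu: "X a \<in> su" for a using X by (simp add: su_orthonormal_basis_def)
  have sp: "scalar_product (axis j 1) ((X a ** Omega_mat l j ** X a) *v axis j 1)
      = (\<Sum>k\<in>UNIV - {j}. (X a $ j $ k * X a $ k $ j) * (l $ k / (l $ k - l $ j)))" for a
  proof -
    have "scalar_product (axis j 1) ((X a ** Omega_mat l j ** X a) *v axis j 1)
        = (X a ** Omega_mat l j ** X a) $ j $ j"
      by (simp add: scalar_product_def matrix_vector_mult_def axis_def if_distrib[of "\<lambda>x. _ * x"]
          if_distrib[of "\<lambda>x. x * _"] cong: if_cong)
    also have "\<dots> = (\<Sum>k\<in>UNIV. (if k \<noteq> j then X a $ j $ k * (l $ k / (l $ k - l $ j)) else 0) * X a $ k $ j)"
    proof -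
      have "Omega_mat l j $ i $ k = (if i = k then if k \<noteq> j then l $ k / (l $ k - l $ j) else 0 else 0)" for i k
        by (simp add: Omega_mat_def)
      then have "(X a ** Omega_mat l j) $ j $ k = (if k \<noteq> j then X a $ j $ k * (l $ k / (l $ k - l $ j)) else 0)" for k
        by (simp add: matrix_matrix_mult_def if_distrib[of "\<lambda>x. _ * x"] sum.delta cong: if_cong)
      then show ?thesis
        by (subst matrix_matrix_mult_def) simp
    qed
    also have "\<dots> = (\<Sum>k\<in>UNIV - {j}. X a $ j $ k * (l $ k / (l $ k - l $ j)) * X a $ k $ j)"
      by (intro sum.mono_neutral_cong_right) auto
    finally show ?thesis by (simp add: mult.commute mult.left_commute)
  qed
  have "(\<Sum>a\<in>UNIV. 2 * scalar_product (axis j 1) ((X a ** Omega_mat l j ** X a) *v axis j 1))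
      = 2 * (\<Sum>k\<in>UNIV - {j}. (\<Sum>a\<in>UNIV. X a $ j $ k * X a $ k $ j) * (l $ k / (l $ k - l $ j)))"
    unfolding sp sum_distrib_left sum_distrib_right by (rule sum.swap)
  \<comment> \<open>The factor 2 in the drift meets the value -2 from completeness; the sign in
    front of the bracket in \<open>drift_coeff\<close> turns the result into +4.\<close>
  also have "\<dots> = - 4 * (\<Sum>k\<in>UNIV - {j}. l $ k / (l $ k - l $ j))"
    by (simp add: su_basis_offdiag[OF X] sum_distrib_left)
  finally have sp4: "(\<Sum>a\<in>UNIV. 2 * scalar_product (axis j 1) ((X a ** Omega_mat l j ** X a) *v axis j 1))
      = - 4 * (\<Sum>k\<in>UNIV - {j}. l $ k / (l $ k - l $ j))" .
  let ?c = "2 * ((real CARD('n))\<^sup>2 - 1) / real CARD('n)"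
  have "cnj (l $ j) * drift_coeff X K J l j
      = of_real ((cmod (l $ j))\<^sup>2) * (- (\<Sum>a\<in>UNIV. of_real (K a) * X a $ j $ j)
          + 4 * (\<Sum>k\<in>UNIV - {j}. l $ k / (l $ k - l $ j)) - of_real ?c)"
    unfolding drift_coeff_def complex_norm_square sum.distrib sp4 J by (simp add: algebra_simps)
  \<comment> \<open>\<open>K a\<close> is real and the diagonal entries are imaginary, so
    \<open>K\<close> disappears whatever its values are. A nonzero \<open>J a\<close>, multiplied by
    \<open>\<i>\<close>, would leave a real term.\<close>
  moreover have "Re (\<Sum>a\<in>UNIV. of_real (K a) * X a $ j $ j) = 0"
    unfolding Re_sum using su_entry[OF Xsu, of _ j j] by (intro sum.neutral ballI) (simp add: complex_eq_iff)
  ultimately show ?thesis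
    by (simp del: of_real_divide of_real_mult of_real_diff of_real_power)
qed

text \<open>The left side is the real part of \<open>(z + w) / (z - w)\<close>, and the real part of
  \<open>(z + w) * cnj (z - w)\<close> is the difference of the squared moduli. Subtracting 1 is
  what makes the expression antisymmetric in \<open>z\<close> and \<open>w\<close>.\<close>

lemma two_Re_quotient:
  assumes "z \<noteq> w"
  shows "2 * Re (z / (z - w)) - 1 = ((cmod z)\<^sup>2 - (cmod w)\<^sup>2) / (cmod (z - w))\<^sup>2"
proof -
  have "(Re z - Re w)\<^sup>2 + (Im z - Im w)\<^sup>2 \<noteq> 0"
    using assms by (simp add: sum_power2_eq_zero_iff complex_eq_iff)
  then show ?thesis
    unfolding cmod_power2 by (simp add: Re_divide divide_simps) (simp add: algebra_simps power2_eq_square)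
qed

text \<open>The drift of \<open>\<bar>\<lambda>\<^sub>j\<bar>\<^sup>2\<close> according to Ito's formula, with Ito correction
  \<open>2 N \<bar>\<lambda>\<^sub>j\<bar>\<^sup>2 (\<Sum>a. \<bar>X a $ j $ j\<bar>\<^sup>2)\<close>.\<close>

definition norm_rate :: "real \<Rightarrow> complex^'n \<Rightarrow> 'n \<Rightarrow> real" where
  "norm_rate N l j = N * (cmod (l $ j))\<^sup>2 * (2 * (4 * (\<Sum>k\<in>UNIV - {j}. Re (l $ k / (l $ k - l $ j)))
      - 2 * ((real CARD('n))\<^sup>2 - 1) / real CARD('n)) + 4 * (1 - 1 / real CARD('n)))"

text \<open>This continuity, together with the absence of \<open>K\<close> from
  \<open>norm_rate\<close>, later yields a derivative at every time and not just at almost every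
  time.\<close>

lemma continuous_on_norm_rate:
  assumes "continuous_on S l" and "\<And>s. s \<in> S \<Longrightarrow> inj (\<lambda>k. l s $ k)"
  shows "continuous_on S (\<lambda>s. norm_rate N (l s) j)"
  unfolding norm_rate_def using assms by (intro continuous_intros) (auto dest: injD)

text \<open>Antisymmetry of the interaction: the pair of \<open>j\<close> and \<open>k\<close> contributes a negative multiple of
  \<open>(\<bar>\<lambda>\<^sub>k\<bar>\<^sup>2 - \<bar>\<lambda>\<^sub>j\<bar>\<^sup>2)\<^sup>2 / \<bar>\<lambda>\<^sub>k - \<lambda>\<^sub>j\<bar>\<^sup>2\<close>.\<close>

lemma sum_norm_rate_nonpos:
  fixes l :: "complex^'n"
  assumes inj: "inj (\<lambda>j. l $ j)" and "0 \<le> N"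
  shows "(\<Sum>j\<in>UNIV. norm_rate N l j) \<le> 0"
proof -
  let ?n = "real CARD('n)"
  define q where "q j = (cmod (l $ j))\<^sup>2" for j
  define g where "g j k = q j * ((q k - q j) / (cmod (l $ k - l $ j))\<^sup>2)" for j k
  have term_eq: "norm_rate N l j = 4 * N * (\<Sum>k\<in>UNIV. g j k)" for j
  proof -
    have "2 * Re (l $ k / (l $ k - l $ j)) - 1 = (q k - q j) / (cmod (l $ k - l $ j))\<^sup>2" if "k \<noteq> j" for k
      unfolding q_def using that injD[OF inj, of k j] by (intro two_Re_quotient) auto
    then have "(\<Sum>k\<in>UNIV - {j}. q j * (2 * Re (l $ k / (l $ k - l $ j)) - 1)) = (\<Sum>k\<in>UNIV - {j}. g j k)"
      by (intro sum.cong refl) (simp add: g_def)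
    \<comment> \<open>\<open>g j j = 0\<close>, so the sum may run over all indices, as the exchange
      of \<open>j\<close> and \<open>k\<close> below requires.\<close>
    also have "\<dots> = (\<Sum>k\<in>UNIV. g j k)"
      by (intro sum.mono_neutral_left) (auto simp: g_def)
    finally have *: "q j * (2 * (\<Sum>k\<in>UNIV - {j}. Re (l $ k / (l $ k - l $ j))) - (?n - 1)) = (\<Sum>k\<in>UNIV. g j k)"
      by (simp add: sum_distrib_left[symmetric] sum_subtractf card_Diff_singleton)
    define c d where "c = 2 * (?n\<^sup>2 - 1) / ?n" and "d = 4 * (1 - 1 / ?n)"
    \<comment> \<open>\<open>c\<close> is the constant of the drift and \<open>d\<close> the Ito
      correction. Together they leave -4 for each of the n - 1 other indices, which supplies the -1
      in \<open>two_Re_quotient\<close>.\<close>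
    have n: "- 2 * c + d = - 4 * (?n - 1)"
      by (simp add: c_def d_def field_simps power2_eq_square)
    have "norm_rate N l j
        = N * q j * (8 * (\<Sum>k\<in>UNIV - {j}. Re (l $ k / (l $ k - l $ j))) + (- 2 * c + d))"
      unfolding norm_rate_def q_def c_def[symmetric] d_def[symmetric] by (simp add: algebra_simps)
    also have "\<dots> = 4 * N * (q j * (2 * (\<Sum>k\<in>UNIV - {j}. Re (l $ k / (l $ k - l $ j))) - (?n - 1)))"
      unfolding n by (simp add: algebra_simps)
    finally show ?thesis unfolding * .
  qed
  have "2 * (\<Sum>j\<in>UNIV. \<Sum>k\<in>UNIV. g j k) = (\<Sum>j\<in>UNIV. \<Sum>k\<in>UNIV. g j k + g k j)"
    unfolding sum.distrib by (subst (2) sum.swap) simp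
  also have "\<dots> \<le> 0"
  proof (intro sum_nonpos)
    fix j k
    have "g j k + g k j = - ((q k - q j)\<^sup>2 / (cmod (l $ k - l $ j))\<^sup>2)"
      unfolding g_def norm_minus_commute[of "l $ j"]
      by (simp add: diff_divide_distrib[symmetric] add_divide_distrib[symmetric] power2_eq_square minus_divide_left algebra_simps)
    then show "g j k + g k j \<le> 0" by simp
  qed
  finally show ?thesis
    using \<open>0 \<le> N\<close> unfolding term_eq sum_distrib_left[symmetric] by (simp add: mult_le_0_iff)
qed

section \<open>Ito's formula along a path\<close>

definition grid :: "real \<Rightarrow> nat \<Rightarrow> nat \<Rightarrow> real" where
  "grid t n i = t * real i / real n"

lemma grid_0 [simp]: "grid t n 0 = 0"
  by (simp add: grid_def)

lemma grid_self [simp]: "0 < n \<Longrightarrow> grid t n n = t"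
  by (simp add: grid_def)

lemma grid_diff: "grid t n (Suc i) - grid t n i = t / real n"
  by (simp add: grid_def diff_divide_distrib[symmetric] algebra_simps)

lemma grid_mono: "0 \<le> t \<Longrightarrow> i \<le> j \<Longrightarrow> grid t n i \<le> grid t n j"
  by (simp add: grid_def divide_right_mono mult_left_mono)

lemma grid_nonneg: "0 \<le> t \<Longrightarrow> 0 \<le> grid t n i"
  by (simp add: grid_def)

lemma grid_le: "0 \<le> t \<Longrightarrow> i \<le> n \<Longrightarrow> grid t n i \<le> t"
  by (cases "n = 0") (use grid_mono[of t i n n] in \<open>auto simp: grid_def\<close>)

lemma grid_strict: "0 < t \<Longrightarrow> 0 < n \<Longrightarrow> grid t n i < grid t n (Suc i)"
  using grid_diff[of t n i] by (smt (verit) divide_pos_pos of_nat_0_less_iff)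

lemma sum_integral_grid:
  fixes h :: "real \<Rightarrow> 'b::banach"
  assumes h: "h integrable_on {0..t}" and t: "0 \<le> t" and n: "0 < n"
  shows "(\<Sum>i<n. integral {grid t n i..grid t n (Suc i)} h) = integral {0..t} h"
proof -
  have "(\<Sum>i<m. integral {grid t n i..grid t n (Suc i)} h) = integral {0..grid t n m} h" if "m \<le> n" for m
    using that
  proof (induction m)
    case (Suc m)
    have "integral {0..grid t n m} h + integral {grid t n m..grid t n (Suc m)} h
        = integral {0..grid t n (Suc m)} h"
    proof (rule Henstock_Kurzweil_Integration.integral_combine)
      show "h integrable_on {0..grid t n (Suc m)}"
        using grid_le[OF t Suc.prems] by (intro integrable_on_subinterval[OF h]) auto
    qed (use t grid_mono[of t m "Suc m" n] in \<open>auto simp: grid_nonneg\<close>)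
    with Suc show ?case by simp
  qed simp
  from this[of n] n show ?thesis by simp
qed

text \<open>\<open>f\<close> is only absolutely integrable, so each step keeps its exact integral
  and only the continuous weight is sampled at the left endpoint. The error is at most the modulus
  of continuity of \<open>\<phi>\<close> times the integral of the norm of \<open>f\<close>.\<close>

lemma Re_riemann_grid_tendsto:
  fixes \<phi> f :: "real \<Rightarrow> complex"
  assumes t: "0 \<le> t" and \<phi>: "continuous_on {0..t} \<phi>" and f: "f absolutely_integrable_on {0..t}"
    and G: "(\<lambda>s. Re (\<phi> s * f s)) integrable_on {0..t}"
  shows "(\<lambda>n. \<Sum>i<n. Re (\<phi> (grid t n i) * integral {grid t n i..grid t n (Suc i)} f))
    \<longlonglongrightarrow> integral {0..t} (\<lambda>s. Re (\<phi> s * f s))"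
proof (rule LIMSEQ_I)
  fix e :: real assume "0 < e"
  let ?G = "\<lambda>s. Re (\<phi> s * f s)"
  define A where "A = integral {0..t} (\<lambda>s. norm (f s))"
  have nf: "(\<lambda>s. norm (f s)) integrable_on {0..t}" and fi: "f integrable_on {0..t}"
    using f by (simp_all add: absolutely_integrable_on_def)
  have A: "0 \<le> A" unfolding A_def by (rule integral_nonneg[OF nf]) auto
  define \<epsilon> where "\<epsilon> = e / (A + 1)"
  have \<epsilon>: "0 < \<epsilon>" using \<open>0 < e\<close> A by (simp add: \<epsilon>_def)
  have "uniformly_continuous_on {0..t} \<phi>"
    by (rule compact_uniformly_continuous[OF \<phi>]) simp
  with \<epsilon> obtain d where d: "0 < d" "\<And>s s'. s \<in> {0..t} \<Longrightarrow> s' \<in> {0..t} \<Longrightarrow> dist s' s < d \<Longrightarrow> dist (\<phi> s') (\<phi> s) < \<epsilon>"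
    unfolding uniformly_continuous_on_def by metis
  obtain N :: nat where N: "t / d < real N" using reals_Archimedean2 by blast
  show "\<exists>no. \<forall>n\<ge>no. norm ((\<Sum>i<n. Re (\<phi> (grid t n i) * integral {grid t n i..grid t n (Suc i)} f)) - integral {0..t} ?G) < e"
  proof (intro exI[of _ "Suc N"] allI impI)
    fix n assume n: "Suc N \<le> n"
    then have "0 < n" by simp
    have "t / d < real n" using N n by (auto intro: less_trans)
    then have mesh: "t / real n < d" using d(1) \<open>0 < n\<close> by (simp add: field_simps)
    have blk: "norm (Re (\<phi> (grid t n i) * integral {grid t n i..grid t n (Suc i)} f) - integral {grid t n i..grid t n (Suc i)} ?G)
        \<le> \<epsilon> * integral {grid t n i..grid t n (Suc i)} (\<lambda>s. norm (f s))" (is "norm (Re (?z * integral ?I f) - _) \<le> _")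
      if i: "i < n" for i
    proof -
      have sub: "?I \<subseteq> {0..t}" using i t by (auto intro: order_trans[OF grid_nonneg[OF t]] order_trans[OF _ grid_le[OF t, of "Suc i" n]])
      have fI: "f integrable_on ?I" and nfI: "(\<lambda>s. norm (f s)) integrable_on ?I" and GI: "?G integrable_on ?I"
        using integrable_on_subinterval[OF fi sub] integrable_on_subinterval[OF nf sub] integrable_on_subinterval[OF G sub] by auto
      have "((\<lambda>s. Re (?z * f s)) has_integral Re (?z * integral ?I f)) ?I"
        by (intro has_integral_Re has_integral_mult_right integrable_integral fI)
      then have zi: "(\<lambda>s. Re (?z * f s)) integrable_on ?I" "integral ?I (\<lambda>s. Re (?z * f s)) = Re (?z * integral ?I f)"
        by (auto simp: has_integral_iff)
      have "norm (integral ?I (\<lambda>s. Re (?z * f s) - ?G s)) \<le> integral ?I (\<lambda>s. \<epsilon> * norm (f s))"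
      proof (rule integral_norm_bound_integral)
        fix s assume s: "s \<in> ?I"
        have "dist s (grid t n i) \<le> t / real n" using s grid_diff[of t n i] by (auto simp: dist_real_def)
        moreover have "s \<in> {0..t}" using s sub by auto
        ultimately have "dist (\<phi> (grid t n i)) (\<phi> s) < \<epsilon>"
          using mesh i by (intro d(2)) (auto simp: dist_commute grid_nonneg t grid_le)
        then have "norm ((?z - \<phi> s) * f s) \<le> \<epsilon> * norm (f s)"
          by (simp add: norm_mult dist_norm mult_right_mono)
        then show "norm (Re (?z * f s) - ?G s) \<le> \<epsilon> * norm (f s)"
          using abs_Re_le_cmod[of "(?z - \<phi> s) * f s"] by (simp add: algebra_simps)
      next
        show "(\<lambda>s. \<epsilon> * norm (f s)) integrable_on ?I"
          using integrable_cmul[OF nfI, of \<epsilon>] by simp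
      qed (intro integrable_diff zi GI)
      then show ?thesis
        by (simp only: Henstock_Kurzweil_Integration.integral_diff[OF zi(1) GI] zi(2)
            Henstock_Kurzweil_Integration.integral_mult_right)
    qed
    have "norm ((\<Sum>i<n. Re (\<phi> (grid t n i) * integral {grid t n i..grid t n (Suc i)} f)) - integral {0..t} ?G)
        = norm (\<Sum>i<n. Re (\<phi> (grid t n i) * integral {grid t n i..grid t n (Suc i)} f) - integral {grid t n i..grid t n (Suc i)} ?G)"
      by (simp only: sum_subtractf sum_integral_grid[OF G t \<open>0 < n\<close>])
    also have "\<dots> \<le> (\<Sum>i<n. \<epsilon> * integral {grid t n i..grid t n (Suc i)} (\<lambda>s. norm (f s)))"
      by (rule order_trans[OF norm_sum sum_mono]) (use blk in auto)
    also have "\<dots> = \<epsilon> * A"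
      by (simp add: sum_distrib_left[symmetric] sum_integral_grid[OF nf t \<open>0 < n\<close>] A_def)
    also have "\<dots> < e" using \<open>0 < e\<close> A by (simp add: \<epsilon>_def field_simps)
    finally show "norm ((\<Sum>i<n. Re (\<phi> (grid t n i) * integral {grid t n i..grid t n (Suc i)} f)) - integral {0..t} ?G) < e" .
  qed
qed

lemma L2_set_norm_triangle:
  "L2_set (\<lambda>i. norm (x i + y i)) I \<le> L2_set (\<lambda>i. norm (x i)) I + L2_set (\<lambda>i. norm (y i)) I"
  by (rule order_trans[OF L2_set_mono L2_set_triangle_ineq]) (auto intro: norm_triangle_ineq)

text \<open>The drift part has vanishing quadratic variation: the sum of squares is bounded by the
  largest increment times the integral of the norm of \<open>f\<close>, and the largest increment
  tends to 0 by uniform continuity of the indefinite integral.\<close>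

lemma L2_set_integral_grid_tendsto_0:
  fixes f :: "real \<Rightarrow> complex"
  assumes t: "0 \<le> t" and f: "f absolutely_integrable_on {0..t}"
  shows "(\<lambda>n. L2_set (\<lambda>i. norm (integral {grid t n i..grid t n (Suc i)} f)) {..<n}) \<longlonglongrightarrow> 0"
proof -
  define A where "A = integral {0..t} (\<lambda>s. norm (f s))"
  have nf: "(\<lambda>s. norm (f s)) integrable_on {0..t}" and fi: "f integrable_on {0..t}"
    using f by (simp_all add: absolutely_integrable_on_def)
  have A: "0 \<le> A" unfolding A_def by (rule integral_nonneg[OF nf]) auto
  let ?d = "\<lambda>n i. integral {grid t n i..grid t n (Suc i)} f"
  have sub: "{grid t n i..grid t n (Suc i)} \<subseteq> {0..t}" if "i < n" for n i
    using that t by (auto intro: order_trans[OF grid_nonneg[OF t]] order_trans[OF _ grid_le[OF t, of "Suc i" n]])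
  have "(\<lambda>n. \<Sum>i<n. (norm (?d n i))\<^sup>2) \<longlonglongrightarrow> 0"
  proof (rule LIMSEQ_I)
    fix e :: real assume "0 < e"
    define \<epsilon> where "\<epsilon> = e / (A + 1)"
    have \<epsilon>: "0 < \<epsilon>" using \<open>0 < e\<close> A by (simp add: \<epsilon>_def)
    have "uniformly_continuous_on {0..t} (\<lambda>s. integral {0..s} f)"
      by (rule compact_uniformly_continuous[OF indefinite_integral_continuous_1[OF fi]]) simp
    with \<epsilon> obtain d where d: "0 < d" "\<And>s s'. s \<in> {0..t} \<Longrightarrow> s' \<in> {0..t} \<Longrightarrow> dist s' s < d
        \<Longrightarrow> dist (integral {0..s'} f) (integral {0..s} f) < \<epsilon>"
      unfolding uniformly_continuous_on_def by metis
    obtain N :: nat where N: "t / d < real N" using reals_Archimedean2 by blast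
    show "\<exists>no. \<forall>n\<ge>no. norm ((\<Sum>i<n. (norm (?d n i))\<^sup>2) - 0) < e"
    proof (intro exI[of _ "Suc N"] allI impI)
      fix n assume n: "Suc N \<le> n"
      then have "0 < n" by simp
      have "t / d < real n" using N n by (auto intro: less_trans)
      then have mesh: "t / real n < d" using d(1) \<open>0 < n\<close> by (simp add: field_simps)
      have "(norm (?d n i))\<^sup>2 \<le> \<epsilon> * integral {grid t n i..grid t n (Suc i)} (\<lambda>s. norm (f s))" if i: "i < n" for i
      proof -
        have "integral {0..grid t n i} f + ?d n i = integral {0..grid t n (Suc i)} f"
          using grid_le[OF t, of "Suc i" n] i t grid_mono[of t i "Suc i" n]
          by (intro Henstock_Kurzweil_Integration.integral_combine integrable_on_subinterval[OF fi])
             (auto simp: grid_nonneg)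
        moreover have "dist (integral {0..grid t n (Suc i)} f) (integral {0..grid t n i} f) < \<epsilon>"
          using mesh i t grid_diff[of t n i] grid_le[OF t, of "Suc i" n] grid_le[OF t, of i n]
          by (intro d(2)) (auto simp: grid_nonneg dist_real_def)
        ultimately have "norm (?d n i) \<le> \<epsilon>"
          by (simp add: dist_norm) (metis add_diff_cancel_left' less_imp_le)
        moreover have "norm (?d n i) \<le> integral {grid t n i..grid t n (Suc i)} (\<lambda>s. norm (f s))"
          using sub[OF i] by (intro integral_norm_bound_integral integrable_on_subinterval[OF fi]
              integrable_on_subinterval[OF nf]) auto
        ultimately show ?thesis
          unfolding power2_eq_square by (intro mult_mono) (use \<epsilon> in auto)
      qed
      then have "(\<Sum>i<n. (norm (?d n i))\<^sup>2) \<le> (\<Sum>i<n. \<epsilon> * integral {grid t n i..grid t n (Suc i)} (\<lambda>s. norm (f s)))"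
        by (intro sum_mono) auto
      also have "\<dots> = \<epsilon> * A"
        by (simp add: sum_distrib_left[symmetric] sum_integral_grid[OF nf t \<open>0 < n\<close>] A_def)
      also have "\<dots> < e" using \<open>0 < e\<close> A by (simp add: \<epsilon>_def field_simps)
      finally show "norm ((\<Sum>i<n. (norm (?d n i))\<^sup>2) - 0) < e"
        by (simp add: sum_nonneg)
    qed
  qed
  from tendsto_real_sqrt[OF this] show ?thesis by (simp add: L2_set_def)
qed

text \<open>Ito's formula for \<open>dL = \<i> k dY + f dt\<close> and \<open>dY = L dB\<close>. In the expansion of
  \<open>\<bar>L + dL\<bar>\<^sup>2\<close>, the assumption \<open>R1\<close> removes the first order term of the noise, and \<open>R2\<close>, \<open>R3\<close>
  determine its quadratic variation.\<close>

lemma norm_square_increment_pathwise: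
  fixes L Y f :: "real \<Rightarrow> complex" and B :: "real \<Rightarrow> real" and r :: "nat \<Rightarrow> nat"
  assumes t: "0 < t" and L: "continuous_on {0..t} L" and f: "f absolutely_integrable_on {0..t}"
    and G: "(\<lambda>s. Re (cnj (L s) * f s)) integrable_on {0..t}"
    and eq: "\<And>s. 0 \<le> s \<Longrightarrow> s \<le> t \<Longrightarrow> L s = L 0 + \<i> * of_real k * Y s + integral {0..s} f"
    and r: "filterlim r at_top sequentially"
    and R1: "(\<lambda>m. \<Sum>i<r m. Im (cnj (L (grid t (r m) i)) * (Y (grid t (r m) (Suc i)) - Y (grid t (r m) i)))) \<longlonglongrightarrow> 0"
    and R2: "(\<lambda>m. L2_set (\<lambda>i. norm (Y (grid t (r m) (Suc i)) - Y (grid t (r m) i)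
        - L (grid t (r m) i) * of_real (B (grid t (r m) (Suc i)) - B (grid t (r m) i)))) {..<r m}) \<longlonglongrightarrow> 0"
    and R3: "(\<lambda>m. \<Sum>i<r m. (norm (L (grid t (r m) i)))\<^sup>2 *
        ((B (grid t (r m) (Suc i)) - B (grid t (r m) i))\<^sup>2 - v * (t / real (r m)))) \<longlonglongrightarrow> 0"
  shows "(norm (L t))\<^sup>2 - (norm (L 0))\<^sup>2
    = 2 * integral {0..t} (\<lambda>s. Re (cnj (L s) * f s)) + k\<^sup>2 * v * integral {0..t} (\<lambda>s. (norm (L s))\<^sup>2)"
proof -
  define p where "p m i = grid t (r m) i" for m i
  define dY where "dY m i = Y (p m (Suc i)) - Y (p m i)" for m i
  define dB where "dB m i = B (p m (Suc i)) - B (p m i)" for m i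
  define dL where "dL m i = L (p m (Suc i)) - L (p m i)" for m i
  define d where "d m i = integral {p m i..p m (Suc i)} f" for m i
  note defs = p_def dY_def dB_def dL_def d_def
  let ?V = "integral {0..t} (\<lambda>s. (norm (L s))\<^sup>2)"
  have t0: "0 \<le> t" using t by simp
  have fi: "f integrable_on {0..t}" using f by (simp add: absolutely_integrable_on_def)
  have dL: "dL m i = \<i> * of_real k * dY m i + d m i" if i: "i < r m" for m i
  proof -
    have "integral {0..p m i} f + d m i = integral {0..p m (Suc i)} f"
      unfolding d_def p_def
      using grid_le[OF t0, of "Suc i" "r m"] i t grid_mono[of t i "Suc i" "r m"]
      by (intro Henstock_Kurzweil_Integration.integral_combine integrable_on_subinterval[OF fi])
         (auto simp: grid_nonneg)
    then show ?thesis
      using eq[of "p m i"] eq[of "p m (Suc i)"] i t0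
      by (simp add: dL_def dY_def p_def grid_nonneg grid_le) (simp add: algebra_simps)
  qed
  have S2: "(\<lambda>m. \<Sum>i<r m. Re (cnj (L (p m i)) * d m i)) \<longlonglongrightarrow> integral {0..t} (\<lambda>s. Re (cnj (L s) * f s))"
    using filterlim_compose[OF Re_riemann_grid_tendsto[OF t0 continuous_on_cnj[OF L] f G] r]
    by (simp add: defs)
  \<comment> \<open>The same convergence with integrand 1 and the squared norm of \<open>L\<close>
    as weight.\<close>
  have S2': "(\<lambda>m. \<Sum>i<r m. (norm (L (p m i)))\<^sup>2 * (t / real (r m))) \<longlonglongrightarrow> ?V"
  proof -
    have "(\<lambda>n. \<Sum>i<n. Re (of_real ((norm (L (grid t n i)))\<^sup>2) * integral {grid t n i..grid t n (Suc i)} (\<lambda>_. 1)))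
        \<longlonglongrightarrow> integral {0..t} (\<lambda>s. Re (of_real ((norm (L s))\<^sup>2) * 1))"
      by (intro Re_riemann_grid_tendsto t0 continuous_intros L absolutely_integrable_on_const integrable_continuous_interval)
         (auto intro!: integrable_continuous_interval continuous_intros L)
    moreover have I1: "integral {grid t n i..grid t n (Suc i)} (\<lambda>_. 1 :: complex) = of_real (t / real n)" for n i
      using grid_mono[OF t0, of i "Suc i" n] grid_diff[of t n i] by (simp add: scaleR_conv_of_real[where 'a=complex])
    ultimately have "(\<lambda>n. \<Sum>i<n. (norm (L (grid t n i)))\<^sup>2 * (t / real n)) \<longlonglongrightarrow> ?V"
      by (simp only: I1 of_real_mult[symmetric] Re_complex_of_real mult_1_right)
    from filterlim_compose[OF this r] show ?thesis by (simp add: p_def)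
  qed
  have S3: "(\<lambda>m. \<Sum>i<r m. (norm (dL m i))\<^sup>2) \<longlonglongrightarrow> k\<^sup>2 * v * ?V"
  proof -
    \<comment> \<open>\<open>a\<close> is the noise increment with frozen coefficient;
      \<open>b\<close> collects the one-step error of the stochastic integral and the drift. Since
      \<open>b\<close> tends to 0 in l2, the triangle inequality in both directions gives
      \<open>dL\<close> the same l2 limit as \<open>a\<close>, without any look at mixed
      products.\<close>
    define a where "a m i = \<i> * of_real k * L (p m i) * of_real (dB m i)" for m i
    define b where "b m i = \<i> * of_real k * (dY m i - L (p m i) * of_real (dB m i)) + d m i" for m i
    have dLab: "dL m i = a m i + b m i" if "i < r m" for m i
      unfolding dL[OF that] a_def b_def by (simp add: algebra_simps)
    have "(\<lambda>m. k\<^sup>2 * ((\<Sum>i<r m. (norm (L (p m i)))\<^sup>2 * ((dB m i)\<^sup>2 - v * (t / real (r m))))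
        + v * (\<Sum>i<r m. (norm (L (p m i)))\<^sup>2 * (t / real (r m))))) \<longlonglongrightarrow> k\<^sup>2 * (0 + v * ?V)"
      by (intro tendsto_intros S2') (use R3 in \<open>simp add: defs\<close>)
    moreover have "k\<^sup>2 * ((\<Sum>i<n. (norm (L (p m i)))\<^sup>2 * ((dB m i)\<^sup>2 - v * c))
        + v * (\<Sum>i<n. (norm (L (p m i)))\<^sup>2 * c)) = (\<Sum>i<n. (norm (a m i))\<^sup>2)" for m n c
      unfolding sum_distrib_left sum.distrib[symmetric]
      by (intro sum.cong refl) (simp add: a_def norm_mult power_mult_distrib algebra_simps)
    ultimately have "(\<lambda>m. \<Sum>i<r m. (norm (a m i))\<^sup>2) \<longlonglongrightarrow> k\<^sup>2 * v * ?V"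
      by (simp only: mult.assoc add_0_left)
    from tendsto_real_sqrt[OF this]
    have La: "(\<lambda>m. L2_set (\<lambda>i. norm (a m i)) {..<r m}) \<longlonglongrightarrow> sqrt (k\<^sup>2 * v * ?V)"
      by (simp add: L2_set_def)
    have Lb: "(\<lambda>m. L2_set (\<lambda>i. norm (b m i)) {..<r m}) \<longlonglongrightarrow> 0"
    proof (rule tendsto_sandwich[OF _ _ tendsto_const])
      let ?U = "\<lambda>m. \<bar>k\<bar> * L2_set (\<lambda>i. norm (dY m i - L (p m i) * of_real (dB m i))) {..<r m}
          + L2_set (\<lambda>i. norm (d m i)) {..<r m}"
      have "L2_set (\<lambda>i. norm (b m i)) {..<r m} \<le> ?U m" for m
        unfolding b_def
        by (rule order_trans[OF L2_set_norm_triangle]) (simp add: norm_mult L2_set_right_distrib)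
      then show "\<forall>\<^sub>F m in sequentially. L2_set (\<lambda>i. norm (b m i)) {..<r m} \<le> ?U m" by simp
      have "(\<lambda>m. L2_set (\<lambda>i. norm (d m i)) {..<r m}) \<longlonglongrightarrow> 0"
        using filterlim_compose[OF L2_set_integral_grid_tendsto_0[OF t0 f] r] by (simp add: defs)
      then have "?U \<longlonglongrightarrow> \<bar>k\<bar> * 0 + 0"
        by (intro tendsto_intros) (use R2 in \<open>simp_all add: defs\<close>)
      then show "?U \<longlonglongrightarrow> 0" by simp
    qed (simp add: L2_set_nonneg)
    have "(\<lambda>m. L2_set (\<lambda>i. norm (dL m i)) {..<r m}) \<longlonglongrightarrow> sqrt (k\<^sup>2 * v * ?V)"
    proof (rule tendsto_sandwich)
      have dLab2: "L2_set (\<lambda>i. norm (dL m i)) {..<r m} = L2_set (\<lambda>i. norm (a m i + b m i)) {..<r m}"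
        "L2_set (\<lambda>i. norm (dL m i - b m i)) {..<r m} = L2_set (\<lambda>i. norm (a m i)) {..<r m}" for m
        by (intro L2_set_cong; auto simp: dLab)+
      let ?a = "\<lambda>m. L2_set (\<lambda>i. norm (a m i)) {..<r m}" and ?b = "\<lambda>m. L2_set (\<lambda>i. norm (b m i)) {..<r m}"
      have "L2_set (\<lambda>i. norm (dL m i)) {..<r m} \<le> ?a m + ?b m" for m
        unfolding dLab2 by (rule L2_set_norm_triangle)
      then show "\<forall>\<^sub>F m in sequentially. L2_set (\<lambda>i. norm (dL m i)) {..<r m} \<le> ?a m + ?b m" by simp
      have "?a m \<le> L2_set (\<lambda>i. norm (dL m i)) {..<r m} + ?b m" for m
        using L2_set_norm_triangle[of "dL m" "\<lambda>i. - b m i" "{..<r m}"]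
        by (simp add: dLab2)
      then show "\<forall>\<^sub>F m in sequentially. ?a m - ?b m \<le> L2_set (\<lambda>i. norm (dL m i)) {..<r m}"
        by (simp add: algebra_simps)
      show "(\<lambda>m. ?a m - ?b m) \<longlonglongrightarrow> sqrt (k\<^sup>2 * v * ?V)" "(\<lambda>m. ?a m + ?b m) \<longlonglongrightarrow> sqrt (k\<^sup>2 * v * ?V)"
        using tendsto_diff[OF La Lb] tendsto_add[OF La Lb] by simp_all
    qed
    from tendsto_power[OF this, of 2]
    have "(\<lambda>m. \<Sum>i<r m. (norm (dL m i))\<^sup>2) \<longlonglongrightarrow> (sqrt (k\<^sup>2 * v * ?V))\<^sup>2"
      by (simp add: L2_set_def sum_nonneg)
    \<comment> \<open>The sign of \<open>v\<close> is not known here. Being a limit of sums of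
      squares makes the product nonnegative, which is needed to undo the square root.\<close>
    moreover have "0 \<le> k\<^sup>2 * v * ?V"
      using \<open>(\<lambda>m. \<Sum>i<r m. (norm (a m i))\<^sup>2) \<longlonglongrightarrow> k\<^sup>2 * v * ?V\<close>
      by (rule LIMSEQ_le_const) (auto intro!: sum_nonneg)
    ultimately show ?thesis by simp
  qed
  \<comment> \<open>Twice the real part of \<open>cnj L * (\<i> * k * dY)\<close> is
    \<open>- 2 * k * Im (cnj L * dY)\<close>: at first order the noise enters only through an
    imaginary part.\<close>
  have "(\<lambda>m. - 2 * k * (\<Sum>i<r m. Im (cnj (L (p m i)) * dY m i)) + 2 * (\<Sum>i<r m. Re (cnj (L (p m i)) * d m i))
      + (\<Sum>i<r m. (norm (dL m i))\<^sup>2))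
      \<longlonglongrightarrow> - 2 * k * 0 + 2 * integral {0..t} (\<lambda>s. Re (cnj (L s) * f s)) + k\<^sup>2 * v * ?V"
    by (intro tendsto_intros S2 S3) (use R1 in \<open>simp add: defs\<close>)
  moreover have "\<forall>\<^sub>F m in sequentially. - 2 * k * (\<Sum>i<r m. Im (cnj (L (p m i)) * dY m i))
      + 2 * (\<Sum>i<r m. Re (cnj (L (p m i)) * d m i)) + (\<Sum>i<r m. (norm (dL m i))\<^sup>2)
      = (norm (L t))\<^sup>2 - (norm (L 0))\<^sup>2"
    \<comment> \<open>Once \<open>r m\<close> is at least 1 the grid ends exactly at
      \<open>t\<close>; with 0 steps \<open>grid\<close> is constantly 0.\<close>
    using filterlim_at_top[THEN iffD1, OF r, rule_format, of 1]
  proof eventually_elim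
    case (elim m)
    have "- 2 * k * Im (cnj (L (p m i)) * dY m i) + 2 * Re (cnj (L (p m i)) * d m i) + (norm (dL m i))\<^sup>2
        = (norm (L (p m (Suc i))))\<^sup>2 - (norm (L (p m i)))\<^sup>2" if "i < r m" for i
    proof -
      have "(norm (L (p m (Suc i))))\<^sup>2 - (norm (L (p m i)))\<^sup>2 = 2 * Re (cnj (L (p m i)) * dL m i) + (norm (dL m i))\<^sup>2"
        unfolding cmod_power2 dL_def by (simp add: algebra_simps power2_eq_square)
      then show ?thesis
        unfolding dL[OF that] by (simp add: algebra_simps)
    qed
    then have "(\<Sum>i<r m. - 2 * k * Im (cnj (L (p m i)) * dY m i) + 2 * Re (cnj (L (p m i)) * d m i) + (norm (dL m i))\<^sup>2)
        = (\<Sum>i<r m. (norm (L (p m (Suc i))))\<^sup>2 - (norm (L (p m i)))\<^sup>2)"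
      by (intro sum.cong) auto
    also have "\<dots> = (norm (L t))\<^sup>2 - (norm (L 0))\<^sup>2"
      using elim sum_lessThan_telescope[of "\<lambda>i. (norm (L (p m i)))\<^sup>2" "r m"] by (simp add: p_def)
    finally show ?case
      unfolding sum.distrib sum_distrib_left[symmetric] .
  qed
  ultimately have "(\<lambda>m. (norm (L t))\<^sup>2 - (norm (L 0))\<^sup>2)
      \<longlonglongrightarrow> - 2 * k * 0 + 2 * integral {0..t} (\<lambda>s. Re (cnj (L s) * f s)) + k\<^sup>2 * v * ?V"
    by (rule Lim_transform_eventually)
  then show ?thesis by (simp add: LIMSEQ_const_iff)
qed

section \<open>Convergence in probability and stochastic sums\<close>

text \<open>\<open>X\<close> generates a sub-sigma-algebra of \<open>G\<close>, and a function of
  \<open>W\<close> one of the sigma-algebra pulled back along \<open>W\<close>. With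
  \<open>W\<close> the vector of increments, this makes their linear combinations independent of the
  past.\<close>

lemma (in prob_space) indep_set_imp_indep_var:
  assumes ind: "indep_set (sets G) (sets (vimage_algebra (space M) W N))"
    and G: "space G = space M" and W: "W \<in> measurable M N"
    and X: "X \<in> borel_measurable G" and \<psi>: "\<psi> \<in> borel_measurable N"
  shows "indep_var borel X borel (\<lambda>\<omega>. \<psi> (W \<omega>))"
  unfolding indep_var_eq
proof (intro conjI indep_setI)
  have sG: "sets G \<subseteq> events" using indep_setD_ev1[OF ind] .
  then show X': "random_variable borel X"
    using X G by (auto simp: measurable_def)
  show \<psi>': "random_variable borel (\<lambda>\<omega>. \<psi> (W \<omega>))"
    using measurable_compose[OF W \<psi>] .
  show "sigma_sets (space M) {X -` S \<inter> space M |S. S \<in> sets borel} \<subseteq> events"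
    "sigma_sets (space M) {(\<lambda>\<omega>. \<psi> (W \<omega>)) -` S \<inter> space M |S. S \<in> sets borel} \<subseteq> events"
    by (intro sets.sigma_sets_subset; use X' \<psi>' in \<open>auto simp: measurable_def\<close>)+
  fix a b
  assume a: "a \<in> sigma_sets (space M) {X -` S \<inter> space M |S. S \<in> sets borel}"
    and b: "b \<in> sigma_sets (space M) {(\<lambda>\<omega>. \<psi> (W \<omega>)) -` S \<inter> space M |S. S \<in> sets borel}"
  have "sigma_sets (space G) {X -` S \<inter> space M |S. S \<in> sets borel} \<subseteq> sets G"
    using X G by (intro sets.sigma_sets_subset) (auto simp: measurable_def)
  with a G have a': "a \<in> sets G" by auto
  let ?V = "vimage_algebra (space M) W N"
  have "W \<in> measurable ?V N"
    using W by (intro measurable_vimage_algebra1) (auto simp: measurable_def)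
  from measurable_compose[OF this \<psi>] have "(\<lambda>\<omega>. \<psi> (W \<omega>)) \<in> borel_measurable ?V" .
  then have "sigma_sets (space ?V) {(\<lambda>\<omega>. \<psi> (W \<omega>)) -` S \<inter> space M |S. S \<in> sets borel} \<subseteq> sets ?V"
    by (intro sets.sigma_sets_subset) (auto simp: measurable_def)
  with b have b': "b \<in> sets ?V" by auto
  show "prob (a \<inter> b) = prob a * prob b"
    by (rule indep_setD[OF ind a' b'])
qed

lemma increasing_nonneg:
  fixes p :: "nat \<Rightarrow> real"
  assumes "0 \<le> p 0" and p: "\<And>i. i < r \<Longrightarrow> p i < p (Suc i)" and "i \<le> r"
  shows "0 \<le> p i"
  using \<open>i \<le> r\<close>
proof (induction i)
  case (Suc i)
  then show ?case using p[of i] by simp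
qed (use assms in simp)

text \<open>Induces convergence in probability on the event \<open>A\<close>.\<close>

definition trunc_norm :: "'a measure \<Rightarrow> 'a set \<Rightarrow> ('a \<Rightarrow> 'b::real_normed_vector) \<Rightarrow> real" where
  "trunc_norm M A Z = (\<integral>\<omega>. indicator A \<omega> * min 1 (norm (Z \<omega>)) \<partial>M)"

section \<open>Truncated expectations as a measure of smallness in probability\<close>

context prob_space
begin

context
  fixes A assumes A [measurable]: "A \<in> events"
begin

lemma trunc_norm_integrable [intro]:
  fixes Z :: "'a \<Rightarrow> 'b::{real_normed_vector, second_countable_topology}"
  assumes [measurable]: "Z \<in> borel_measurable M"
  shows "integrable M (\<lambda>\<omega>. indicator A \<omega> * min 1 (norm (Z \<omega>)))"
  by (rule integrable_const_bound[of _ 1]) (auto simp: indicator_def)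

lemma trunc_norm_nonneg: "0 \<le> trunc_norm M A Z"
  unfolding trunc_norm_def by (rule Bochner_Integration.integral_nonneg) simp

text \<open>The integrand is at most 1, so whatever happens on \<open>E\<close> costs at most its
  probability. Pathwise bounds that hold off a small event enter in this way.\<close>

lemma trunc_norm_le_off:
  fixes Z :: "'a \<Rightarrow> 'b::{real_normed_vector, second_countable_topology}"
    and W :: "'a \<Rightarrow> 'c::{real_normed_vector, second_countable_topology}"
  assumes [measurable]: "Z \<in> borel_measurable M" "W \<in> borel_measurable M" "E \<in> events"
    and le: "\<And>\<omega>. \<omega> \<in> space M \<Longrightarrow> \<omega> \<in> A \<Longrightarrow> \<omega> \<notin> E \<Longrightarrow> norm (Z \<omega>) \<le> norm (W \<omega>)"
  shows "trunc_norm M A Z \<le> prob E + trunc_norm M A W"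
proof -
  have iE: "integrable M (indicator E :: 'a \<Rightarrow> real)"
    by (rule integrable_const_bound[of _ 1]) (auto simp: indicator_def)
  have "trunc_norm M A Z \<le> (\<integral>\<omega>. indicator E \<omega> + indicator A \<omega> * min 1 (norm (W \<omega>)) \<partial>M)"
    unfolding trunc_norm_def
  proof (rule integral_mono)
    show "integrable M (\<lambda>\<omega>. indicator E \<omega> + indicator A \<omega> * min 1 (norm (W \<omega>)) :: real)"
      by (intro Bochner_Integration.integrable_add trunc_norm_integrable iE) simp
    fix \<omega> assume "\<omega> \<in> space M"
    then show "indicator A \<omega> * min 1 (norm (Z \<omega>)) \<le> indicator E \<omega> + indicator A \<omega> * min 1 (norm (W \<omega>))"
      using le[of \<omega>] min.cobounded1[of 1 "norm (Z \<omega>)"] min.mono[of 1 1 "norm (Z \<omega>)" "norm (W \<omega>)"]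
      by (cases "\<omega> \<in> E"; cases "\<omega> \<in> A") (simp_all add: add_increasing2)
  qed auto
  also have "\<dots> = prob E + trunc_norm M A W"
    unfolding trunc_norm_def by (subst Bochner_Integration.integral_add[OF iE]) auto
  finally show ?thesis .
qed

lemma trunc_norm_mono:
  fixes Z :: "'a \<Rightarrow> 'b::{real_normed_vector, second_countable_topology}"
    and W :: "'a \<Rightarrow> 'c::{real_normed_vector, second_countable_topology}"
  assumes "Z \<in> borel_measurable M" "W \<in> borel_measurable M"
    and "\<And>\<omega>. norm (Z \<omega>) \<le> norm (W \<omega>)"
  shows "trunc_norm M A Z \<le> trunc_norm M A W"
  using trunc_norm_le_off[of Z W "{}"] assms by simp

lemma trunc_norm_add:
  fixes Z W :: "'a \<Rightarrow> 'b::{real_normed_vector, second_countable_topology}"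
  assumes [measurable]: "Z \<in> borel_measurable M" "W \<in> borel_measurable M"
  shows "trunc_norm M A (\<lambda>\<omega>. Z \<omega> + W \<omega>) \<le> trunc_norm M A Z + trunc_norm M A W"
proof -
  have min_add: "0 \<le> a \<Longrightarrow> 0 \<le> b \<Longrightarrow> x \<le> a + b \<Longrightarrow> min 1 x \<le> min 1 a + min 1 b" for a b x :: real
    by (auto simp: min_def)
  have "trunc_norm M A (\<lambda>\<omega>. Z \<omega> + W \<omega>)
      \<le> (\<integral>\<omega>. indicator A \<omega> * min 1 (norm (Z \<omega>)) + indicator A \<omega> * min 1 (norm (W \<omega>)) \<partial>M)"
    unfolding trunc_norm_def
  proof (rule integral_mono)
    fix \<omega>
    show "indicator A \<omega> * min 1 (norm (Z \<omega> + W \<omega>))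
        \<le> indicator A \<omega> * min 1 (norm (Z \<omega>)) + indicator A \<omega> * min 1 (norm (W \<omega>))"
      using min_add[OF norm_ge_zero norm_ge_zero norm_triangle_ineq, of "Z \<omega>" "W \<omega>"] by (simp add: indicator_def)
  qed (auto intro!: Bochner_Integration.integrable_add trunc_norm_integrable)
  also have "\<dots> = trunc_norm M A Z + trunc_norm M A W"
    unfolding trunc_norm_def by (rule Bochner_Integration.integral_add) auto
  finally show ?thesis .
qed

lemma trunc_norm_sum:
  fixes Z :: "'i \<Rightarrow> 'a \<Rightarrow> 'b::{real_normed_vector, second_countable_topology}"
  assumes "finite I" and "\<And>i. i \<in> I \<Longrightarrow> Z i \<in> borel_measurable M"
  shows "trunc_norm M A (\<lambda>\<omega>. \<Sum>i\<in>I. Z i \<omega>) \<le> (\<Sum>i\<in>I. trunc_norm M A (Z i))"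
  using assms
proof (induction I rule: finite_induct)
  case empty
  show ?case by (simp add: trunc_norm_def)
next
  case (insert i I)
  have "trunc_norm M A (\<lambda>\<omega>. Z i \<omega> + (\<Sum>i\<in>I. Z i \<omega>)) \<le> trunc_norm M A (Z i) + trunc_norm M A (\<lambda>\<omega>. \<Sum>i\<in>I. Z i \<omega>)"
    using insert by (intro trunc_norm_add borel_measurable_sum) auto
  with insert show ?case by simp
qed

text \<open>\<open>min 1\<close> is not homogeneous: \<open>min 1 (K * x)\<close> stays below
  \<open>K * min 1 x\<close> because of \<open>1 \<le> K\<close>.\<close>

lemma trunc_norm_scale:
  fixes Z :: "'a \<Rightarrow> 'b::{real_normed_vector, second_countable_topology}"
  assumes [measurable]: "Z \<in> borel_measurable M" and K: "1 \<le> K"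
  shows "trunc_norm M A (\<lambda>\<omega>. K *\<^sub>R Z \<omega>) \<le> K * trunc_norm M A Z"
proof -
  have "min 1 (K * x) \<le> K * min 1 x" if "0 \<le> x" for x :: real
    using K mult_right_mono[OF K that] by (auto simp: min_def)
  then have "trunc_norm M A (\<lambda>\<omega>. K *\<^sub>R Z \<omega>) \<le> (\<integral>\<omega>. K * (indicator A \<omega> * min 1 (norm (Z \<omega>))) \<partial>M)"
    unfolding trunc_norm_def using K
    by (intro integral_mono integrable_mult_right trunc_norm_integrable) (auto simp: indicator_def)
  then show ?thesis by (simp add: trunc_norm_def)
qed

text \<open>Entry point for the kind of convergence used in \<open>ito_integral\<close>: on the
  event the truncated norm is at most 1, off it at most \<open>\<epsilon>\<close>.\<close>

lemma trunc_norm_le_prob: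
  fixes Z :: "'a \<Rightarrow> 'b::{real_normed_vector, second_countable_topology}"
  assumes [measurable]: "Z \<in> borel_measurable M" and \<epsilon>: "0 \<le> \<epsilon>"
  shows "trunc_norm M A Z \<le> prob {\<omega> \<in> space M. \<omega> \<in> A \<and> \<epsilon> < norm (Z \<omega>)} + \<epsilon>"
proof -
  have "trunc_norm M A Z \<le> prob {\<omega> \<in> space M. \<omega> \<in> A \<and> \<epsilon> < norm (Z \<omega>)} + trunc_norm M A (\<lambda>_. \<epsilon>)"
    by (rule trunc_norm_le_off) (use \<epsilon> in \<open>auto simp: not_less\<close>)
  also have "trunc_norm M A (\<lambda>_. \<epsilon>) \<le> (\<integral>\<omega>. \<epsilon> \<partial>M)"
    unfolding trunc_norm_def using \<epsilon>
    by (intro integral_mono trunc_norm_integrable) (auto simp: indicator_def)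
  finally show ?thesis by (simp add: prob_space)
qed

text \<open>Entry point for second moments: nonnegativity of the variance of the absolute value
  bounds the first absolute moment by the root of the second.\<close>

lemma trunc_norm_le_L2:
  fixes Z :: "'a \<Rightarrow> real"
  assumes Z [measurable]: "Z \<in> borel_measurable M" and Z2: "integrable M (\<lambda>\<omega>. (Z \<omega>)\<^sup>2)"
  shows "trunc_norm M A Z \<le> sqrt (expectation (\<lambda>\<omega>. (Z \<omega>)\<^sup>2))"
proof -
  let ?N = "\<lambda>\<omega>. \<bar>Z \<omega>\<bar>"
  have N: "integrable M ?N"
    by (rule square_integrable_imp_integrable) (use Z2 in auto)
  have "(expectation ?N)\<^sup>2 \<le> expectation (\<lambda>\<omega>. (Z \<omega>)\<^sup>2)"
    using variance_positive[of ?N] variance_eq[OF N] Z2 by simp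
  then have "expectation ?N \<le> sqrt (expectation (\<lambda>\<omega>. (Z \<omega>)\<^sup>2))"
    by (rule real_le_rsqrt)
  moreover have "trunc_norm M A Z \<le> expectation ?N"
    unfolding trunc_norm_def using N
    by (intro integral_mono trunc_norm_integrable) (auto simp: indicator_def)
  ultimately show ?thesis by simp
qed

end

end

text \<open>Only these properties of a Brownian motion enter the estimates: second moments control
  sums of increments, fourth moments control sums of their squares. \<open>v\<close> is the variance
  per unit time. Independence of the past is stated for random variables, the form in which
  expectations of products factor.\<close>

locale brownian_driver = prob_space M + filtration "space M" F
  for M :: "'w measure" and F :: "real \<Rightarrow> 'w measure" +
  fixes B :: "real \<Rightarrow> 'w \<Rightarrow> real" and v c :: real
  assumes subalg: "subalgebra M (F s)"
    and B_adapted: "0 \<le> s \<Longrightarrow> B s \<in> borel_measurable (F s)"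
    and B_indep: "0 \<le> s \<Longrightarrow> s < t \<Longrightarrow> X \<in> borel_measurable (F s) \<Longrightarrow>
          indep_var borel X borel (\<lambda>\<omega>. B t \<omega> - B s \<omega>)"
    and B_int4: "0 \<le> s \<Longrightarrow> s < t \<Longrightarrow> integrable M (\<lambda>\<omega>. (B t \<omega> - B s \<omega>) ^ 4)"
    and B_mean: "0 \<le> s \<Longrightarrow> s < t \<Longrightarrow> expectation (\<lambda>\<omega>. B t \<omega> - B s \<omega>) = 0"
    and B_var: "0 \<le> s \<Longrightarrow> s < t \<Longrightarrow> expectation (\<lambda>\<omega>. (B t \<omega> - B s \<omega>)\<^sup>2) = v * (t - s)"
    and B_fourth: "0 \<le> s \<Longrightarrow> s < t \<Longrightarrow> expectation (\<lambda>\<omega>. (B t \<omega> - B s \<omega>) ^ 4) \<le> c * (t - s)\<^sup>2"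
begin

lemma measurable_F_mono:
  "X \<in> measurable (F s) N \<Longrightarrow> s \<le> t \<Longrightarrow> X \<in> measurable (F t) N"
  by (rule measurable_from_subalg[of "F t" "F s"])
     (use sets_F_mono[of s t] space_F in \<open>auto simp: subalgebra_def\<close>)

lemma measurable_F: "X \<in> measurable (F s) N \<Longrightarrow> X \<in> measurable M N"
  using measurable_from_subalg[OF subalg] by blast

lemma B_measurable [measurable]: "0 \<le> s \<Longrightarrow> B s \<in> borel_measurable M"
  by (rule measurable_F[OF B_adapted])

lemma B_int2: "0 \<le> s \<Longrightarrow> s < t \<Longrightarrow> integrable M (\<lambda>\<omega>. (B t \<omega> - B s \<omega>)\<^sup>2)"
  by (rule square_integrable_imp_integrable) (use B_int4 in \<open>auto simp: power_mult[symmetric]\<close>)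

lemma v_nonneg: "0 \<le> v"
proof -
  have "0 \<le> expectation (\<lambda>\<omega>. (B 1 \<omega> - B 0 \<omega>)\<^sup>2)" by (rule Bochner_Integration.integral_nonneg) simp
  also have "\<dots> = v" using B_var[of 0 1] by simp
  finally show ?thesis .
qed

lemma c_nonneg: "0 \<le> c"
proof -
  have "0 \<le> expectation (\<lambda>\<omega>. (B 1 \<omega> - B 0 \<omega>) ^ 4)" by (rule Bochner_Integration.integral_nonneg) simp
  also have "\<dots> \<le> c" using B_fourth[of 0 1] by simp
  finally show ?thesis .
qed

lemma expectation_times_increment:
  fixes X :: "'w \<Rightarrow> real"
  assumes st: "0 \<le> s" "s < t" and X: "X \<in> borel_measurable (F s)" and XI: "integrable M X"
    and \<psi>: "\<psi> \<in> borel_measurable borel" and \<psi>I: "integrable M (\<lambda>\<omega>. \<psi> (B t \<omega> - B s \<omega>) :: real)"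
  shows "integrable M (\<lambda>\<omega>. X \<omega> * \<psi> (B t \<omega> - B s \<omega>))"
    and "expectation (\<lambda>\<omega>. X \<omega> * \<psi> (B t \<omega> - B s \<omega>)) = expectation X * expectation (\<lambda>\<omega>. \<psi> (B t \<omega> - B s \<omega>))"
proof -
  have "indep_var borel ((\<lambda>x. x) \<circ> X) borel (\<psi> \<circ> (\<lambda>\<omega>. B t \<omega> - B s \<omega>))"
    by (rule indep_var_compose[OF B_indep[OF st X] _ \<psi>]) simp
  then have ind: "indep_var borel X borel (\<lambda>\<omega>. \<psi> (B t \<omega> - B s \<omega>))"
    by (simp add: comp_def)
  show "integrable M (\<lambda>\<omega>. X \<omega> * \<psi> (B t \<omega> - B s \<omega>))"
    by (rule indep_var_integrable[OF ind XI \<psi>I])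
  show "expectation (\<lambda>\<omega>. X \<omega> * \<psi> (B t \<omega> - B s \<omega>)) = expectation X * expectation (\<lambda>\<omega>. \<psi> (B t \<omega> - B s \<omega>))"
    by (rule indep_var_lebesgue_integral[OF ind XI \<psi>I])
qed

text \<open>The Ito isometry for finite sums, as an inequality: the partial sum times the next
  coefficient is known at time \<open>p n\<close>, the next term is centered and independent of it,
  so mixed products have mean 0. The functions \<open>\<psi> i\<close> admit both the increments
  themselves and their centered squares.\<close>

lemma expectation_square_sum_le:
  fixes p :: "nat \<Rightarrow> real" and h :: "nat \<Rightarrow> 'w \<Rightarrow> real" and \<psi> :: "nat \<Rightarrow> real \<Rightarrow> real"
  assumes p0: "0 \<le> p 0" and p: "\<And>i. i < r \<Longrightarrow> p i < p (Suc i)"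
    and h: "\<And>i. i < r \<Longrightarrow> h i \<in> borel_measurable (F (p i))"
    and hC: "\<And>i \<omega>. i < r \<Longrightarrow> \<bar>h i \<omega>\<bar> \<le> C"
    and \<psi>: "\<And>i. i < r \<Longrightarrow> \<psi> i \<in> borel_measurable borel"
    and \<psi>2: "\<And>i. i < r \<Longrightarrow> integrable M (\<lambda>\<omega>. (\<psi> i (B (p (Suc i)) \<omega> - B (p i) \<omega>))\<^sup>2)"
    and \<psi>m: "\<And>i. i < r \<Longrightarrow> expectation (\<lambda>\<omega>. \<psi> i (B (p (Suc i)) \<omega> - B (p i) \<omega>)) = 0"
    and \<psi>V: "\<And>i. i < r \<Longrightarrow> expectation (\<lambda>\<omega>. (\<psi> i (B (p (Suc i)) \<omega> - B (p i) \<omega>))\<^sup>2) \<le> V i"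
  shows "(\<lambda>\<omega>. \<Sum>i<r. h i \<omega> * \<psi> i (B (p (Suc i)) \<omega> - B (p i) \<omega>)) \<in> borel_measurable (F (p r))"
    and "integrable M (\<lambda>\<omega>. (\<Sum>i<r. h i \<omega> * \<psi> i (B (p (Suc i)) \<omega> - B (p i) \<omega>))\<^sup>2)"
    and "expectation (\<lambda>\<omega>. (\<Sum>i<r. h i \<omega> * \<psi> i (B (p (Suc i)) \<omega> - B (p i) \<omega>))\<^sup>2) \<le> C\<^sup>2 * (\<Sum>i<r. V i)"
proof -
  let ?\<xi> = "\<lambda>i \<omega>. \<psi> i (B (p (Suc i)) \<omega> - B (p i) \<omega>)"
  let ?S = "\<lambda>n \<omega>. \<Sum>i<n. h i \<omega> * ?\<xi> i \<omega>"
  have pn: "0 \<le> p i" if "i \<le> r" for i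
    by (rule increasing_nonneg[where r=r]) (use p0 p that in auto)
  \<comment> \<open>Adaptedness, integrability and the bound share one induction, because the first
    two are what makes the next mixed product factor.\<close>
  have "?S n \<in> borel_measurable (F (p n)) \<and> integrable M (\<lambda>\<omega>. (?S n \<omega>)\<^sup>2)
      \<and> expectation (\<lambda>\<omega>. (?S n \<omega>)\<^sup>2) \<le> C\<^sup>2 * (\<Sum>i<n. V i)" if "n \<le> r" for n
    using that
  proof (induction n)
    case 0
    show ?case by simp
  next
    case (Suc n)
    then have n: "n < r" and S [measurable]: "?S n \<in> borel_measurable (F (p n))"
      and S2: "integrable M (\<lambda>\<omega>. (?S n \<omega>)\<^sup>2)"
      and SV: "expectation (\<lambda>\<omega>. (?S n \<omega>)\<^sup>2) \<le> C\<^sup>2 * (\<Sum>i<n. V i)" by auto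
    note hn [measurable] = h[OF n] and \<psi>n [measurable] = \<psi>[OF n]
    have pm: "p n \<le> p (Suc n)" using p[OF n] by simp
    have B1 [measurable]: "B (p (Suc n)) \<in> borel_measurable (F (p (Suc n)))"
      "B (p n) \<in> borel_measurable (F (p (Suc n)))" "h n \<in> borel_measurable (F (p (Suc n)))"
      "?S n \<in> borel_measurable (F (p (Suc n)))"
      using pn[of n] pn[of "Suc n"] n pm by (auto intro: B_adapted measurable_F_mono[OF _ pm] S hn)
    have B2 [measurable]: "B (p (Suc n)) \<in> borel_measurable M" "B (p n) \<in> borel_measurable M"
      "h n \<in> borel_measurable M" "?S n \<in> borel_measurable M"
      using measurable_F[OF B1(1)] measurable_F[OF B1(2)] measurable_F[OF B1(3)] measurable_F[OF S] by auto
    have C: "0 \<le> C" using hC[OF n] by (meson abs_ge_zero order_trans)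
    have \<xi>I: "integrable M (?\<xi> n)"
      by (rule square_integrable_imp_integrable[OF _ \<psi>2[OF n]]) measurable
    have S1: "integrable M (?S n)"
      by (rule square_integrable_imp_integrable[OF _ S2]) measurable
    have Sh: "integrable M (\<lambda>\<omega>. ?S n \<omega> * h n \<omega>)"
    proof (rule Bochner_Integration.integrable_bound)
      show "integrable M (\<lambda>\<omega>. C * ?S n \<omega>)" using S1 by simp
      show "AE \<omega> in M. norm (?S n \<omega> * h n \<omega>) \<le> norm (C * ?S n \<omega>)"
        using hC[OF n] C by (intro AE_I2) (simp add: abs_mult mult.commute mult_right_mono)
    qed measurable
    have "(\<lambda>\<omega>. ?S n \<omega> * h n \<omega>) \<in> borel_measurable (F (p n))" by measurable
    from expectation_times_increment[OF pn[of n] p[OF n] this Sh \<psi>n \<xi>I] n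
    have X: "integrable M (\<lambda>\<omega>. ?S n \<omega> * h n \<omega> * ?\<xi> n \<omega>)"
      "expectation (\<lambda>\<omega>. ?S n \<omega> * h n \<omega> * ?\<xi> n \<omega>) = 0"
      using \<psi>m[OF n] by auto
    have h2: "(h n \<omega>)\<^sup>2 * x \<le> C\<^sup>2 * x" if "0 \<le> x" for \<omega> x
      using hC[OF n, of \<omega>] C by (intro mult_right_mono[OF _ that]) (metis abs_ge_zero power2_abs power_mono)
    have H: "integrable M (\<lambda>\<omega>. (h n \<omega>)\<^sup>2 * (?\<xi> n \<omega>)\<^sup>2)"
    proof (rule Bochner_Integration.integrable_bound)
      show "integrable M (\<lambda>\<omega>. C\<^sup>2 * (?\<xi> n \<omega>)\<^sup>2)" using \<psi>2[OF n] by simp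
      show "AE \<omega> in M. norm ((h n \<omega>)\<^sup>2 * (?\<xi> n \<omega>)\<^sup>2) \<le> norm (C\<^sup>2 * (?\<xi> n \<omega>)\<^sup>2)"
        using h2 by (intro AE_I2) simp
    qed measurable
    have HV: "expectation (\<lambda>\<omega>. (h n \<omega>)\<^sup>2 * (?\<xi> n \<omega>)\<^sup>2) \<le> C\<^sup>2 * V n"
    proof -
      have "expectation (\<lambda>\<omega>. (h n \<omega>)\<^sup>2 * (?\<xi> n \<omega>)\<^sup>2) \<le> expectation (\<lambda>\<omega>. C\<^sup>2 * (?\<xi> n \<omega>)\<^sup>2)"
        using h2 H \<psi>2[OF n] by (intro integral_mono) auto
      also have "\<dots> \<le> C\<^sup>2 * V n" using \<psi>V[OF n] by (simp add: mult_left_mono)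
      finally show ?thesis .
    qed
    have eq: "(\<lambda>\<omega>. (?S (Suc n) \<omega>)\<^sup>2) = (\<lambda>\<omega>. (?S n \<omega>)\<^sup>2 + 2 * (?S n \<omega> * h n \<omega> * ?\<xi> n \<omega>) + (h n \<omega>)\<^sup>2 * (?\<xi> n \<omega>)\<^sup>2)"
      by (simp add: power2_sum power_mult_distrib algebra_simps)
    have "?S (Suc n) \<in> borel_measurable (F (p (Suc n)))"
      using B1 by simp
    moreover have "integrable M (\<lambda>\<omega>. (?S (Suc n) \<omega>)\<^sup>2)"
      unfolding eq using S2 X(1) H by (intro Bochner_Integration.integrable_add integrable_mult_right)
    moreover have "expectation (\<lambda>\<omega>. (?S (Suc n) \<omega>)\<^sup>2) \<le> C\<^sup>2 * (\<Sum>i<Suc n. V i)"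
      unfolding eq using S2 X H SV HV
      by (simp add: distrib_left)
    ultimately show ?case by blast
  qed
  then show "?S r \<in> borel_measurable (F (p r))" "integrable M (\<lambda>\<omega>. (?S r \<omega>)\<^sup>2)"
    "expectation (\<lambda>\<omega>. (?S r \<omega>)\<^sup>2) \<le> C\<^sup>2 * (\<Sum>i<r. V i)" by auto
qed

lemma trunc_norm_increment_sum_le:
  fixes p :: "nat \<Rightarrow> real" and h :: "nat \<Rightarrow> 'w \<Rightarrow> real" and \<psi> :: "nat \<Rightarrow> real \<Rightarrow> real"
  assumes A: "A \<in> events" and E: "E \<in> events" and C: "0 \<le> C"
    and p0: "0 \<le> p 0" and p: "\<And>i. i < r \<Longrightarrow> p i < p (Suc i)"
    and h: "\<And>i. i < r \<Longrightarrow> h i \<in> borel_measurable (F (p i))"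
    and hC: "\<And>i \<omega>. i < r \<Longrightarrow> \<omega> \<in> space M \<Longrightarrow> \<omega> \<in> A \<Longrightarrow> \<omega> \<notin> E \<Longrightarrow> \<bar>h i \<omega>\<bar> \<le> C"
    and \<psi>: "\<And>i. i < r \<Longrightarrow> \<psi> i \<in> borel_measurable borel"
    and \<psi>2: "\<And>i. i < r \<Longrightarrow> integrable M (\<lambda>\<omega>. (\<psi> i (B (p (Suc i)) \<omega> - B (p i) \<omega>))\<^sup>2)"
    and \<psi>m: "\<And>i. i < r \<Longrightarrow> expectation (\<lambda>\<omega>. \<psi> i (B (p (Suc i)) \<omega> - B (p i) \<omega>)) = 0"
    and \<psi>V: "\<And>i. i < r \<Longrightarrow> expectation (\<lambda>\<omega>. (\<psi> i (B (p (Suc i)) \<omega> - B (p i) \<omega>))\<^sup>2) \<le> V i"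
  shows "trunc_norm M A (\<lambda>\<omega>. \<Sum>i<r. h i \<omega> * \<psi> i (B (p (Suc i)) \<omega> - B (p i) \<omega>)) \<le> prob E + C * sqrt (\<Sum>i<r. V i)"
proof -
  \<comment> \<open>Cutting off by the size of \<open>h i\<close> itself keeps the coefficient
    adapted. Multiplying by the indicator of \<open>A - E\<close> might not, since \<open>A\<close>
    and \<open>E\<close> may depend on times after \<open>p i\<close>.\<close>
  define h' where "h' i \<omega> = (if \<bar>h i \<omega>\<bar> \<le> C then h i \<omega> else 0)" for i \<omega>
  let ?\<xi> = "\<lambda>i \<omega>. \<psi> i (B (p (Suc i)) \<omega> - B (p i) \<omega>)"
  let ?S = "\<lambda>h \<omega>. \<Sum>i<r. h i \<omega> * ?\<xi> i \<omega>"
  have h': "h' i \<in> borel_measurable (F (p i))" if "i < r" for i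
    unfolding h'_def using h[OF that] by measurable
  have h'C: "\<bar>h' i \<omega>\<bar> \<le> C" for i \<omega> using C by (simp add: h'_def)
  note * = expectation_square_sum_le[where V=V, OF p0 p h' h'C \<psi> \<psi>2 \<psi>m \<psi>V, of r]
  have pn: "0 \<le> p i" if "i \<le> r" for i
    by (rule increasing_nonneg[where r=r]) (use p0 p that in auto)
  have m: "?S h \<in> borel_measurable M"
  proof (intro borel_measurable_sum)
    fix i assume "i \<in> {..<r}"
    then have [measurable]: "h i \<in> borel_measurable M" "\<psi> i \<in> borel_measurable borel"
      "B (p i) \<in> borel_measurable M" "B (p (Suc i)) \<in> borel_measurable M"
      using measurable_F[OF h[of i]] \<psi> pn by auto
    show "(\<lambda>\<omega>. h i \<omega> * ?\<xi> i \<omega>) \<in> borel_measurable M" by measurable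
  qed
  have m': "?S h' \<in> borel_measurable M"
    by (rule measurable_F[OF *(1)]) auto
  have "trunc_norm M A (?S h) \<le> prob E + trunc_norm M A (?S h')"
  proof (rule trunc_norm_le_off[OF A m m' E])
    fix \<omega> assume "\<omega> \<in> space M" "\<omega> \<in> A" "\<omega> \<notin> E"
    then have "h i \<omega> = h' i \<omega>" if "i < r" for i using hC[OF that, of \<omega>] by (simp add: h'_def)
    then show "norm (?S h \<omega>) \<le> norm (?S h' \<omega>)" by simp
  qed
  also have "trunc_norm M A (?S h') \<le> sqrt (expectation (\<lambda>\<omega>. (?S h' \<omega>)\<^sup>2))"
    by (rule trunc_norm_le_L2[OF A m' *(2)]) auto
  also have "\<dots> \<le> sqrt (C\<^sup>2 * (\<Sum>i<r. V i))"
    by (intro real_sqrt_le_mono *(3)) auto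
  also have "\<dots> = C * sqrt (\<Sum>i<r. V i)"
    using C by (simp add: real_sqrt_mult)
  finally show ?thesis by simp
qed

end

section \<open>Limits of sums over uniform partitions\<close>

text \<open>Meant for \<open>x\<close> a one-step error and \<open>y\<close> its finer
  approximation: for a fixed number of steps it is enough that each single difference becomes
  small.\<close>

lemma L2_set_le_sum_norm:
  assumes "finite I"
  shows "L2_set (\<lambda>i. norm (x i)) I \<le> (\<Sum>i\<in>I. norm (x i - y i)) + L2_set (\<lambda>i. norm (y i)) I"
proof -
  have "L2_set (\<lambda>i. norm (x i - y i + y i)) I \<le> L2_set (\<lambda>i. norm (x i - y i)) I + L2_set (\<lambda>i. norm (y i)) I"
    by (rule L2_set_norm_triangle)
  also have "L2_set (\<lambda>i. norm (x i - y i)) I \<le> (\<Sum>i\<in>I. norm (x i - y i))"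
    by (rule L2_set_le_sum) simp
  finally show ?thesis by simp
qed

lemma borel_measurable_L2_set [measurable]:
  assumes "\<And>i. i \<in> I \<Longrightarrow> f i \<in> borel_measurable M"
  shows "(\<lambda>\<omega>. L2_set (\<lambda>i. f i \<omega>) I) \<in> borel_measurable M"
  unfolding L2_set_def using assms by measurable

text \<open>Exact nesting is a reason for using uniform grids: one fine grid provides partitions
  that end at every point of the coarse grid.\<close>

lemma grid_refine: "0 < k \<Longrightarrow> grid t (r * k) (i * k) = grid t r i"
  by (simp add: grid_def)

lemma grid_coarse_le: "0 \<le> t \<Longrightarrow> 0 < k \<Longrightarrow> grid t r (m div k) \<le> grid t (r * k) m"
  using grid_mono[of t "m div k * k" m "r * k"] by (simp add: grid_refine)

text \<open>The fine point lies \<open>m mod k\<close> fine steps, fewer than \<open>k\<close>, to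
  the right of the start of its coarse step.\<close>

lemma grid_coarse_dist:
  assumes "0 \<le> t" "0 < k" "0 < r"
  shows "grid t (r * k) m - grid t r (m div k) \<le> t / real r"
proof -
  have m: "real m = real k * real (m div k) + real (m mod k)"
    by (metis mult_div_mod_eq of_nat_add of_nat_mult)
  have "grid t (r * k) m - grid t r (m div k) = t * real (m mod k) / real (r * k)"
    unfolding grid_def m using assms by (simp add: diff_divide_distrib add_divide_distrib distrib_left)
  also have "\<dots> \<le> t * real k / real (r * k)"
    using assms by (intro divide_right_mono mult_left_mono) (auto intro: less_imp_le)
  finally show ?thesis using assms by simp
qed

lemma sum_nested:
  fixes f :: "nat \<Rightarrow> 'b::comm_monoid_add"
  shows "(\<Sum>i<r. \<Sum>l<k. f (i * k + l)) = (\<Sum>m<r * k. f m)"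
proof -
  have "(\<Sum>l<k. f (i * k + l)) = sum f {i * k..<i * k + k}" for i
    by (rule sum.reindex_bij_witness[of _ "\<lambda>j. j - i * k" "\<lambda>l. i * k + l"]) auto
  then show ?thesis by (simp add: sum.nat_group)
qed

text \<open>Here \<open>Y\<close> is the stochastic integral of \<open>L\<close> with respect to \<open>B\<close> on the event \<open>A\<close>, up to a
  fixed time \<open>t\<close>.\<close>

locale stochastic_integral = brownian_driver +
  fixes L Y :: "real \<Rightarrow> 'a \<Rightarrow> complex" and A :: "'a set" and t :: real
  assumes t: "0 < t" and A [measurable]: "A \<in> events"
    and L_adapted: "0 \<le> s \<Longrightarrow> L s \<in> borel_measurable (F s)"
    and Y_measurable [measurable]: "0 \<le> s \<Longrightarrow> Y s \<in> borel_measurable M"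
    and L_continuous: "AE \<omega> in M. \<omega> \<in> A \<longrightarrow> continuous_on {0..t} (\<lambda>s. L s \<omega>)"
    and riemann_sums: "0 \<le> s \<Longrightarrow> s \<le> t \<Longrightarrow> 0 < \<epsilon> \<Longrightarrow>
      \<exists>\<delta>>0. \<forall>(p :: nat \<Rightarrow> real) n. p 0 = 0 \<and> p n = s \<and> (\<forall>i<n. p i \<le> p (Suc i) \<and> p (Suc i) - p i < \<delta>) \<longrightarrow>
        trunc_norm M A (\<lambda>\<omega>. (\<Sum>i<n. L (p i) \<omega> * of_real (B (p (Suc i)) \<omega> - B (p i) \<omega>)) - Y s \<omega>) < \<epsilon>"
begin

lemma L_measurable [measurable]: "0 \<le> s \<Longrightarrow> L s \<in> borel_measurable M"
  by (rule measurable_F[OF L_adapted])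

lemma L_grid [measurable]: "L (grid t n i) \<in> borel_measurable M"
  and Y_grid [measurable]: "Y (grid t n i) \<in> borel_measurable M"
  and B_grid [measurable]: "B (grid t n i) \<in> borel_measurable M"
  using t by (simp_all add: grid_nonneg L_measurable Y_measurable B_measurable)

text \<open>Off the event \<open>osc r \<epsilon>\<close> the path of \<open>L\<close> varies little on intervals of length \<open>t / r\<close>, even
  after multiplication with its size, and it is not too large. Only rational multiples of \<open>t\<close> are
  considered, to make this an event.\<close>

definition osc :: "nat \<Rightarrow> real \<Rightarrow> 'a set" where
  "osc r \<epsilon> = {\<omega> \<in> space M. \<omega> \<in> A \<and> (\<exists>n i n' i'. i \<le> n \<and> i' \<le> n' \<and>
     \<bar>grid t n i - grid t n' i'\<bar> \<le> t / real r \<and>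
     (\<epsilon> < (1 + norm (L (grid t n' i') \<omega>)) * norm (L (grid t n i) \<omega> - L (grid t n' i') \<omega>) \<or>
      \<epsilon> * sqrt (real r) < (norm (L (grid t n i) \<omega>))\<^sup>2))}"

lemma osc_event [measurable]: "osc r \<epsilon> \<in> events"
  unfolding osc_def by measurable

lemma not_osc:
  assumes "\<omega> \<in> space M" "\<omega> \<in> A" "\<omega> \<notin> osc r \<epsilon>" "i \<le> n" "i' \<le> n'"
    "\<bar>grid t n i - grid t n' i'\<bar> \<le> t / real r"
  shows "(1 + norm (L (grid t n' i') \<omega>)) * norm (L (grid t n i) \<omega> - L (grid t n' i') \<omega>) \<le> \<epsilon>"
    and "(norm (L (grid t n i) \<omega>))\<^sup>2 \<le> \<epsilon> * sqrt (real r)"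
  using assms unfolding osc_def by (auto simp: not_less)

text \<open>Almost every path in \<open>A\<close> is bounded and uniformly continuous on
  \<open>{0..t}\<close>, so it lies outside \<open>osc r \<epsilon>\<close> for all large
  \<open>r\<close>; dominated convergence carries this over to probabilities.\<close>

lemma osc_tendsto_0:
  assumes \<epsilon>: "0 < \<epsilon>"
  shows "(\<lambda>r. prob (osc r \<epsilon>)) \<longlonglongrightarrow> 0"
proof -
  have "AE \<omega> in M. (\<lambda>r. indicator (osc r \<epsilon>) \<omega> :: real) \<longlonglongrightarrow> 0"
    using L_continuous
  proof eventually_elim
    case (elim \<omega>)
    show ?case
    proof (cases "\<omega> \<in> A")
      case False
      then have "indicator (osc r \<epsilon>) \<omega> = (0::real)" for r by (simp add: osc_def)
      then show ?thesis by simp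
    next
      case True
      then have cont: "continuous_on {0..t} (\<lambda>s. L s \<omega>)" using elim by simp
      have "bounded ((\<lambda>s. L s \<omega>) ` {0..t})"
        by (intro compact_imp_bounded compact_continuous_image cont) simp
      then obtain K where K: "0 < K" "\<And>s. s \<in> {0..t} \<Longrightarrow> norm (L s \<omega>) \<le> K"
        unfolding bounded_pos by auto
      have "uniformly_continuous_on {0..t} (\<lambda>s. L s \<omega>)"
        by (rule compact_uniformly_continuous[OF cont]) simp
      \<comment> \<open>\<open>1 + K\<close> dominates the weight in the definition of
        \<open>osc\<close>.\<close>
      moreover have "0 < \<epsilon> / (1 + K)" using \<epsilon> K by simp
      ultimately obtain d where d: "0 < d" "\<And>s s'. s \<in> {0..t} \<Longrightarrow> s' \<in> {0..t} \<Longrightarrow> dist s' s < d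
          \<Longrightarrow> dist (L s' \<omega>) (L s \<omega>) < \<epsilon> / (1 + K)"
        unfolding uniformly_continuous_on_def by metis
      have "(\<lambda>r. t / real r) \<longlonglongrightarrow> 0" by (rule lim_const_over_n)
      then have ev1: "\<forall>\<^sub>F r in sequentially. t / real r < d"
        using d(1) by (rule order_tendstoD)
      have "filterlim (\<lambda>r. \<epsilon> * sqrt (real r)) at_top sequentially"
        by (intro filterlim_tendsto_pos_mult_at_top[OF tendsto_const \<epsilon>]
            filterlim_compose[OF sqrt_at_top filterlim_real_sequentially])
      then have ev2: "\<forall>\<^sub>F r in sequentially. K\<^sup>2 \<le> \<epsilon> * sqrt (real r)"
        by (simp add: filterlim_at_top)
      have "\<forall>\<^sub>F r in sequentially. indicator (osc r \<epsilon>) \<omega> = (0::real)"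
        using ev1 ev2
      proof eventually_elim
        case (elim r)
        have "\<omega> \<notin> osc r \<epsilon>"
        proof
          assume "\<omega> \<in> osc r \<epsilon>"
          then obtain n i n' i' where le: "i \<le> n" "i' \<le> n'" "\<bar>grid t n i - grid t n' i'\<bar> \<le> t / real r"
            and or: "\<epsilon> < (1 + norm (L (grid t n' i') \<omega>)) * norm (L (grid t n i) \<omega> - L (grid t n' i') \<omega>) \<or>
              \<epsilon> * sqrt (real r) < (norm (L (grid t n i) \<omega>))\<^sup>2"
            unfolding osc_def by blast
          have g: "grid t n i \<in> {0..t}" "grid t n' i' \<in> {0..t}"
            using t le by (auto simp: grid_nonneg grid_le)
          have "(norm (L (grid t n i) \<omega>))\<^sup>2 \<le> K\<^sup>2" using K(2)[OF g(1)] by (simp add: power_mono)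
          with or elim have "\<epsilon> < (1 + norm (L (grid t n' i') \<omega>)) * norm (L (grid t n i) \<omega> - L (grid t n' i') \<omega>)"
            by auto
          also have "\<dots> \<le> (1 + K) * (\<epsilon> / (1 + K))"
            using K(1) K(2)[OF g(2)] d(2)[OF g(2) g(1)] le(3) elim
            by (intro mult_mono) (auto simp: dist_norm)
          also have "\<dots> = \<epsilon>" using K by simp
          finally show False by simp
        qed
        then show ?case by simp
      qed
      then show ?thesis by (rule tendsto_eventually)
    qed
  qed
  then have "(\<lambda>r. \<integral>\<omega>. indicator (osc r \<epsilon>) \<omega> \<partial>M) \<longlonglongrightarrow> (\<integral>\<omega>. (0::real) \<partial>M)"
    by (intro integral_dominated_convergence[where w="\<lambda>_. 1"]) (auto simp: indicator_def)
  then show ?thesis by simp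
qed

section \<open>One-step errors and their approximation by finer sums\<close>

definition dB :: "nat \<Rightarrow> nat \<Rightarrow> 'a \<Rightarrow> real" where
  "dB n i \<omega> = B (grid t n (Suc i)) \<omega> - B (grid t n i) \<omega>"

definition dY :: "nat \<Rightarrow> nat \<Rightarrow> 'a \<Rightarrow> complex" where
  "dY n i \<omega> = Y (grid t n (Suc i)) \<omega> - Y (grid t n i) \<omega>"

text \<open>The one-step error \<open>err r i\<close> is the limit in probability of \<open>err_approx r k i\<close> for
  \<open>k \<longlonglongrightarrow> \<infinity>\<close>, where the step is divided into \<open>k\<close> steps.\<close>

definition err :: "nat \<Rightarrow> nat \<Rightarrow> 'a \<Rightarrow> complex" where
  "err r i \<omega> = dY r i \<omega> - L (grid t r i) \<omega> * of_real (dB r i \<omega>)"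

definition err_approx :: "nat \<Rightarrow> nat \<Rightarrow> nat \<Rightarrow> 'a \<Rightarrow> complex" where
  "err_approx r k i \<omega> = (\<Sum>l<k. (L (grid t (r * k) (i * k + l)) \<omega> - L (grid t r i) \<omega>) * of_real (dB (r * k) (i * k + l) \<omega>))"

lemma err_measurable [measurable]:
  "dB n i \<in> borel_measurable M" "dY n i \<in> borel_measurable M" "err r i \<in> borel_measurable M"
  "err_approx r k i \<in> borel_measurable M"
  unfolding err_def[abs_def] err_approx_def[abs_def] dY_def[abs_def] dB_def[abs_def] by measurable

text \<open>The first \<open>i * k\<close> steps of the grid with \<open>r * k\<close> steps
  partition the interval up to the coarse point of index \<open>i\<close>, with mesh at most
  \<open>t / k\<close>. So \<open>r\<close> stays fixed while the mesh tends to 0.\<close>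

lemma riemann_sums_grid:
  assumes r: "0 < r" and i: "i \<le> r"
  shows "(\<lambda>k. trunc_norm M A (\<lambda>\<omega>. (\<Sum>j<i * k. L (grid t (r * k) j) \<omega> * of_real (dB (r * k) j \<omega>))
      - Y (grid t r i) \<omega>)) \<longlonglongrightarrow> 0" (is "?f \<longlonglongrightarrow> 0")
proof (rule LIMSEQ_I)
  fix \<epsilon> :: real assume "0 < \<epsilon>"
  then obtain \<delta> where \<delta>: "0 < \<delta>" and conv: "\<And>(p :: nat \<Rightarrow> real) n. p 0 = 0 \<Longrightarrow> p n = grid t r i \<Longrightarrow>
      (\<And>i. i < n \<Longrightarrow> p i \<le> p (Suc i) \<and> p (Suc i) - p i < \<delta>) \<Longrightarrow>
        trunc_norm M A (\<lambda>\<omega>. (\<Sum>i<n. L (p i) \<omega> * of_real (B (p (Suc i)) \<omega> - B (p i) \<omega>)) - Y (grid t r i) \<omega>) < \<epsilon>"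
    using riemann_sums[of "grid t r i" \<epsilon>] t i by (auto simp: grid_nonneg grid_le)
  have "(\<lambda>k. t / real k) \<longlonglongrightarrow> 0" by (rule lim_const_over_n)
  then have "\<forall>\<^sub>F k in sequentially. t / real k < \<delta>"
    using \<delta> by (rule order_tendstoD)
  then obtain N where N: "\<And>k. N \<le> k \<Longrightarrow> t / real k < \<delta>" by (auto simp: eventually_sequentially)
  show "\<exists>no. \<forall>k\<ge>no. norm (?f k - 0) < \<epsilon>"
  proof (intro exI[of _ "Suc N"] allI impI)
    fix k assume k: "Suc N \<le> k"
    have "t / real (r * k) \<le> t / real k"
      using t r k by (intro divide_left_mono) auto
    also have "\<dots> < \<delta>" using N[of k] k by simp
    finally have "grid t (r * k) (Suc j) - grid t (r * k) j < \<delta>" for j by (simp only: grid_diff)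
    then have "?f k < \<epsilon>"
      unfolding dB_def using k t r
      by (intro conv) (auto simp: grid_refine intro: grid_mono)
    then show "norm (?f k - 0) < \<epsilon>" by (simp add: trunc_norm_nonneg[OF A])
  qed
qed

text \<open>The increment of \<open>Y\<close> is a difference of values at the two ends of a coarse
  step. Each is compared with the Riemann sum over the same fine grid, and these two sums differ by
  the fine sum over the step.\<close>

lemma err_eq:
  assumes k: "0 < k"
  shows "err r i \<omega> - err_approx r k i \<omega>
    = ((\<Sum>j<i * k. L (grid t (r * k) j) \<omega> * of_real (dB (r * k) j \<omega>)) - Y (grid t r i) \<omega>)
      - ((\<Sum>j<Suc i * k. L (grid t (r * k) j) \<omega> * of_real (dB (r * k) j \<omega>)) - Y (grid t r (Suc i)) \<omega>)"
proof -
  let ?g = "\<lambda>j. L (grid t (r * k) j) \<omega> * complex_of_real (dB (r * k) j \<omega>)"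
  have "(\<Sum>l<k. dB (r * k) (i * k + l) \<omega>) = B (grid t (r * k) (i * k + k)) \<omega> - B (grid t (r * k) (i * k)) \<omega>"
    unfolding dB_def using sum_lessThan_telescope[of "\<lambda>l. B (grid t (r * k) (i * k + l)) \<omega>" k] by simp
  also have "\<dots> = dB r i \<omega>"
    using grid_refine[OF k, of t r "Suc i"] by (simp add: dB_def grid_refine[OF k] add.commute)
  finally have 1: "(\<Sum>l<k. dB (r * k) (i * k + l) \<omega>) = dB r i \<omega>" .
  have "(\<Sum>j<Suc i * k. ?g j) = (\<Sum>j<i * k. ?g j) + (\<Sum>l<k. ?g (i * k + l))"
    using sum_nested[of ?g k "Suc i"] sum_nested[of ?g k i] by simp
  moreover have "err_approx r k i \<omega> = (\<Sum>l<k. ?g (i * k + l)) - L (grid t r i) \<omega> * of_real (dB r i \<omega>)"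
    unfolding err_approx_def 1[symmetric] by (simp add: algebra_simps sum_subtractf sum_distrib_left)
  ultimately show ?thesis by (simp add: err_def dY_def)
qed

text \<open>The convergence to \<open>Y\<close> comes without a rate, which dictates the order of
  limits: for fixed \<open>r\<close> there are finitely many steps, so \<open>k\<close> goes to
  infinity before \<open>r\<close>.\<close>

lemma err_approx_tendsto:
  assumes r: "0 < r"
  shows "(\<lambda>k. \<Sum>i<r. trunc_norm M A (\<lambda>\<omega>. err r i \<omega> - err_approx r k i \<omega>)) \<longlonglongrightarrow> 0"
proof -
  define f where "f i k = trunc_norm M A (\<lambda>\<omega>. (\<Sum>j<i * k. L (grid t (r * k) j) \<omega> * of_real (dB (r * k) j \<omega>))
      - Y (grid t r i) \<omega>)" for i k
  have "(\<lambda>k. trunc_norm M A (\<lambda>\<omega>. err r i \<omega> - err_approx r k i \<omega>)) \<longlonglongrightarrow> 0" if i: "i < r" for i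
  proof (rule tendsto_sandwich[OF _ _ tendsto_const])
    show "\<forall>\<^sub>F k in sequentially. 0 \<le> trunc_norm M A (\<lambda>\<omega>. err r i \<omega> - err_approx r k i \<omega>)"
      by (simp add: trunc_norm_nonneg[OF A])
    have "f i \<longlonglongrightarrow> 0" "f (Suc i) \<longlonglongrightarrow> 0"
      using riemann_sums_grid[OF r, of i] riemann_sums_grid[OF r, of "Suc i"] i
      unfolding f_def[abs_def] by auto
    then show "(\<lambda>k. f i k + f (Suc i) k) \<longlonglongrightarrow> 0" using tendsto_add[of "f i" 0 sequentially "f (Suc i)" 0] by simp
    show "\<forall>\<^sub>F k in sequentially. trunc_norm M A (\<lambda>\<omega>. err r i \<omega> - err_approx r k i \<omega>) \<le> f i k + f (Suc i) k"
      using eventually_gt_at_top[of 0]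
    proof eventually_elim
      case (elim k)
      have "trunc_norm M A (\<lambda>\<omega>. err r i \<omega> - err_approx r k i \<omega>)
          \<le> f i k + trunc_norm M A (\<lambda>\<omega>. - ((\<Sum>j<Suc i * k. L (grid t (r * k) j) \<omega> * of_real (dB (r * k) j \<omega>)) - Y (grid t r (Suc i)) \<omega>))"
        unfolding err_eq[OF elim] f_def diff_conv_add_uminus[of "_ - Y (grid t r i) _"]
        by (intro trunc_norm_add[OF A]) measurable
      also have "\<dots> = f i k + f (Suc i) k" by (simp only: f_def trunc_norm_def norm_minus_cancel)
      finally show ?case .
    qed
  qed
  then have "(\<lambda>k. \<Sum>i<r. trunc_norm M A (\<lambda>\<omega>. err r i \<omega> - err_approx r k i \<omega>)) \<longlonglongrightarrow> (\<Sum>i<r. 0)"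
    by (intro tendsto_sum) auto
  then show ?thesis by simp
qed

lemma grid_increments:
  assumes "0 < n"
  shows "integrable M (\<lambda>\<omega>. (dB n i \<omega>)\<^sup>2)" "expectation (dB n i) = 0"
    "expectation (\<lambda>\<omega>. (dB n i \<omega>)\<^sup>2) = v * (t / real n)"
    "integrable M (\<lambda>\<omega>. (dB n i \<omega>) ^ 4)" "expectation (\<lambda>\<omega>. (dB n i \<omega>) ^ 4) \<le> c * (t / real n)\<^sup>2"
  unfolding dB_def[abs_def] grid_diff[of t n i, symmetric]
  by (intro B_int2 B_mean B_var B_int4 B_fourth grid_nonneg grid_strict t assms less_imp_le[OF t])+

text \<open>Each \<open>err_approx r k i\<close> is a sum of Brownian increments with adapted
  coefficients that are at most \<open>\<epsilon>\<close> on \<open>A\<close> off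
  \<open>osc r \<epsilon>\<close>. After truncation the second moments, summed over
  \<open>i\<close>, stay below \<open>\<epsilon>\<^sup>2 * (2 * v * t)\<close> uniformly in
  \<open>k\<close>; the factor 2 comes from treating real and imaginary parts separately.\<close>

lemma L2_err_le:
  assumes r: "0 < r" and \<epsilon>: "0 \<le> \<epsilon>"
  shows "trunc_norm M A (\<lambda>\<omega>. L2_set (\<lambda>i. norm (err r i \<omega>)) {..<r}) \<le> prob (osc r \<epsilon>) + \<epsilon> * sqrt (2 * v * t)"
proof -
  have main: "trunc_norm M A (\<lambda>\<omega>. L2_set (\<lambda>i. norm (err_approx r k i \<omega>)) {..<r}) \<le> prob (osc r \<epsilon>) + \<epsilon> * sqrt (2 * v * t)"
    if k: "0 < k" for k
  proof -
    define h where "h i l \<omega> = L (grid t (r * k) (i * k + l)) \<omega> - L (grid t r i) \<omega>" for i l \<omega>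
    \<comment> \<open>The truncation looks at \<open>h i l\<close> alone, which is known at time
      \<open>p i l\<close>, so it stays adapted; on \<open>A\<close> off
      \<open>osc r \<epsilon>\<close> it changes nothing.\<close>
    define h' where "h' i l \<omega> = (if norm (h i l \<omega>) \<le> \<epsilon> then h i l \<omega> else 0)" for i l \<omega>
    define p where "p i l = grid t (r * k) (i * k + l)" for i l
    define b where "b i l \<omega> = B (p i (Suc l)) \<omega> - B (p i l) \<omega>" for i l \<omega>
    have b_dB: "b i l = dB (r * k) (i * k + l)" for i l by (simp add: b_def[abs_def] dB_def[abs_def] p_def)
    have pm: "grid t r i \<le> p i l" for i l
      using grid_mono[of t "i * k" "i * k + l" "r * k"] t k by (simp add: p_def grid_refine)
    have h_meas: "h i l \<in> borel_measurable (F (p i l))" for i l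
      unfolding h_def[abs_def] p_def[symmetric] using t pm[of i l]
      by (intro borel_measurable_diff measurable_F_mono[OF L_adapted pm] L_adapted) (auto simp: grid_nonneg p_def)
    have h'_meas: "h' i l \<in> borel_measurable (F (p i l))" for i l
      unfolding h'_def[abs_def] using h_meas[of i l] by measurable
    have h'_meas' [measurable]: "h' i l \<in> borel_measurable M" for i l
      by (rule measurable_F[OF h'_meas])
    have b_meas [measurable]: "b i l \<in> borel_measurable M" for i l
      unfolding b_dB by measurable
    have h'_le: "\<bar>Re (h' i l \<omega>)\<bar> \<le> \<epsilon>" "\<bar>Im (h' i l \<omega>)\<bar> \<le> \<epsilon>" for i l \<omega>
      using \<epsilon> abs_Re_le_cmod[of "h i l \<omega>"] abs_Im_le_cmod[of "h i l \<omega>"] by (auto simp: h'_def)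
    have rk: "0 < r * k" using r k by simp
    have bound: "integrable M (\<lambda>\<omega>. (\<Sum>l<k. g l \<omega> * b i l \<omega>)\<^sup>2) \<and>
        expectation (\<lambda>\<omega>. (\<Sum>l<k. g l \<omega> * b i l \<omega>)\<^sup>2) \<le> \<epsilon>\<^sup>2 * (v * t / real r)"
      if g: "\<And>l. g l \<in> borel_measurable (F (p i l))" "\<And>l \<omega>. \<bar>g l \<omega>\<bar> \<le> \<epsilon>" for g i
    proof -
      have p0: "0 \<le> p i 0" and p_less: "p i l < p i (Suc l)" for l
        using t rk by (simp_all add: p_def grid_nonneg grid_strict)
      have inc: "integrable M (\<lambda>\<omega>. (b i l \<omega>)\<^sup>2)" "expectation (\<lambda>\<omega>. b i l \<omega>) = 0"
        "expectation (\<lambda>\<omega>. (b i l \<omega>)\<^sup>2) \<le> v * (t / real (r * k))" for l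
        unfolding b_dB using grid_increments(1-3)[OF rk, of "i * k + l"] by simp_all
      note sums = expectation_square_sum_le[where p="p i" and h=g and C=\<epsilon> and \<psi>="\<lambda>_ x. x" and r=k
          and V="\<lambda>_. v * (t / real (r * k))", folded b_def, OF p0 p_less g _ inc]
      have "expectation (\<lambda>\<omega>. (\<Sum>l<k. g l \<omega> * b i l \<omega>)\<^sup>2) \<le> \<epsilon>\<^sup>2 * (\<Sum>l<k. v * (t / real (r * k)))"
        by (rule sums(3)) simp
      also have "\<dots> = \<epsilon>\<^sup>2 * (v * t / real r)" using k by simp
      finally show ?thesis using sums(2) by simp
    qed
    define e' where "e' i \<omega> = (\<Sum>l<k. h' i l \<omega> * of_real (b i l \<omega>))" for i \<omega>
    have [measurable]: "e' i \<in> borel_measurable M" for i unfolding e'_def[abs_def] by measurable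
    have ReIm: "Re (e' i \<omega>) = (\<Sum>l<k. Re (h' i l \<omega>) * b i l \<omega>)" "Im (e' i \<omega>) = (\<Sum>l<k. Im (h' i l \<omega>) * b i l \<omega>)" for i \<omega>
      by (simp_all add: e'_def)
    have R: "integrable M (\<lambda>\<omega>. (Re (e' i \<omega>))\<^sup>2)" "expectation (\<lambda>\<omega>. (Re (e' i \<omega>))\<^sup>2) \<le> \<epsilon>\<^sup>2 * (v * t / real r)"
      and I: "integrable M (\<lambda>\<omega>. (Im (e' i \<omega>))\<^sup>2)" "expectation (\<lambda>\<omega>. (Im (e' i \<omega>))\<^sup>2) \<le> \<epsilon>\<^sup>2 * (v * t / real r)" for i
      unfolding ReIm using bound[of "\<lambda>l \<omega>. Re (h' i l \<omega>)" i] bound[of "\<lambda>l \<omega>. Im (h' i l \<omega>)" i] h'_le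
        measurable_compose[OF h'_meas borel_measurable_Re] measurable_compose[OF h'_meas borel_measurable_Im] by auto
    have sq: "(L2_set (\<lambda>i. norm (e' i \<omega>)) {..<r})\<^sup>2 = (\<Sum>i<r. (Re (e' i \<omega>))\<^sup>2 + (Im (e' i \<omega>))\<^sup>2)" for \<omega>
      by (simp add: L2_set_def sum_nonneg cmod_power2)
    have int: "integrable M (\<lambda>\<omega>. (L2_set (\<lambda>i. norm (e' i \<omega>)) {..<r})\<^sup>2)"
      unfolding sq by (intro Bochner_Integration.integrable_sum Bochner_Integration.integrable_add R I)
    have "expectation (\<lambda>\<omega>. (L2_set (\<lambda>i. norm (e' i \<omega>)) {..<r})\<^sup>2)
        = (\<Sum>i<r. expectation (\<lambda>\<omega>. (Re (e' i \<omega>))\<^sup>2) + expectation (\<lambda>\<omega>. (Im (e' i \<omega>))\<^sup>2))"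
      unfolding sq using R(1) I(1) by (simp add: Bochner_Integration.integral_sum)
    also have "\<dots> \<le> (\<Sum>i<r. \<epsilon>\<^sup>2 * (v * t / real r) + \<epsilon>\<^sup>2 * (v * t / real r))"
      by (intro sum_mono add_mono R I)
    also have "\<dots> = \<epsilon>\<^sup>2 * (2 * v * t)" using r by (simp add: field_simps)
    finally have "sqrt (expectation (\<lambda>\<omega>. (L2_set (\<lambda>i. norm (e' i \<omega>)) {..<r})\<^sup>2)) \<le> sqrt (\<epsilon>\<^sup>2 * (2 * v * t))"
      by (rule real_sqrt_le_mono)
    also have "\<dots> = \<epsilon> * sqrt (2 * v * t)" using \<epsilon> by (simp add: real_sqrt_mult)
    finally have s: "sqrt (expectation (\<lambda>\<omega>. (L2_set (\<lambda>i. norm (e' i \<omega>)) {..<r})\<^sup>2)) \<le> \<epsilon> * sqrt (2 * v * t)" .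
    have "trunc_norm M A (\<lambda>\<omega>. L2_set (\<lambda>i. norm (err_approx r k i \<omega>)) {..<r})
        \<le> prob (osc r \<epsilon>) + trunc_norm M A (\<lambda>\<omega>. L2_set (\<lambda>i. norm (e' i \<omega>)) {..<r})"
    proof (rule trunc_norm_le_off[OF A])
      fix \<omega> assume \<omega>: "\<omega> \<in> space M" "\<omega> \<in> A" "\<omega> \<notin> osc r \<epsilon>"
      have "h' i l \<omega> = h i l \<omega>" if "i < r" "l < k" for i l
      proof -
        have il: "i * k + l \<le> r * k" using that mult_le_mono1[of "Suc i" r k] by simp
        have "\<bar>p i l - grid t r i\<bar> \<le> t / real r"
          using grid_coarse_dist[of t k r "i * k + l"] t k r pm[of i l] that by (simp add: p_def)
        from not_osc(1)[OF \<omega> il _ this[unfolded p_def]] that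
        have "(1 + norm (L (grid t r i) \<omega>)) * norm (h i l \<omega>) \<le> \<epsilon>" by (simp add: h_def)
        moreover have "1 * norm (h i l \<omega>) \<le> (1 + norm (L (grid t r i) \<omega>)) * norm (h i l \<omega>)"
          by (intro mult_right_mono) auto
        ultimately show ?thesis by (simp add: h'_def)
      qed
      then have "e' i \<omega> = err_approx r k i \<omega>" if "i < r" for i
        using that by (simp add: e'_def err_approx_def h_def b_dB)
      then have "L2_set (\<lambda>i. norm (err_approx r k i \<omega>)) {..<r} = L2_set (\<lambda>i. norm (e' i \<omega>)) {..<r}"
        by (intro L2_set_cong) auto
      then show "norm (L2_set (\<lambda>i. norm (err_approx r k i \<omega>)) {..<r}) \<le> norm (L2_set (\<lambda>i. norm (e' i \<omega>)) {..<r})"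
        by simp
    qed measurable
    also have "trunc_norm M A (\<lambda>\<omega>. L2_set (\<lambda>i. norm (e' i \<omega>)) {..<r}) \<le> \<epsilon> * sqrt (2 * v * t)"
      by (rule order_trans[OF trunc_norm_le_L2[OF A _ int] s]) measurable
    finally show ?thesis by simp
  qed
  have "trunc_norm M A (\<lambda>\<omega>. L2_set (\<lambda>i. norm (err r i \<omega>)) {..<r})
      \<le> (\<Sum>i<r. trunc_norm M A (\<lambda>\<omega>. err r i \<omega> - err_approx r k i \<omega>)) + (prob (osc r \<epsilon>) + \<epsilon> * sqrt (2 * v * t))"
    if k: "0 < k" for k
  proof -
    have "trunc_norm M A (\<lambda>\<omega>. L2_set (\<lambda>i. norm (err r i \<omega>)) {..<r})
        \<le> trunc_norm M A (\<lambda>\<omega>. (\<Sum>i<r. norm (err r i \<omega> - err_approx r k i \<omega>)) + L2_set (\<lambda>i. norm (err_approx r k i \<omega>)) {..<r})"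
      by (rule trunc_norm_mono[OF A]; (measurable)?)
         (use L2_set_le_sum_norm[of "{..<r}"] in \<open>simp add: L2_set_nonneg sum_nonneg\<close>)
    also have "\<dots> \<le> trunc_norm M A (\<lambda>\<omega>. \<Sum>i<r. norm (err r i \<omega> - err_approx r k i \<omega>))
        + trunc_norm M A (\<lambda>\<omega>. L2_set (\<lambda>i. norm (err_approx r k i \<omega>)) {..<r})"
      by (rule trunc_norm_add[OF A]) measurable
    also have "trunc_norm M A (\<lambda>\<omega>. \<Sum>i<r. norm (err r i \<omega> - err_approx r k i \<omega>))
        \<le> (\<Sum>i<r. trunc_norm M A (\<lambda>\<omega>. norm (err r i \<omega> - err_approx r k i \<omega>)))"
      by (rule trunc_norm_sum[OF A]) auto
    finally show ?thesis
      using main[OF k] by (simp add: trunc_norm_def)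
  qed
  then have le: "\<forall>k\<ge>1. trunc_norm M A (\<lambda>\<omega>. L2_set (\<lambda>i. norm (err r i \<omega>)) {..<r})
      \<le> (\<Sum>i<r. trunc_norm M A (\<lambda>\<omega>. err r i \<omega> - err_approx r k i \<omega>)) + (prob (osc r \<epsilon>) + \<epsilon> * sqrt (2 * v * t))"
    by simp
  \<comment> \<open>The estimate holds for every positive \<open>k\<close>, and only the sum of the
    approximation errors depends on \<open>k\<close>.\<close>
  have lim: "(\<lambda>k. (\<Sum>i<r. trunc_norm M A (\<lambda>\<omega>. err r i \<omega> - err_approx r k i \<omega>)) + (prob (osc r \<epsilon>) + \<epsilon> * sqrt (2 * v * t)))
      \<longlonglongrightarrow> 0 + (prob (osc r \<epsilon>) + \<epsilon> * sqrt (2 * v * t))"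
    by (intro tendsto_add err_approx_tendsto r tendsto_const)
  have "trunc_norm M A (\<lambda>\<omega>. L2_set (\<lambda>i. norm (err r i \<omega>)) {..<r}) \<le> 0 + (prob (osc r \<epsilon>) + \<epsilon> * sqrt (2 * v * t))"
    by (rule LIMSEQ_le_const[OF lim]) (use le in blast)
  then show ?thesis by simp
qed

end

section \<open>Cross term, quadratic variation and almost sure limits\<close>

lemma borel_measurable_cnj [measurable]: "cnj \<in> borel_measurable borel"
  by (intro borel_measurable_continuous_onI continuous_intros)

context stochastic_integral
begin

text \<open>\<open>cnj L * L\<close> and the increments of \<open>B\<close> are real, so only the
  one-step errors contribute to the imaginary part. Their approximations give a sum of increments
  whose coefficients are oscillations of \<open>L\<close> multiplied by its value at the coarse
  point; for this reason \<open>osc\<close> weights the oscillation with the size of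
  \<open>L\<close>.\<close>

lemma cross_term_le:
  assumes r: "0 < r" and \<epsilon>: "0 \<le> \<epsilon>"
  shows "trunc_norm M A (\<lambda>\<omega>. \<Sum>i<r. Im (cnj (L (grid t r i) \<omega>) * dY r i \<omega>)) \<le> 2 * prob (osc r \<epsilon>) + \<epsilon> * sqrt (v * t)"
    (is "trunc_norm M A ?X \<le> _")
proof -
  \<comment> \<open>Bounds the norm of \<open>L\<close> at coarse points on \<open>A\<close> off
    \<open>osc r \<epsilon>\<close>, because a number whose square is at most \<open>y\<close> is at
    most \<open>1 + y\<close>. It grows with \<open>r\<close>, which is harmless: its factor
    vanishes as \<open>k\<close> tends to infinity with \<open>r\<close> fixed.\<close>
  define K where "K = 1 + \<epsilon> * sqrt (real r)"
  have K: "1 \<le> K" using \<epsilon> by (simp add: K_def)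
  define U where "U k \<omega> = (\<Sum>i<r. Im (cnj (L (grid t r i) \<omega>) * err_approx r k i \<omega>))" for k \<omega>
  define W where "W k \<omega> = (\<Sum>i<r. norm (err r i \<omega> - err_approx r k i \<omega>))" for k \<omega>
  have [measurable]: "U k \<in> borel_measurable M" "W k \<in> borel_measurable M" for k
    unfolding U_def[abs_def] W_def[abs_def] by measurable
  have trunc_U: "trunc_norm M A (U k) \<le> prob (osc r \<epsilon>) + \<epsilon> * sqrt (v * t)" if k: "0 < k" for k
  proof -
    \<comment> \<open>\<open>m div k\<close> is the coarse step that contains the fine step
      \<open>m\<close>; in this form the double sum becomes a single sum over the fine grid.\<close>
    define h where "h m \<omega> = Im (cnj (L (grid t r (m div k)) \<omega>) * (L (grid t (r * k) m) \<omega> - L (grid t r (m div k)) \<omega>))" for m \<omega>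
    have rk: "0 < r * k" using r k by simp
    have t0: "0 \<le> t" using t by simp
    have "U k \<omega> = (\<Sum>i<r. \<Sum>l<k. h (i * k + l) \<omega> * dB (r * k) (i * k + l) \<omega>)" for \<omega>
      unfolding U_def err_approx_def sum_distrib_left Im_sum
      by (intro sum.cong refl) (simp add: h_def algebra_simps)
    then have U_eq: "U k = (\<lambda>\<omega>. \<Sum>m<r * k. h m \<omega> * (B (grid t (r * k) (Suc m)) \<omega> - B (grid t (r * k) m) \<omega>))"
      using sum_nested[of "\<lambda>m. h m _ * dB (r * k) m _" k r] unfolding dB_def by (auto simp: fun_eq_iff)
    have "trunc_norm M A (U k) \<le> prob (osc r \<epsilon>) + \<epsilon> * sqrt (\<Sum>m<r * k. v * (t / real (r * k)))"
      unfolding U_eq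
    proof (rule trunc_norm_increment_sum_le[where \<psi>="\<lambda>_ x. x"])
      fix m assume "m < r * k"
      have [measurable]: "L (grid t r (m div k)) \<in> borel_measurable (F (grid t (r * k) m))"
        "L (grid t (r * k) m) \<in> borel_measurable (F (grid t (r * k) m))"
        using t by (auto intro!: measurable_F_mono[OF L_adapted] L_adapted grid_coarse_le k simp: grid_nonneg)
      show "h m \<in> borel_measurable (F (grid t (r * k) m))"
        unfolding h_def[abs_def] by measurable
      show "integrable M (\<lambda>\<omega>. (B (grid t (r * k) (Suc m)) \<omega> - B (grid t (r * k) m) \<omega>)\<^sup>2)"
        "expectation (\<lambda>\<omega>. B (grid t (r * k) (Suc m)) \<omega> - B (grid t (r * k) m) \<omega>) = 0"
        "expectation (\<lambda>\<omega>. (B (grid t (r * k) (Suc m)) \<omega> - B (grid t (r * k) m) \<omega>)\<^sup>2) \<le> v * (t / real (r * k))"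
        using grid_increments(1-3)[OF rk, of m] unfolding dB_def by simp_all
    next
      fix m \<omega> assume m: "m < r * k" and \<omega>: "\<omega> \<in> space M" "\<omega> \<in> A" "\<omega> \<notin> osc r \<epsilon>"
      have mk: "m div k < r" using m by (simp add: less_mult_imp_div_less)
      have "\<bar>grid t (r * k) m - grid t r (m div k)\<bar> \<le> t / real r"
        using grid_coarse_dist[OF t0 k r, of m] grid_coarse_le[OF t0 k, of r m] by simp
      from not_osc(1)[OF \<omega> _ _ this] m mk
      have "(1 + norm (L (grid t r (m div k)) \<omega>)) * norm (L (grid t (r * k) m) \<omega> - L (grid t r (m div k)) \<omega>) \<le> \<epsilon>"
        by simp
      moreover have "norm (L (grid t r (m div k)) \<omega>) * norm (L (grid t (r * k) m) \<omega> - L (grid t r (m div k)) \<omega>)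
          \<le> (1 + norm (L (grid t r (m div k)) \<omega>)) * norm (L (grid t (r * k) m) \<omega> - L (grid t r (m div k)) \<omega>)"
        by (intro mult_right_mono) auto
      moreover have "\<bar>h m \<omega>\<bar> \<le> norm (L (grid t r (m div k)) \<omega>) * norm (L (grid t (r * k) m) \<omega> - L (grid t r (m div k)) \<omega>)"
        unfolding h_def by (rule order_trans[OF abs_Im_le_cmod]) (simp add: norm_mult)
      ultimately show "\<bar>h m \<omega>\<bar> \<le> \<epsilon>" by linarith
    qed (use t rk \<epsilon> in \<open>auto intro: grid_strict\<close>)
    also have "(\<Sum>m<r * k. v * (t / real (r * k))) = v * t" using rk by (simp add: field_simps)
    finally show ?thesis .
  qed
  have "trunc_norm M A ?X \<le> K * (\<Sum>i<r. trunc_norm M A (\<lambda>\<omega>. err r i \<omega> - err_approx r k i \<omega>)) + (2 * prob (osc r \<epsilon>) + \<epsilon> * sqrt (v * t))"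
    if k: "0 < k" for k
  proof -
    \<comment> \<open>\<open>osc r \<epsilon>\<close> is paid for a second time, now for the bound
      \<open>K\<close>; this explains the factor 2 in front of its probability.\<close>
    have "trunc_norm M A ?X \<le> prob (osc r \<epsilon>) + trunc_norm M A (\<lambda>\<omega>. norm (U k \<omega>) + K *\<^sub>R W k \<omega>)"
    proof (rule trunc_norm_le_off[OF A])
      fix \<omega> assume \<omega>: "\<omega> \<in> space M" "\<omega> \<in> A" "\<omega> \<notin> osc r \<epsilon>"
      have L_le: "norm (L (grid t r i) \<omega>) \<le> K" if "i < r" for i
      proof -
        have "(norm (L (grid t r i) \<omega>))\<^sup>2 \<le> \<epsilon> * sqrt (real r)"
          using not_osc(2)[OF \<omega>, of i r i r] that t by simp
        then show ?thesis
          unfolding K_def using power2_le_iff_abs_le[of "1 + \<epsilon> * sqrt (real r)" "norm (L (grid t r i) \<omega>)"] \<epsilon>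
          by (smt (verit) norm_ge_zero one_le_power power2_eq_square mult_le_cancel_left1 self_le_power mult_nonneg_nonneg real_sqrt_ge_zero of_nat_0_le_iff)
      qed
      have "?X \<omega> = U k \<omega> + (\<Sum>i<r. Im (cnj (L (grid t r i) \<omega>) * (err r i \<omega> - err_approx r k i \<omega>)))"
        unfolding U_def sum.distrib[symmetric] err_def
        by (intro sum.cong refl) (simp add: algebra_simps)
      moreover have "\<bar>\<Sum>i<r. Im (cnj (L (grid t r i) \<omega>) * (err r i \<omega> - err_approx r k i \<omega>))\<bar> \<le> K * W k \<omega>"
        unfolding W_def sum_distrib_left
      proof (rule order_trans[OF sum_abs sum_mono])
        fix i assume "i \<in> {..<r}"
        then show "\<bar>Im (cnj (L (grid t r i) \<omega>) * (err r i \<omega> - err_approx r k i \<omega>))\<bar> \<le> K * norm (err r i \<omega> - err_approx r k i \<omega>)"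
          using L_le[of i] by (intro order_trans[OF abs_Im_le_cmod]) (simp add: norm_mult mult_right_mono)
      qed
      moreover have "0 \<le> K * W k \<omega>" using K by (simp add: W_def sum_nonneg)
      ultimately show "norm (?X \<omega>) \<le> norm (norm (U k \<omega>) + K *\<^sub>R W k \<omega>)" by simp
    qed (unfold dY_def, measurable)
    also have "trunc_norm M A (\<lambda>\<omega>. norm (U k \<omega>) + K *\<^sub>R W k \<omega>) \<le> trunc_norm M A (\<lambda>\<omega>. norm (U k \<omega>)) + trunc_norm M A (\<lambda>\<omega>. K *\<^sub>R W k \<omega>)"
      by (rule trunc_norm_add[OF A]) measurable
    also have "trunc_norm M A (\<lambda>\<omega>. K *\<^sub>R W k \<omega>) \<le> K * trunc_norm M A (W k)"
      by (rule trunc_norm_scale[OF A _ K]) measurable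
    also have "trunc_norm M A (W k) \<le> (\<Sum>i<r. trunc_norm M A (\<lambda>\<omega>. norm (err r i \<omega> - err_approx r k i \<omega>)))"
      unfolding W_def[abs_def] by (rule trunc_norm_sum[OF A]) auto
    also have "trunc_norm M A (\<lambda>\<omega>. norm (U k \<omega>)) \<le> prob (osc r \<epsilon>) + \<epsilon> * sqrt (v * t)"
      using trunc_U[OF k] by (simp add: trunc_norm_def)
    finally show ?thesis using K by (simp add: trunc_norm_def mult_left_mono)
  qed
  then have le: "\<forall>k\<ge>1. trunc_norm M A ?X \<le> K * (\<Sum>i<r. trunc_norm M A (\<lambda>\<omega>. err r i \<omega> - err_approx r k i \<omega>)) + (2 * prob (osc r \<epsilon>) + \<epsilon> * sqrt (v * t))"
    by simp
  have lim: "(\<lambda>k. K * (\<Sum>i<r. trunc_norm M A (\<lambda>\<omega>. err r i \<omega> - err_approx r k i \<omega>)) + (2 * prob (osc r \<epsilon>) + \<epsilon> * sqrt (v * t)))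
      \<longlonglongrightarrow> K * 0 + (2 * prob (osc r \<epsilon>) + \<epsilon> * sqrt (v * t))"
    by (intro tendsto_add tendsto_mult err_approx_tendsto r tendsto_const)
  have "trunc_norm M A ?X \<le> K * 0 + (2 * prob (osc r \<epsilon>) + \<epsilon> * sqrt (v * t))"
    by (rule LIMSEQ_le_const[OF lim]) (use le in blast)
  then show ?thesis by simp
qed

text \<open>The centered squares have second moment at most \<open>c * (t / r)\<^sup>2\<close>. Over
  \<open>r\<close> steps the root of the sum is of order \<open>1 / sqrt r\<close>, and the bound
  \<open>\<epsilon> * sqrt r\<close> on the squared norm in \<open>osc\<close> is chosen to match
  it.\<close>

lemma quadratic_variation_le:
  assumes r: "0 < r" and \<epsilon>: "0 \<le> \<epsilon>"
  shows "trunc_norm M A (\<lambda>\<omega>. \<Sum>i<r. (norm (L (grid t r i) \<omega>))\<^sup>2 * ((dB r i \<omega>)\<^sup>2 - v * (t / real r)))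
    \<le> prob (osc r \<epsilon>) + \<epsilon> * (t * sqrt c)"
proof -
  let ?d = "t / real r"
  have "trunc_norm M A (\<lambda>\<omega>. \<Sum>i<r. (norm (L (grid t r i) \<omega>))\<^sup>2 * ((B (grid t r (Suc i)) \<omega> - B (grid t r i) \<omega>)\<^sup>2 - v * ?d))
      \<le> prob (osc r \<epsilon>) + (\<epsilon> * sqrt (real r)) * sqrt (\<Sum>i<r. c * ?d\<^sup>2)"
  proof (rule trunc_norm_increment_sum_le[where \<psi>="\<lambda>_ x. x\<^sup>2 - v * ?d"])
    fix i assume i: "i < r"
    show "(\<lambda>\<omega>. (norm (L (grid t r i) \<omega>))\<^sup>2) \<in> borel_measurable (F (grid t r i))"
      using L_adapted[of "grid t r i"] t by (simp add: grid_nonneg)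
    note I = grid_increments[OF r, of i]
    have eq: "((dB r i \<omega>)\<^sup>2 - v * ?d)\<^sup>2 = (dB r i \<omega>) ^ 4 - 2 * (v * ?d) * (dB r i \<omega>)\<^sup>2 + (v * ?d)\<^sup>2" for \<omega>
      by (simp add: power2_eq_square power4_eq_xxxx algebra_simps)
    have "integrable M (\<lambda>\<omega>. ((dB r i \<omega>)\<^sup>2 - v * ?d)\<^sup>2)"
      unfolding eq using I(1,4)
      by (intro Bochner_Integration.integrable_add Bochner_Integration.integrable_diff integrable_mult_right) simp_all
    moreover have "expectation (\<lambda>\<omega>. (dB r i \<omega>)\<^sup>2 - v * ?d) = 0"
      using I(1,3) by (simp add: prob_space)
    moreover have "expectation (\<lambda>\<omega>. ((dB r i \<omega>)\<^sup>2 - v * ?d)\<^sup>2) \<le> c * ?d\<^sup>2"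
    proof -
      have "expectation (\<lambda>\<omega>. ((dB r i \<omega>)\<^sup>2 - v * ?d)\<^sup>2) = expectation (\<lambda>\<omega>. (dB r i \<omega>) ^ 4) - (v * ?d)\<^sup>2"
        unfolding eq using I by (simp add: prob_space power2_eq_square)
      also have "\<dots> \<le> c * ?d\<^sup>2" using I(5) zero_le_power2[of "v * ?d"] by linarith
      finally show ?thesis .
    qed
    ultimately show "integrable M (\<lambda>\<omega>. ((B (grid t r (Suc i)) \<omega> - B (grid t r i) \<omega>)\<^sup>2 - v * ?d)\<^sup>2)"
      "expectation (\<lambda>\<omega>. (B (grid t r (Suc i)) \<omega> - B (grid t r i) \<omega>)\<^sup>2 - v * ?d) = 0"
      "expectation (\<lambda>\<omega>. ((B (grid t r (Suc i)) \<omega> - B (grid t r i) \<omega>)\<^sup>2 - v * ?d)\<^sup>2) \<le> c * ?d\<^sup>2"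
      unfolding dB_def by simp_all
  next
    fix i \<omega> assume "i < r" "\<omega> \<in> space M" "\<omega> \<in> A" "\<omega> \<notin> osc r \<epsilon>"
    then show "\<bar>(norm (L (grid t r i) \<omega>))\<^sup>2\<bar> \<le> \<epsilon> * sqrt (real r)"
      using not_osc(2)[of \<omega> r \<epsilon> i r i r] t by simp
  qed (use t r \<epsilon> in \<open>auto intro: grid_strict\<close>)
  also have "(\<epsilon> * sqrt (real r)) * sqrt (\<Sum>i<r. c * ?d\<^sup>2) = \<epsilon> * (t * sqrt c)"
  proof -
    have "sqrt (real r) * sqrt (\<Sum>i<r. c * ?d\<^sup>2) = sqrt ((t\<^sup>2) * c)"
      using r unfolding real_sqrt_mult[symmetric] by (simp add: power_divide) (simp add: field_simps power2_eq_square)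
    also have "\<dots> = t * sqrt c" using t by (simp add: real_sqrt_mult)
    finally show ?thesis by (simp add: mult.assoc)
  qed
  finally show ?thesis unfolding dB_def .
qed

text \<open>Convergence in probability yields almost sure limits along a subsequence only. That is
  enough, because the sides of the formula to be proved do not depend on the grid.\<close>

theorem grid_limits_subsequence:
  obtains \<rho> :: "nat \<Rightarrow> nat" where "strict_mono \<rho>"
    "AE \<omega> in M. \<omega> \<in> A \<longrightarrow>
      (\<lambda>m. \<Sum>i<\<rho> m. Im (cnj (L (grid t (\<rho> m) i) \<omega>) * dY (\<rho> m) i \<omega>)) \<longlonglongrightarrow> 0 \<and>
      (\<lambda>m. L2_set (\<lambda>i. norm (err (\<rho> m) i \<omega>)) {..<\<rho> m}) \<longlonglongrightarrow> 0 \<and>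
      (\<lambda>m. \<Sum>i<\<rho> m. (norm (L (grid t (\<rho> m) i) \<omega>))\<^sup>2 * ((dB (\<rho> m) i \<omega>)\<^sup>2 - v * (t / real (\<rho> m)))) \<longlonglongrightarrow> 0"
proof -
  define R1 where "R1 r \<omega> = (\<Sum>i<r. Im (cnj (L (grid t r i) \<omega>) * dY r i \<omega>))" for r \<omega>
  define R2 where "R2 r \<omega> = L2_set (\<lambda>i. norm (err r i \<omega>)) {..<r}" for r \<omega>
  define R3 where "R3 r \<omega> = (\<Sum>i<r. (norm (L (grid t r i) \<omega>))\<^sup>2 * ((dB r i \<omega>)\<^sup>2 - v * (t / real r)))" for r \<omega>
  \<comment> \<open>One sum for all three remainders, so that a single subsequence serves them all;
    the 4 below is 2 + 1 + 1 from the three bounds.\<close>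
  define Z where "Z r \<omega> = \<bar>R1 r \<omega>\<bar> + \<bar>R2 r \<omega>\<bar> + \<bar>R3 r \<omega>\<bar>" for r \<omega>
  define D where "D = sqrt (v * t) + sqrt (2 * v * t) + t * sqrt c"
  have [measurable]: "R1 r \<in> borel_measurable M" "R2 r \<in> borel_measurable M" "R3 r \<in> borel_measurable M" for r
    unfolding R1_def[abs_def] R2_def[abs_def] R3_def[abs_def] by measurable
  have [measurable]: "Z r \<in> borel_measurable M" for r unfolding Z_def[abs_def] by measurable
  have D: "0 \<le> D" using t v_nonneg c_nonneg by (simp add: D_def)
  have Z_le: "trunc_norm M A (Z r) \<le> 4 * prob (osc r \<epsilon>) + \<epsilon> * D" if "0 < r" "0 \<le> \<epsilon>" for r \<epsilon>
  proof -
    have "trunc_norm M A (Z r) \<le> trunc_norm M A (\<lambda>\<omega>. \<bar>R1 r \<omega>\<bar> + \<bar>R2 r \<omega>\<bar>) + trunc_norm M A (\<lambda>\<omega>. \<bar>R3 r \<omega>\<bar>)"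
      unfolding Z_def[abs_def] by (rule trunc_norm_add[OF A]) measurable
    also have "trunc_norm M A (\<lambda>\<omega>. \<bar>R1 r \<omega>\<bar> + \<bar>R2 r \<omega>\<bar>) \<le> trunc_norm M A (\<lambda>\<omega>. \<bar>R1 r \<omega>\<bar>) + trunc_norm M A (\<lambda>\<omega>. \<bar>R2 r \<omega>\<bar>)"
      by (rule trunc_norm_add[OF A]) measurable
    finally have "trunc_norm M A (Z r) \<le> trunc_norm M A (R1 r) + trunc_norm M A (R2 r) + trunc_norm M A (R3 r)"
      by (simp add: trunc_norm_def)
    also have "\<dots> \<le> (2 * prob (osc r \<epsilon>) + \<epsilon> * sqrt (v * t)) + (prob (osc r \<epsilon>) + \<epsilon> * sqrt (2 * v * t))
        + (prob (osc r \<epsilon>) + \<epsilon> * (t * sqrt c))"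
      unfolding R1_def[abs_def] R2_def[abs_def] R3_def[abs_def]
      by (intro add_mono cross_term_le L2_err_le quadratic_variation_le that)
    finally show ?thesis by (simp add: D_def algebra_simps)
  qed
  have "(\<lambda>r. trunc_norm M A (Z r)) \<longlonglongrightarrow> 0"
  proof (rule LIMSEQ_I)
    fix e :: real assume e: "0 < e"
    define \<epsilon> where "\<epsilon> = e / (2 * (D + 1))"
    have \<epsilon>: "0 < \<epsilon>" using e D by (simp add: \<epsilon>_def)
    have "\<epsilon> * D \<le> \<epsilon> * (D + 1)" using \<epsilon> by simp
    also have "\<dots> = e / 2" using D by (simp add: \<epsilon>_def field_simps)
    finally have \<epsilon>D: "\<epsilon> * D \<le> e / 2" .
    have "\<forall>\<^sub>F r in sequentially. prob (osc r \<epsilon>) < e / 8"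
      using osc_tendsto_0[OF \<epsilon>] e by (intro order_tendstoD) auto
    then obtain N where N: "\<And>r. N \<le> r \<Longrightarrow> prob (osc r \<epsilon>) < e / 8" by (auto simp: eventually_sequentially)
    show "\<exists>no. \<forall>r\<ge>no. norm (trunc_norm M A (Z r) - 0) < e"
    proof (intro exI[of _ "Suc N"] allI impI)
      fix r assume "Suc N \<le> r"
      then have "trunc_norm M A (Z r) < e"
        using Z_le[of r \<epsilon>] N[of r] \<epsilon> \<epsilon>D by simp
      then show "norm (trunc_norm M A (Z r) - 0) < e" by (simp add: trunc_norm_nonneg[OF A])
    qed
  qed
  moreover have "trunc_norm M A (Z r) = (\<integral>\<omega>. norm (indicator A \<omega> * min 1 (norm (Z r \<omega>)) :: real) \<partial>M)" for r
    unfolding trunc_norm_def by (intro Bochner_Integration.integral_cong) auto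
  ultimately have "(\<lambda>r. \<integral>\<omega>. norm (indicator A \<omega> * min 1 (norm (Z r \<omega>)) :: real) \<partial>M) \<longlonglongrightarrow> 0" by simp
  from tendsto_L1_AE_subseq[OF trunc_norm_integrable[OF A, of "Z _"] this]
  obtain \<rho> :: "nat \<Rightarrow> nat" where \<rho>: "strict_mono \<rho>"
    and lim: "AE \<omega> in M. (\<lambda>m. indicator A \<omega> * min 1 (norm (Z (\<rho> m) \<omega>)) :: real) \<longlonglongrightarrow> 0" by auto
  have "AE \<omega> in M. \<omega> \<in> A \<longrightarrow> (\<lambda>m. R1 (\<rho> m) \<omega>) \<longlonglongrightarrow> 0 \<and> (\<lambda>m. R2 (\<rho> m) \<omega>) \<longlonglongrightarrow> 0 \<and> (\<lambda>m. R3 (\<rho> m) \<omega>) \<longlonglongrightarrow> 0"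
    using lim
  proof eventually_elim
    case (elim \<omega>)
    show ?case
    proof
      assume "\<omega> \<in> A"
      with elim have lim1: "(\<lambda>m. min 1 (Z (\<rho> m) \<omega>)) \<longlonglongrightarrow> 0" by (simp add: Z_def)
      then have "\<forall>\<^sub>F m in sequentially. min 1 (Z (\<rho> m) \<omega>) < 1"
        by (rule order_tendstoD) simp
      then have "\<forall>\<^sub>F m in sequentially. min 1 (Z (\<rho> m) \<omega>) = Z (\<rho> m) \<omega>"
        by eventually_elim auto
      with lim1 have Z0: "(\<lambda>m. Z (\<rho> m) \<omega>) \<longlonglongrightarrow> 0" by (rule Lim_transform_eventually)
      show "(\<lambda>m. R1 (\<rho> m) \<omega>) \<longlonglongrightarrow> 0 \<and> (\<lambda>m. R2 (\<rho> m) \<omega>) \<longlonglongrightarrow> 0 \<and> (\<lambda>m. R3 (\<rho> m) \<omega>) \<longlonglongrightarrow> 0"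
        by (intro conjI; rule Lim_null_comparison[OF _ Z0]; simp add: Z_def)
    qed
  qed
  with that[OF \<rho>] show thesis unfolding R1_def R2_def R3_def by blast
qed

end

section \<open>Solutions of the Langevin equation\<close>

lemma normal_increment_moments:
  assumes D: "distributed M lborel X (normal_density 0 (sqrt s))" and s: "0 < s"
  shows "integrable M X" "integral\<^sup>L M X = 0"
    "integrable M (\<lambda>\<omega>. (X \<omega>)\<^sup>2)" "(\<integral>\<omega>. (X \<omega>)\<^sup>2 \<partial>M) = s"
    "integrable M (\<lambda>\<omega>. (X \<omega>) ^ 4)" "(\<integral>\<omega>. (X \<omega>) ^ 4 \<partial>M) = 3 * s\<^sup>2"
proof -
  have moment: "integrable M (\<lambda>\<omega>. (X \<omega>) ^ n) \<and> (\<integral>\<omega>. (X \<omega>) ^ n \<partial>M) = m"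
    if "has_bochner_integral lborel (\<lambda>x. normal_density 0 (sqrt s) x * x ^ n) m" for n m
  proof -
    have m: "(\<lambda>x :: real. x ^ n) \<in> borel_measurable lborel" by measurable
    show ?thesis
      using that distributed_integrable[OF D m] distributed_integral[OF D m]
      by (simp add: has_bochner_integral_iff)
  qed
  show "integrable M X" "integral\<^sup>L M X = 0"
    using moment[of 1 0] normal_moment_odd[of "sqrt s" 0 0] s by simp_all
  show "integrable M (\<lambda>\<omega>. (X \<omega>)\<^sup>2)" "(\<integral>\<omega>. (X \<omega>)\<^sup>2 \<partial>M) = s"
    using moment[of 2 s] normal_moment_even[of "sqrt s" 0 1] s by (simp_all add: fact_numeral)
  show "integrable M (\<lambda>\<omega>. (X \<omega>) ^ 4)" "(\<integral>\<omega>. (X \<omega>) ^ 4 \<partial>M) = 3 * s\<^sup>2"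
    using moment[of 4 "3 * s\<^sup>2"] normal_moment_even[of "sqrt s" 0 2] s
    by (simp_all add: fact_numeral power_divide field_simps)
qed

text \<open>The Cauchy-Schwarz inequality, applied twice. A crude constant is enough, since the
  fourth moments only have to be of the order of the squared time step.\<close>

lemma sum_pow4_le:
  fixes z :: "'m::finite \<Rightarrow> real"
  shows "(\<Sum>a\<in>UNIV. z a) ^ 4 \<le> real CARD('m) ^ 3 * (\<Sum>a\<in>UNIV. (z a) ^ 4)"
proof -
  let ?m = "real CARD('m)"
  have "(\<Sum>a\<in>UNIV. z a) ^ 4 = ((\<Sum>a\<in>UNIV. z a)\<^sup>2)\<^sup>2" by simp
  also have "\<dots> \<le> ((\<Sum>a\<in>UNIV. (z a)\<^sup>2) * ?m)\<^sup>2"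
    by (intro power_mono sum_squared_le_sum_of_squares) simp
  also have "\<dots> = ?m\<^sup>2 * (\<Sum>a\<in>UNIV. (z a)\<^sup>2)\<^sup>2" by (simp add: power_mult_distrib)
  also have "\<dots> \<le> ?m\<^sup>2 * ((\<Sum>a\<in>UNIV. ((z a)\<^sup>2)\<^sup>2) * ?m)"
    by (intro mult_left_mono sum_squared_le_sum_of_squares) simp
  also have "\<dots> = ?m ^ 3 * (\<Sum>a\<in>UNIV. (z a) ^ 4)"
    by (simp add: power2_eq_square power3_eq_cube power4_eq_xxxx mult.assoc)
  finally show ?thesis .
qed

text \<open>Variances add because distinct components have independent centered increments; 2 is the
  variance of each per unit time. The constant 12 is 3 times 2 squared, from the Gaussian fourth
  moment at variance \<open>2 * (t - s)\<close>, and the power of \<open>CARD('m)\<close> comes from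
  \<open>sum_pow4_le\<close>.\<close>

lemma brownian_driver_linear_combination:
  fixes w :: "'m::finite \<Rightarrow> real \<Rightarrow> 'w \<Rightarrow> real" and y :: "'m \<Rightarrow> real"
  assumes F: "filtered_prob_space P F" and w: "brownian_motions2 P F w"
  shows "brownian_driver P F (\<lambda>t \<omega>. \<Sum>a\<in>UNIV. y a * w a t \<omega>) (2 * (\<Sum>a\<in>UNIV. (y a)\<^sup>2))
    (12 * real CARD('m) ^ 3 * (\<Sum>a\<in>UNIV. (y a) ^ 4))"
proof -
  let ?B = "\<lambda>t \<omega>. \<Sum>a\<in>UNIV. y a * w a t \<omega>"
  have P: "prob_space P" and filt: "filtration (space P) F" and sub: "\<And>t. subalgebra P (F t)"
    using F by (auto simp: filtered_prob_space_def)
  interpret prob_space P by fact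
  have w_adapted: "0 \<le> t \<Longrightarrow> w a t \<in> borel_measurable (F t)" for a t
    using w by (simp add: brownian_motions2_def)
  have w_meas: "0 \<le> t \<Longrightarrow> w a t \<in> borel_measurable P" for a t
    by (rule measurable_from_subalg[OF sub w_adapted])
  define d where "d s t a \<omega> = w a t \<omega> - w a s \<omega>" for s t a \<omega>
  have dist: "distributed P lborel (d s t a) (normal_density 0 (sqrt (2 * (t - s))))"
    and iv: "indep_vars (\<lambda>_. borel) (\<lambda>a. d s t a) UNIV"
    and isw: "indep_set (sets (F s)) (sets (vimage_algebra (space P) (\<lambda>\<omega>. (\<chi> a. d s t a \<omega>) :: real^'m) borel))"
    if "0 \<le> s" "s < t" for s t a
    using w that unfolding brownian_motions2_def d_def[abs_def] by blast+
  have inc: "?B t \<omega> - ?B s \<omega> = (\<Sum>a\<in>UNIV. y a * d s t a \<omega>)" for s t \<omega>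
    by (simp add: d_def sum_subtractf right_diff_distrib)
  show ?thesis
  proof (intro brownian_driver.intro brownian_driver_axioms.intro)
    show "prob_space P" "filtration (space P) F" "\<And>s. subalgebra P (F s)"
      using P filt sub by auto
    show "?B s \<in> borel_measurable (F s)" if "0 \<le> s" for s
      using w_adapted[OF that] by measurable
    fix s t :: real assume st: "0 \<le> s" "s < t"
    have t_s: "0 < 2 * (t - s)" using st by simp
    note m = normal_increment_moments[OF dist[OF st] t_s]
    have d_meas [measurable]: "d s t a \<in> borel_measurable P" for a
      unfolding d_def[abs_def] using w_meas st by (intro borel_measurable_diff) auto
    show "indep_var borel X borel (\<lambda>\<omega>. ?B t \<omega> - ?B s \<omega>)" if X: "X \<in> borel_measurable (F s)" for X :: "'w \<Rightarrow> real"
    proof -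
      have "(\<lambda>\<omega>. (\<chi> a. d s t a \<omega>) :: real^'m) \<in> borel_measurable P"
        by (subst borel_measurable_euclidean_space) (auto simp: Basis_vec_def inner_axis)
      moreover have "(\<lambda>u :: real^'m. \<Sum>a\<in>UNIV. y a * u $ a) \<in> borel_measurable borel"
        by (intro borel_measurable_continuous_onI continuous_intros)
      ultimately have "indep_var borel X borel (\<lambda>\<omega>. \<Sum>a\<in>UNIV. y a * ((\<chi> a. d s t a \<omega>) :: real^'m) $ a)"
        using sub X by (intro indep_set_imp_indep_var[OF isw[OF st]]) (auto simp: subalgebra_def)
      then show ?thesis by (simp add: inc)
    qed
    show "expectation (\<lambda>\<omega>. ?B t \<omega> - ?B s \<omega>) = 0"
      unfolding inc using m by (simp add: Bochner_Integration.integral_sum)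
    have cross: "integrable P (\<lambda>\<omega>. d s t a \<omega> * d s t b \<omega>) \<and>
        expectation (\<lambda>\<omega>. d s t a \<omega> * d s t b \<omega>) = (if a = b then 2 * (t - s) else 0)" for a b
    proof (cases "a = b")
      case True
      then show ?thesis using m(3,4)[of a] by (simp add: power2_eq_square)
    next
      case False
      have "indep_vars (\<lambda>_. borel) (d s t) {a, b}"
        by (rule indep_vars_subset[OF iv[OF st]]) auto
      from indep_vars_lebesgue_integral[OF _ this] indep_vars_integrable[OF _ this] False m(1,2)
      show ?thesis by simp
    qed
    have sq: "(?B t \<omega> - ?B s \<omega>)\<^sup>2 = (\<Sum>a\<in>UNIV. \<Sum>b\<in>UNIV. (y a * y b) * (d s t a \<omega> * d s t b \<omega>))" for \<omega>
      unfolding inc power2_eq_square sum_product by (intro sum.cong refl) (simp add: algebra_simps)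
    have "expectation (\<lambda>\<omega>. (?B t \<omega> - ?B s \<omega>)\<^sup>2)
        = (\<Sum>a\<in>UNIV. \<Sum>b\<in>UNIV. (y a * y b) * (if a = b then 2 * (t - s) else 0))"
      unfolding sq using cross
      by (subst Bochner_Integration.integral_sum) (auto intro!: sum.cong Bochner_Integration.integrable_sum simp: Bochner_Integration.integral_sum)
    also have "\<dots> = 2 * (\<Sum>a\<in>UNIV. (y a)\<^sup>2) * (t - s)"
      by (simp add: if_distrib[of "\<lambda>x. _ * x"] sum.delta sum_distrib_left sum_distrib_right power2_eq_square algebra_simps cong: if_cong)
    finally show "expectation (\<lambda>\<omega>. (?B t \<omega> - ?B s \<omega>)\<^sup>2) = 2 * (\<Sum>a\<in>UNIV. (y a)\<^sup>2) * (t - s)" .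
    let ?U = "\<lambda>\<omega>. real CARD('m) ^ 3 * (\<Sum>a\<in>UNIV. (y a * d s t a \<omega>) ^ 4)"
    have U: "integrable P ?U" using m(5) by (simp add: power_mult_distrib)
    show I4: "integrable P (\<lambda>\<omega>. (?B t \<omega> - ?B s \<omega>) ^ 4)"
    proof (rule Bochner_Integration.integrable_bound[OF U])
      show "AE \<omega> in P. norm ((?B t \<omega> - ?B s \<omega>) ^ 4) \<le> norm (?U \<omega>)"
        unfolding inc using sum_pow4_le[of "\<lambda>a. y a * d s t a _"]
        by (intro AE_I2) (simp add: sum_nonneg)
    qed (unfold inc, measurable)
    have 4: "(2 * t - 2 * s)\<^sup>2 = 4 * (t - s)\<^sup>2" by (simp add: power2_eq_square algebra_simps)
    have "expectation (\<lambda>\<omega>. (?B t \<omega> - ?B s \<omega>) ^ 4) \<le> expectation ?U"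
      using sum_pow4_le[of "\<lambda>a. y a * d s t a _"] by (intro integral_mono I4 U) (simp add: inc)
    also have "\<dots> = 12 * real CARD('m) ^ 3 * (\<Sum>a\<in>UNIV. (y a) ^ 4) * (t - s)\<^sup>2"
      using m(5,6) 4 by (simp add: power_mult_distrib Bochner_Integration.integral_sum sum_distrib_right[symmetric])
    finally show "expectation (\<lambda>\<omega>. (?B t \<omega> - ?B s \<omega>) ^ 4) \<le> 12 * real CARD('m) ^ 3 * (\<Sum>a\<in>UNIV. (y a) ^ 4) * (t - s)\<^sup>2" .
  qed
qed

section \<open>The noise of one component as a scalar stochastic integral\<close>

lemma partition_bounds:
  fixes p :: "nat \<Rightarrow> real"
  assumes "p 0 = 0" "p n = s" "\<And>i. i < n \<Longrightarrow> p i \<le> p (Suc i)" "i \<le> n"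
  shows "0 \<le> p i" "p i \<le> s"
proof -
  have "p 0 \<le> p i" if "i \<le> n" for i
    using that by (induction i) (use assms(3) in \<open>auto intro: order_trans\<close>)
  then show "0 \<le> p i" using assms by auto
  have "p i \<le> p n" using \<open>i \<le> n\<close>
    by (induction rule: inc_induct) (use assms(3) in \<open>auto intro: order_trans\<close>)
  then show "p i \<le> s" using assms by simp
qed

text \<open>The diagonal entries are \<open>\<i>\<close> times real numbers, so each integrand is
  \<open>- \<i> / sqrt N\<close> times a real multiple of the component; the prefactor
  \<open>\<i> * sqrt N\<close> cancels this. Processes are set to 0 from the lifetime on, to be
  measurable at all times; on the event \<open>t < \<tau>\<close> this changes nothing up to time
  \<open>t\<close>.\<close>

lemma langevin_stochastic_integral:
  fixes w :: "'m::finite \<Rightarrow> real \<Rightarrow> 'w \<Rightarrow> real" and X :: "'m \<Rightarrow> complex^'n^'n"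
  assumes F: "filtered_prob_space P F" and w: "brownian_motions2 P F w"
    and \<tau>: "lifetime P F \<tau>"
    and \<Lambda>: "adapted_before F \<tau> \<Lambda>" "continuous_before P \<tau> \<Lambda>"
    and I: "\<And>a. ito_integral P F \<tau> (w a) (\<lambda>t \<omega>. noise_coeff N X (\<Lambda> t \<omega>) j a) (I a)"
    and X: "\<And>a. X a \<in> su" and N: "0 < N" and t: "0 < t"
  shows "stochastic_integral P F (\<lambda>s \<omega>. \<Sum>a\<in>UNIV. Im (X a $ j $ j) * w a s \<omega>)
    (2 * (\<Sum>a\<in>UNIV. (Im (X a $ j $ j))\<^sup>2)) (12 * real CARD('m) ^ 3 * (\<Sum>a\<in>UNIV. (Im (X a $ j $ j)) ^ 4))
    (\<lambda>s \<omega>. if ereal s < \<tau> \<omega> then \<Lambda> s \<omega> $ j else 0)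
    (\<lambda>s \<omega>. \<i> * of_real (sqrt (real N)) * (\<Sum>a\<in>UNIV. if ereal s < \<tau> \<omega> then I a s \<omega> else 0))
    {\<omega> \<in> space P. ereal t < \<tau> \<omega>} t"
proof -
  define y where "y a = Im (X a $ j $ j)" for a
  define L where "L s \<omega> = (if ereal s < \<tau> \<omega> then \<Lambda> s \<omega> $ j else 0)" for s \<omega>
  define J where "J a s \<omega> = (if ereal s < \<tau> \<omega> then I a s \<omega> else 0)" for a s \<omega>
  define B where "B s \<omega> = (\<Sum>a\<in>UNIV. y a * w a s \<omega>)" for s \<omega>
  let ?A = "\<lambda>t. {\<omega> \<in> space P. ereal t < \<tau> \<omega>}"
  let ?c = "of_real (sqrt (real N)) :: complex"
  interpret brownian_driver P F B "2 * (\<Sum>a\<in>UNIV. (y a)\<^sup>2)" "12 * real CARD('m) ^ 3 * (\<Sum>a\<in>UNIV. (y a) ^ 4)"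
    unfolding B_def[abs_def] by (rule brownian_driver_linear_combination[OF F w])
  have A [measurable]: "?A s \<in> events" if "0 \<le> s" for s
  proof -
    have "{\<omega> \<in> space P. \<tau> \<omega> \<le> ereal s} \<in> events"
      using \<tau> that subalg[of s] by (auto simp: lifetime_def subalgebra_def)
    moreover have "?A s = space P - {\<omega> \<in> space P. \<tau> \<omega> \<le> ereal s}" by auto
    ultimately show ?thesis by (metis sets.compl_sets)
  qed
  have w_meas: "w a s \<in> borel_measurable P" if "0 \<le> s" for a s
    by (rule measurable_F) (use w that in \<open>auto simp: brownian_motions2_def\<close>)
  have L_F: "L s \<in> borel_measurable (F s)" if "0 \<le> s" for s
  proof -
    have "(\<lambda>\<omega>. if ereal s < \<tau> \<omega> then \<Lambda> s \<omega> else 0) \<in> borel_measurable (F s)"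
      using \<Lambda>(1) that by (simp add: adapted_before_def)
    moreover have "(\<lambda>v :: complex^'n. v $ j) \<in> borel_measurable borel"
      by (intro borel_measurable_continuous_onI continuous_intros)
    ultimately have "(\<lambda>\<omega>. (if ereal s < \<tau> \<omega> then \<Lambda> s \<omega> else 0) $ j) \<in> borel_measurable (F s)"
      by (rule measurable_compose)
    then show ?thesis by (simp add: L_def[abs_def] if_distrib[of "\<lambda>v. v $ j"] cong: if_cong)
  qed
  have J_meas: "J a s \<in> borel_measurable P" if "0 \<le> s" for a s
    unfolding J_def[abs_def]
    by (rule measurable_F) (use I[of a] that in \<open>auto simp: ito_integral_def adapted_before_def\<close>)
  define H where "H a s \<omega> = - (\<i> * of_real (1 / sqrt (real N))) * of_real (y a) * L s \<omega>" for a s \<omega>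
  have H_eq: "noise_coeff N X (\<Lambda> s \<omega>) j a = H a s \<omega>" if "ereal s < \<tau> \<omega>" for a s \<omega>
    unfolding noise_coeff_def H_def y_def L_def using that by (subst su_diag[OF X]) simp
  define D where "D a p n s \<omega> = (\<Sum>i<n. H a (p i) \<omega> * of_real (w a (p (Suc i)) \<omega> - w a (p i) \<omega>)) - J a s \<omega>"
    for a n s \<omega> and p :: "nat \<Rightarrow> real"
  have D_meas: "D a p n s \<in> borel_measurable P" if "0 \<le> s" "\<And>i. i \<le> n \<Longrightarrow> 0 \<le> p i" for a p n s
    unfolding D_def[abs_def] H_def
  proof (intro borel_measurable_diff borel_measurable_sum J_meas that)
    fix i assume "i \<in> {..<n}"
    then have [measurable]: "L (p i) \<in> borel_measurable P" "w a (p i) \<in> borel_measurable P"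
      "w a (p (Suc i)) \<in> borel_measurable P"
      using that(2)[of i] that(2)[of "Suc i"] by (auto intro: measurable_F[OF L_F] w_meas)
    show "(\<lambda>\<omega>. - (\<i> * of_real (1 / sqrt (real N))) * of_real (y a) * L (p i) \<omega> *
        of_real (w a (p (Suc i)) \<omega> - w a (p i) \<omega>)) \<in> borel_measurable P"
      by measurable
  qed
  \<comment> \<open>\<open>2 * \<epsilon>\<close> adds up the probability and the threshold in
    \<open>ito_integral\<close>. Convergence is given on \<open>s < \<tau>\<close>, an event that
    contains \<open>t < \<tau>\<close>.\<close>
  have conv_a: "\<exists>\<delta>>0. \<forall>(p :: nat \<Rightarrow> real) n. p 0 = 0 \<and> p n = s \<and> (\<forall>i<n. p i \<le> p (Suc i) \<and> p (Suc i) - p i < \<delta>) \<longrightarrow>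
      trunc_norm P (?A t) (D a p n s) < 2 * \<epsilon>" if s: "0 \<le> s" "s \<le> t" and \<epsilon>: "0 < \<epsilon>" for a s \<epsilon>
  proof -
    obtain \<delta> where \<delta>: "0 < \<delta>" and lim: "\<And>(p :: nat \<Rightarrow> real) n. p 0 = 0 \<Longrightarrow> p n = s \<Longrightarrow> (\<forall>i<n. p i \<le> p (Suc i) \<and> p (Suc i) - p i < \<delta>) \<Longrightarrow>
        measure P {\<omega> \<in> space P. ereal s < \<tau> \<omega> \<and>
          \<epsilon> < norm ((\<Sum>i<n. noise_coeff N X (\<Lambda> (p i) \<omega>) j a * of_real (w a (p (Suc i)) \<omega> - w a (p i) \<omega>)) - I a s \<omega>)} < \<epsilon>"
      using I[of a] s(1) \<epsilon> unfolding ito_integral_def by blast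
    have "trunc_norm P (?A t) (D a p n s) < 2 * \<epsilon>"
      if p: "p 0 = 0" "p n = s" and mesh: "\<forall>i<n. p i \<le> p (Suc i) \<and> p (Suc i) - p i < \<delta>" for p n
    proof -
      have pb: "0 \<le> p i" "p i \<le> s" if "i \<le> n" for i
        using partition_bounds[OF p _ that] mesh by auto
      have [measurable]: "D a p n s \<in> borel_measurable P" by (rule D_meas[OF s(1) pb(1)])
      have "trunc_norm P (?A t) (D a p n s) \<le> prob {\<omega> \<in> space P. \<omega> \<in> ?A t \<and> \<epsilon> < norm (D a p n s \<omega>)} + \<epsilon>"
        using t \<epsilon> by (intro trunc_norm_le_prob A) auto
      also have "prob {\<omega> \<in> space P. \<omega> \<in> ?A t \<and> \<epsilon> < norm (D a p n s \<omega>)}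
          \<le> prob {\<omega> \<in> space P. \<omega> \<in> ?A s \<and> \<epsilon> < norm (D a p n s \<omega>)}"
      proof (rule finite_measure_mono)
        show "{\<omega> \<in> space P. \<omega> \<in> ?A s \<and> \<epsilon> < norm (D a p n s \<omega>)} \<in> events"
          using A[OF s(1)] by measurable
        show "{\<omega> \<in> space P. \<omega> \<in> ?A t \<and> \<epsilon> < norm (D a p n s \<omega>)} \<subseteq> {\<omega> \<in> space P. \<omega> \<in> ?A s \<and> \<epsilon> < norm (D a p n s \<omega>)}"
          using s(2) by (auto intro: le_less_trans[of "ereal s" "ereal t"])
      qed
      also have "{\<omega> \<in> space P. \<omega> \<in> ?A s \<and> \<epsilon> < norm (D a p n s \<omega>)} = {\<omega> \<in> space P. ereal s < \<tau> \<omega> \<and>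
          \<epsilon> < norm ((\<Sum>i<n. noise_coeff N X (\<Lambda> (p i) \<omega>) j a * of_real (w a (p (Suc i)) \<omega> - w a (p i) \<omega>)) - I a s \<omega>)}"
      proof -
        have "D a p n s \<omega> = (\<Sum>i<n. noise_coeff N X (\<Lambda> (p i) \<omega>) j a * of_real (w a (p (Suc i)) \<omega> - w a (p i) \<omega>)) - I a s \<omega>"
          if "ereal s < \<tau> \<omega>" for \<omega>
        proof -
          have "ereal (p i) < \<tau> \<omega>" if "i < n" for i
            using pb(2)[of i] that \<open>ereal s < \<tau> \<omega>\<close> by (intro le_less_trans[of "ereal (p i)" "ereal s"]) auto
          then show ?thesis using that by (simp add: D_def H_eq J_def)
        qed
        then show ?thesis by auto
      qed
      also have "prob \<dots> < \<epsilon>" by (rule lim[OF p mesh])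
      finally show ?thesis by simp
    qed
    with \<delta> show ?thesis by blast
  qed
  have "stochastic_integral P F B (2 * (\<Sum>a\<in>UNIV. (y a)\<^sup>2)) (12 * real CARD('m) ^ 3 * (\<Sum>a\<in>UNIV. (y a) ^ 4))
      L (\<lambda>s \<omega>. \<i> * ?c * (\<Sum>a\<in>UNIV. J a s \<omega>)) (?A t) t"
  proof
    show "0 < t" by fact
    show "?A t \<in> events" using t by (intro A) simp
    show "L s \<in> borel_measurable (F s)" if "0 \<le> s" for s by (rule L_F[OF that])
    show "(\<lambda>\<omega>. \<i> * ?c * (\<Sum>a\<in>UNIV. J a s \<omega>)) \<in> borel_measurable P" if "0 \<le> s" for s
      using J_meas[OF that] by measurable
    show "AE \<omega> in P. \<omega> \<in> ?A t \<longrightarrow> continuous_on {0..t} (\<lambda>s. L s \<omega>)"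
      using \<Lambda>(2)[unfolded continuous_before_def]
    proof eventually_elim
      case (elim \<omega>)
      show ?case
      proof
        assume "\<omega> \<in> ?A t"
        then have lt: "ereal s < \<tau> \<omega>" if "s \<in> {0..t}" for s
          using that by (auto intro: le_less_trans[of _ "ereal t"])
        have "continuous_on {0..t} (\<lambda>s. \<Lambda> s \<omega> $ j)"
          by (intro continuous_on_component continuous_on_subset[OF elim]) (use lt in auto)
        then show "continuous_on {0..t} (\<lambda>s. L s \<omega>)"
          by (rule continuous_on_eq) (use lt in \<open>auto simp: L_def\<close>)
      qed
    qed
    fix s \<epsilon> :: real assume s: "0 \<le> s" "s \<le> t" and \<epsilon>: "0 < \<epsilon>"
    \<comment> \<open>Distributes \<open>\<epsilon>\<close> over the \<open>CARD('m)\<close>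
      integrals, allowing for the 2 in \<open>conv_a\<close> and the scaling by
      \<open>sqrt N\<close>.\<close>
    define \<epsilon>' where "\<epsilon>' = \<epsilon> / (2 * sqrt (real N) * real CARD('m))"
    have N1: "1 \<le> sqrt (real N)" using N by simp
    have "0 < \<epsilon>'" using \<epsilon> N by (simp add: \<epsilon>'_def)
    have "\<exists>\<delta>. \<forall>a. 0 < \<delta> a \<and> (\<forall>(p :: nat \<Rightarrow> real) n. p 0 = 0 \<and> p n = s \<and>
        (\<forall>i<n. p i \<le> p (Suc i) \<and> p (Suc i) - p i < \<delta> a) \<longrightarrow> trunc_norm P (?A t) (D a p n s) < 2 * \<epsilon>')"
      using conv_a[OF s \<open>0 < \<epsilon>'\<close>] by (intro choice allI)
    then obtain \<delta> where \<delta>: "\<And>a. 0 < \<delta> a" and lim: "\<And>a (p :: nat \<Rightarrow> real) n. p 0 = 0 \<Longrightarrow> p n = s \<Longrightarrow>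
        (\<forall>i<n. p i \<le> p (Suc i) \<and> p (Suc i) - p i < \<delta> a) \<Longrightarrow> trunc_norm P (?A t) (D a p n s) < 2 * \<epsilon>'"
      by blast
    show "\<exists>\<delta>>0. \<forall>(p :: nat \<Rightarrow> real) n. p 0 = 0 \<and> p n = s \<and> (\<forall>i<n. p i \<le> p (Suc i) \<and> p (Suc i) - p i < \<delta>) \<longrightarrow>
        trunc_norm P (?A t) (\<lambda>\<omega>. (\<Sum>i<n. L (p i) \<omega> * of_real (B (p (Suc i)) \<omega> - B (p i) \<omega>)) - \<i> * ?c * (\<Sum>a\<in>UNIV. J a s \<omega>)) < \<epsilon>"
    proof (intro exI[of _ "Min (range \<delta>)"] conjI allI impI)
      show "0 < Min (range \<delta>)" using \<delta> by simp
      fix p :: "nat \<Rightarrow> real" and n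
      assume asm: "p 0 = 0 \<and> p n = s \<and> (\<forall>i<n. p i \<le> p (Suc i) \<and> p (Suc i) - p i < Min (range \<delta>))"
      then have p: "p 0 = 0" "p n = s" and mesh: "\<And>i a. i < n \<Longrightarrow> p i \<le> p (Suc i) \<and> p (Suc i) - p i < \<delta> a"
        by auto
      have pb: "0 \<le> p i" if "i \<le> n" for i
        using partition_bounds(1)[OF p _ that] mesh by auto
      have Dm: "D a p n s \<in> borel_measurable P" for a by (rule D_meas[OF s(1) pb])
      have eq: "(\<Sum>i<n. L (p i) \<omega> * of_real (B (p (Suc i)) \<omega> - B (p i) \<omega>)) - \<i> * ?c * (\<Sum>a\<in>UNIV. J a s \<omega>)
          = \<i> * ?c * (\<Sum>a\<in>UNIV. D a p n s \<omega>)" for \<omega>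
      proof -
        have cc: "\<i> * ?c * (- (\<i> * of_real (1 / sqrt (real N))) * u) = u" for u
          using N by simp
        have "(\<Sum>i<n. L (p i) \<omega> * of_real (B (p (Suc i)) \<omega> - B (p i) \<omega>))
            = (\<Sum>i<n. \<Sum>a\<in>UNIV. of_real (y a) * L (p i) \<omega> * of_real (w a (p (Suc i)) \<omega> - w a (p i) \<omega>))"
          unfolding B_def sum_subtractf[symmetric] of_real_sum sum_distrib_left
          by (intro sum.cong refl) (simp add: algebra_simps)
        also have "\<dots> = (\<Sum>a\<in>UNIV. \<Sum>i<n. of_real (y a) * L (p i) \<omega> * of_real (w a (p (Suc i)) \<omega> - w a (p i) \<omega>))"
          by (rule sum.swap)
        also have "\<dots> = \<i> * ?c * (\<Sum>a\<in>UNIV. \<Sum>i<n. H a (p i) \<omega> * of_real (w a (p (Suc i)) \<omega> - w a (p i) \<omega>))"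
          unfolding sum_distrib_left H_def
          by (intro sum.cong refl) (simp only: mult.assoc cc[unfolded mult.assoc])
        finally show ?thesis
          unfolding D_def sum_subtractf right_diff_distrib by simp
      qed
      have "trunc_norm P (?A t) (\<lambda>\<omega>. \<i> * ?c * (\<Sum>a\<in>UNIV. D a p n s \<omega>))
          = trunc_norm P (?A t) (\<lambda>\<omega>. sqrt (real N) *\<^sub>R (\<Sum>a\<in>UNIV. D a p n s \<omega>))"
        by (simp add: trunc_norm_def norm_mult)
      also have "\<dots> \<le> sqrt (real N) * trunc_norm P (?A t) (\<lambda>\<omega>. \<Sum>a\<in>UNIV. D a p n s \<omega>)"
        using Dm t by (intro trunc_norm_scale A N1 borel_measurable_sum) auto
      also have "\<dots> \<le> sqrt (real N) * (\<Sum>a\<in>UNIV. trunc_norm P (?A t) (D a p n s))"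
        using Dm t by (intro mult_left_mono trunc_norm_sum A) auto
      also have "\<dots> < sqrt (real N) * (\<Sum>a\<in>(UNIV :: 'm set). 2 * \<epsilon>')"
        using N lim[OF p] mesh by (intro mult_strict_left_mono sum_strict_mono) auto
      also have "\<dots> = \<epsilon>" using N by (simp add: \<epsilon>'_def)
      finally show "trunc_norm P (?A t) (\<lambda>\<omega>. (\<Sum>i<n. L (p i) \<omega> * of_real (B (p (Suc i)) \<omega> - B (p i) \<omega>)) - \<i> * ?c * (\<Sum>a\<in>UNIV. J a s \<omega>)) < \<epsilon>"
        unfolding eq .
    qed
  qed
  then show ?thesis unfolding B_def[abs_def] L_def[abs_def] J_def y_def .
qed

text \<open>Multiplied by N, the equation has noise part \<open>- \<i> * sqrt N * Y\<close>, so the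
  pathwise formula applies with \<open>k = - sqrt N\<close>. The exceptional null set depends on
  \<open>t\<close>, as does the subsequence of grids.\<close>

lemma langevin_norm_square_increment:
  fixes w :: "'m::finite \<Rightarrow> real \<Rightarrow> 'w \<Rightarrow> real" and X :: "'m \<Rightarrow> complex^'n^'n"
  assumes F: "filtered_prob_space P F" and w: "brownian_motions2 P F w"
    and X: "su_orthonormal_basis X" and N: "0 < N"
    and sol: "langevin_solution P F w N X K J \<tau> \<Lambda>"
    and J0: "AE \<omega> in P. \<forall>t\<ge>0. ereal t < \<tau> \<omega> \<longrightarrow> (\<forall>a. J t \<omega> a = 0)"
    and t: "0 < t"
  shows "AE \<omega> in P. ereal t < \<tau> \<omega> \<longrightarrow>
    (cmod (\<Lambda> t \<omega> $ j))\<^sup>2 - (cmod (\<Lambda> 0 \<omega> $ j))\<^sup>2 = integral {0..t} (\<lambda>s. norm_rate (real N) (\<Lambda> s \<omega>) j)"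
proof -
  have \<tau>: "lifetime P F \<tau>" and \<Lambda>: "adapted_before F \<tau> \<Lambda>" "continuous_before P \<tau> \<Lambda>"
    and inj: "AE \<omega> in P. \<forall>t\<ge>0. ereal t < \<tau> \<omega> \<longrightarrow> \<Lambda> t \<omega> \<in> state_space \<and> inj (\<lambda>j. \<Lambda> t \<omega> $ j)"
    and drift: "AE \<omega> in P. \<forall>t\<ge>0. ereal t < \<tau> \<omega> \<longrightarrow>
        (\<forall>j. (\<lambda>s. drift_coeff X (K s \<omega>) (J s \<omega>) (\<Lambda> s \<omega>) j) absolutely_integrable_on {0..t})"
    using sol by (auto simp: langevin_solution_def)
  obtain I' where I': "\<And>j a. ito_integral P F \<tau> (w a) (\<lambda>t \<omega>. noise_coeff N X (\<Lambda> t \<omega>) j a) (I' j a)"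
    and eqn: "AE \<omega> in P. \<forall>t\<ge>0. ereal t < \<tau> \<omega> \<longrightarrow>
          (\<forall>j. of_real (1 / real N) * (\<Lambda> t \<omega> $ j - \<Lambda> 0 \<omega> $ j) =
             (\<Sum>a\<in>UNIV. I' j a t \<omega>) + integral {0..t} (\<lambda>s. drift_coeff X (K s \<omega>) (J s \<omega>) (\<Lambda> s \<omega>) j))"
    using sol unfolding langevin_solution_def by blast
  have Xsu: "X a \<in> su" for a using X by (simp add: su_orthonormal_basis_def)
  define B where "B s \<omega> = (\<Sum>a\<in>UNIV. Im (X a $ j $ j) * w a s \<omega>)" for s \<omega>
  define L where "L s \<omega> = (if ereal s < \<tau> \<omega> then \<Lambda> s \<omega> $ j else 0)" for s \<omega>
  define Y where "Y s \<omega> = \<i> * of_real (sqrt (real N)) * (\<Sum>a\<in>UNIV. if ereal s < \<tau> \<omega> then I' j a s \<omega> else 0)" for s \<omega>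
  \<comment> \<open>Twice the value in \<open>su_basis_diag\<close>, since each \<open>w a\<close>
    has variance 2 per unit time.\<close>
  define v where "v = 4 * (1 - 1 / real CARD('n))"
  interpret stochastic_integral P F B v "12 * real CARD('m) ^ 3 * (\<Sum>a\<in>UNIV. (Im (X a $ j $ j)) ^ 4)"
    L Y "{\<omega> \<in> space P. ereal t < \<tau> \<omega>}" t
    using langevin_stochastic_integral[OF F w \<tau> \<Lambda> I' Xsu N t, of j] su_basis_diag[OF X, of j]
    unfolding B_def[abs_def] L_def[abs_def] Y_def[abs_def] v_def by simp
  obtain \<rho> :: "nat \<Rightarrow> nat" where \<rho>: "strict_mono \<rho>" and lims:
    "AE \<omega> in P. \<omega> \<in> {\<omega> \<in> space P. ereal t < \<tau> \<omega>} \<longrightarrow>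
      (\<lambda>m. \<Sum>i<\<rho> m. Im (cnj (L (grid t (\<rho> m) i) \<omega>) * dY (\<rho> m) i \<omega>)) \<longlonglongrightarrow> 0 \<and>
      (\<lambda>m. L2_set (\<lambda>i. norm (err (\<rho> m) i \<omega>)) {..<\<rho> m}) \<longlonglongrightarrow> 0 \<and>
      (\<lambda>m. \<Sum>i<\<rho> m. (norm (L (grid t (\<rho> m) i) \<omega>))\<^sup>2 * ((dB (\<rho> m) i \<omega>)\<^sup>2 - v * (t / real (\<rho> m)))) \<longlonglongrightarrow> 0"
    by (rule grid_limits_subsequence)
  show ?thesis
    using AE_space lims inj drift eqn J0 \<Lambda>(2)[unfolded continuous_before_def]
  proof eventually_elim
    case (elim \<omega>)
    show ?case
    proof
      assume alive: "ereal t < \<tau> \<omega>"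
      have lt: "ereal s < \<tau> \<omega>" if "s \<le> t" for s
        using that alive by (auto intro: le_less_trans[of _ "ereal t"])
      have L_eq: "L s \<omega> = \<Lambda> s \<omega> $ j" if "s \<le> t" for s
        using lt[OF that] by (simp add: L_def)
      have \<Lambda>_cont: "continuous_on {0..t} (\<lambda>s. \<Lambda> s \<omega>)"
        by (intro continuous_on_subset[OF elim(7)]) (use lt in auto)
      have L_cont: "continuous_on {0..t} (\<lambda>s. L s \<omega>)"
        by (rule continuous_on_eq[OF continuous_on_component[OF \<Lambda>_cont, of j]]) (simp add: L_eq)
      let ?d = "\<lambda>s. drift_coeff X (K s \<omega>) (J s \<omega>) (\<Lambda> s \<omega>) j"
      define f where "f s = of_real (real N) * ?d s" for s
      have f: "f absolutely_integrable_on {0..t}"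
        unfolding f_def using elim(4) t alive by (intro set_integrable_mult_right) auto
      \<comment> \<open>This is where \<open>J = 0\<close> enters. The second summand on the left is
        the Ito correction.\<close>
      have rate: "2 * Re (cnj (L s \<omega>) * f s) + real N * v * (norm (L s \<omega>))\<^sup>2 = norm_rate (real N) (\<Lambda> s \<omega>) j"
        if "s \<in> {0..t}" for s
      proof -
        have "J s \<omega> a = 0" for a using elim(6) that lt by auto
        note drift_eq = Re_cnj_drift[where J="J s \<omega>", OF X this, of "\<Lambda> s \<omega>" j "K s \<omega>"]
        have Le: "L s \<omega> = \<Lambda> s \<omega> $ j" using that by (simp add: L_eq)
        have Re_scale: "Re (of_real (real N) * z) = real N * Re z" for z by simp
        have "cnj (L s \<omega>) * f s = of_real (real N) * (cnj (\<Lambda> s \<omega> $ j) * ?d s)"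
          unfolding f_def Le by (rule mult.left_commute)
        then have e: "Re (cnj (L s \<omega>) * f s) = real N * Re (cnj (\<Lambda> s \<omega> $ j) * ?d s)"
          by (simp only: Re_scale)
        have "2 * (n * (q * u)) + n * d * q = n * q * (2 * u + d)" for n q u d :: real
          by (simp add: algebra_simps)
        then show ?thesis
          unfolding e unfolding drift_eq Le norm_rate_def v_def .
      qed
      have norm_rate_int: "(\<lambda>s. norm_rate (real N) (\<Lambda> s \<omega>) j) integrable_on {0..t}"
        using elim(3) lt by (intro integrable_continuous_interval continuous_on_norm_rate \<Lambda>_cont) auto
      have sq_int: "(\<lambda>s. (norm (L s \<omega>))\<^sup>2) integrable_on {0..t}"
        by (intro integrable_continuous_interval continuous_intros L_cont)
      \<comment> \<open>Read backwards, \<open>rate\<close> expresses the product through two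
        continuous functions, which gives its integrability even if \<open>f\<close> is
        discontinuous.\<close>
      have "(\<lambda>s. (1 / 2) * (norm_rate (real N) (\<Lambda> s \<omega>) j - real N * v * (norm (L s \<omega>))\<^sup>2)) integrable_on {0..t}"
        using norm_rate_int sq_int by (intro integrable_on_mult_right Henstock_Kurzweil_Integration.integrable_diff)
      then have G_int: "(\<lambda>s. Re (cnj (L s \<omega>) * f s)) integrable_on {0..t}"
        by (rule integrable_eq) (use rate in \<open>simp add: field_simps\<close>)
      have path: "L s \<omega> = L 0 \<omega> + \<i> * of_real (- sqrt (real N)) * Y s \<omega> + integral {0..s} f" if s: "0 \<le> s" "s \<le> t" for s
      proof -
        have "of_real (1 / real N) * (L s \<omega> - L 0 \<omega>) = (\<Sum>a\<in>UNIV. I' j a s \<omega>) + integral {0..s} ?d"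
          using elim(5) s lt[of s] t by (simp add: L_eq)
        then have "L s \<omega> - L 0 \<omega> = of_real (real N) * (\<Sum>a\<in>UNIV. I' j a s \<omega>) + of_real (real N) * integral {0..s} ?d"
          using N by (simp add: field_simps)
        also have "of_real (real N) * integral {0..s} ?d = integral {0..s} f"
          by (simp add: f_def[abs_def])
        also have "of_real (real N) * (\<Sum>a\<in>UNIV. I' j a s \<omega>) = \<i> * of_real (- sqrt (real N)) * Y s \<omega>"
        proof -
          have "(of_real (real N) :: complex) = of_real (sqrt (real N)) * of_real (sqrt (real N))"
            by (simp flip: of_real_mult)
          then show ?thesis using lt[OF s(2)] by (simp add: Y_def algebra_simps)
        qed
        finally show ?thesis by (simp add: algebra_simps)
      qed
      have r: "filterlim \<rho> at_top sequentially" by (rule filterlim_subseq[OF \<rho>])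
      have lim: "(\<lambda>m. \<Sum>i<\<rho> m. Im (cnj (L (grid t (\<rho> m) i) \<omega>) * (Y (grid t (\<rho> m) (Suc i)) \<omega> - Y (grid t (\<rho> m) i) \<omega>))) \<longlonglongrightarrow> 0"
        "(\<lambda>m. L2_set (\<lambda>i. norm (Y (grid t (\<rho> m) (Suc i)) \<omega> - Y (grid t (\<rho> m) i) \<omega>
          - L (grid t (\<rho> m) i) \<omega> * of_real (B (grid t (\<rho> m) (Suc i)) \<omega> - B (grid t (\<rho> m) i) \<omega>))) {..<\<rho> m}) \<longlonglongrightarrow> 0"
        "(\<lambda>m. \<Sum>i<\<rho> m. (norm (L (grid t (\<rho> m) i) \<omega>))\<^sup>2 *
          ((B (grid t (\<rho> m) (Suc i)) \<omega> - B (grid t (\<rho> m) i) \<omega>)\<^sup>2 - v * (t / real (\<rho> m)))) \<longlonglongrightarrow> 0"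
        using elim(1,2) alive unfolding err_def dY_def dB_def by auto
      have "(cmod (\<Lambda> t \<omega> $ j))\<^sup>2 - (cmod (\<Lambda> 0 \<omega> $ j))\<^sup>2
          = 2 * integral {0..t} (\<lambda>s. Re (cnj (L s \<omega>) * f s)) + (- sqrt (real N))\<^sup>2 * v * integral {0..t} (\<lambda>s. (norm (L s \<omega>))\<^sup>2)"
        using norm_square_increment_pathwise[where Y="\<lambda>s. Y s \<omega>" and B="\<lambda>s. B s \<omega>", OF t L_cont f G_int path r lim] t
        by (simp add: L_eq)
      also have "\<dots> = integral {0..t} (\<lambda>s. 2 * Re (cnj (L s \<omega>) * f s) + real N * v * (norm (L s \<omega>))\<^sup>2)"
        using Henstock_Kurzweil_Integration.integral_add[OF integrable_on_mult_right[OF G_int, of 2] integrable_on_mult_right[OF sq_int, of "real N * v"]]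
        by (simp only: Henstock_Kurzweil_Integration.integral_mult_right power2_minus real_sqrt_pow2 of_nat_0_le_iff)
      also have "\<dots> = integral {0..t} (\<lambda>s. norm_rate (real N) (\<Lambda> s \<omega>) j)"
        using rate by (rule Henstock_Kurzweil_Integration.integral_cong)
      finally show "(cmod (\<Lambda> t \<omega> $ j))\<^sup>2 - (cmod (\<Lambda> 0 \<omega> $ j))\<^sup>2 = integral {0..t} (\<lambda>s. norm_rate (real N) (\<Lambda> s \<omega>) j)" .
    qed
  qed
qed

text \<open>Extends an identity that holds off one null set at countably many times to all times by
  continuity. The zeros approach \<open>s\<close> from the right, hence the strict
  \<open>s < b\<close>.\<close>

lemma zero_on_rationals_imp_zero:
  fixes D :: "real \<Rightarrow> real"
  assumes D: "continuous_on {0..b} D" and q: "\<And>q :: rat. 0 < q \<Longrightarrow> of_rat q \<le> b \<Longrightarrow> D (of_rat q) = 0"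
    and s: "0 \<le> s" "s < b"
  shows "D s = 0"
proof (rule ccontr)
  assume "D s \<noteq> 0"
  then obtain d where d: "0 < d" "\<And>s'. s' \<in> {0..b} \<Longrightarrow> dist s' s < d \<Longrightarrow> dist (D s') (D s) < \<bar>D s\<bar>"
    using D s unfolding continuous_on_iff by (metis atLeastAtMost_iff less_imp_le zero_less_abs_iff)
  obtain q' where q': "q' \<in> \<rat>" "s < q'" "q' < min b (s + d)"
    using Rats_dense_in_real[of s "min b (s + d)"] s d by auto
  then obtain q :: rat where q'_eq: "q' = of_rat q" by (auto elim: Rats_cases)
  have "0 < real_of_rat q" using q'(2) s unfolding q'_eq by linarith
  moreover have "real_of_rat q \<le> b" using q'(3) unfolding q'_eq by simp
  ultimately have "D q' = 0" unfolding q'_eq by (intro q) (simp_all only: zero_less_of_rat_iff)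
  moreover have "dist (D q') (D s) < \<bar>D s\<bar>" using q' s by (intro d(2)) (auto simp: dist_real_def)
  ultimately show False by (simp add: dist_real_def)
qed

theorem theorem4p2:
  fixes P :: "'w measure"
    and F :: "real \<Rightarrow> 'w measure"
    and w :: "'m::finite \<Rightarrow> real \<Rightarrow> 'w \<Rightarrow> real"
    and X :: "'m \<Rightarrow> complex^'n^'n"
    and S :: "('s::finite \<Rightarrow> complex^'n^'n) \<Rightarrow> complex"
    and U :: "real \<Rightarrow> 'w \<Rightarrow> 's \<Rightarrow> complex^'n^'n"
    and \<tau> :: "'w \<Rightarrow> ereal"
    and \<Lambda> :: "real \<Rightarrow> 'w \<Rightarrow> complex^'n"
  assumes "CARD('n) \<ge> 2"
    and "CARD('m) = CARD('n) ^ 2 - 1"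
    and "su_orthonormal_basis X"
    and "lie_differentiable_action X S"
    and "filtered_prob_space P F"
    and "brownian_motions2 P F w"
    and "\<And>x. adapted_before F \<tau> (\<lambda>t \<omega>. U t \<omega> x)"
    and "\<And>t \<omega> x. \<omega> \<in> space P \<Longrightarrow> 0 \<le> t \<Longrightarrow> ereal t < \<tau> \<omega> \<Longrightarrow> U t \<omega> x \<in> SL"
    and "langevin_solution P F w CARD('s) X
           (\<lambda>t \<omega>. K_coeff X S (U t \<omega>)) (\<lambda>t \<omega>. J_coeff X S (U t \<omega>)) \<tau> \<Lambda>"
    and "AE \<omega> in P. \<forall>t\<ge>0. ereal t < \<tau> \<omega> \<longrightarrow> (\<forall>a. J_coeff X S (U t \<omega>) a = 0)"
  shows "AE \<omega> in P. \<forall>t\<ge>0. ereal t < \<tau> \<omega> \<longrightarrow>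
           (\<exists>D\<le>0. ((\<lambda>s. \<Sum>j\<in>UNIV. (cmod (\<Lambda> s \<omega> $ j))\<^sup>2) has_real_derivative D) (at t within {0..}))"
proof -
  let ?N = "real CARD('s)"
  define V where "V \<omega> s = (\<Sum>j\<in>UNIV. (cmod (\<Lambda> s \<omega> $ j))\<^sup>2)" for \<omega> s
  define R where "R \<omega> s = (\<Sum>j\<in>UNIV. norm_rate ?N (\<Lambda> s \<omega>) j)" for \<omega> s
  have inj: "AE \<omega> in P. \<forall>t\<ge>0. ereal t < \<tau> \<omega> \<longrightarrow> \<Lambda> t \<omega> \<in> state_space \<and> inj (\<lambda>j. \<Lambda> t \<omega> $ j)"
    and cont: "AE \<omega> in P. continuous_on {t. 0 \<le> t \<and> ereal t < \<tau> \<omega>} (\<lambda>t. \<Lambda> t \<omega>)"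
    using assms(9) by (auto simp: langevin_solution_def continuous_before_def)
  \<comment> \<open>Countably many times and finitely many components: the null sets of the
    individual identities merge into one.\<close>
  have "AE \<omega> in P. \<forall>(q :: rat) j. 0 < q \<longrightarrow> ereal (of_rat q) < \<tau> \<omega> \<longrightarrow>
      (cmod (\<Lambda> (of_rat q) \<omega> $ j))\<^sup>2 - (cmod (\<Lambda> 0 \<omega> $ j))\<^sup>2 = integral {0..of_rat q} (\<lambda>s. norm_rate ?N (\<Lambda> s \<omega>) j)"
    unfolding AE_all_countable
  proof (intro allI)
    fix q :: rat and j
    show "AE \<omega> in P. 0 < q \<longrightarrow> ereal (of_rat q) < \<tau> \<omega> \<longrightarrow>
      (cmod (\<Lambda> (of_rat q) \<omega> $ j))\<^sup>2 - (cmod (\<Lambda> 0 \<omega> $ j))\<^sup>2 = integral {0..of_rat q} (\<lambda>s. norm_rate ?N (\<Lambda> s \<omega>) j)"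
      using langevin_norm_square_increment[OF assms(5,6,3) _ assms(9,10), of "of_rat q" j]
      by (cases "0 < q") auto
  qed
  with inj cont show ?thesis
  proof eventually_elim
    case (elim \<omega>)
    show ?case
    proof (intro allI impI)
      fix t :: real assume t: "0 \<le> t" and alive: "ereal t < \<tau> \<omega>"
      \<comment> \<open>With room beyond \<open>t\<close> inside the lifetime, \<open>{0..b}\<close>
        is a neighbourhood of \<open>t\<close> relative to \<open>{0..}\<close>, also for
        \<open>t = 0\<close>.\<close>
      obtain b where tb: "t < b" and b: "ereal b < \<tau> \<omega>"
        using ereal_dense2[OF alive] by auto
      have lt: "ereal s < \<tau> \<omega>" if "s \<le> b" for s
        using that b by (auto intro: le_less_trans[of _ "ereal b"])
      have \<Lambda>_cont: "continuous_on {0..b} (\<lambda>s. \<Lambda> s \<omega>)"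
        by (intro continuous_on_subset[OF elim(2)]) (use lt in auto)
      have inj_b: "inj (\<lambda>j. \<Lambda> s \<omega> $ j)" if "s \<in> {0..b}" for s using elim(1) lt that by auto
      have rate_cont: "continuous_on {0..b} (\<lambda>s. norm_rate ?N (\<Lambda> s \<omega>) j)" for j
        using inj_b by (intro continuous_on_norm_rate \<Lambda>_cont)
      have R_cont: "continuous_on {0..b} (R \<omega>)"
        unfolding R_def[abs_def] by (intro continuous_on_sum rate_cont)
      have V_cont: "continuous_on {0..b} (V \<omega>)"
        unfolding V_def[abs_def] by (intro continuous_intros continuous_on_component \<Lambda>_cont)
      have V_eq: "V \<omega> s - V \<omega> 0 - integral {0..s} (R \<omega>) = 0" if s: "0 \<le> s" "s < b" for s
      proof (rule zero_on_rationals_imp_zero[OF _ _ s])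
        show "continuous_on {0..b} (\<lambda>s. V \<omega> s - V \<omega> 0 - integral {0..s} (R \<omega>))"
          by (intro continuous_intros V_cont indefinite_integral_continuous_1 integrable_continuous_interval R_cont)
        fix q :: rat assume q: "0 < q" "of_rat q \<le> b"
        have "(\<lambda>s. norm_rate ?N (\<Lambda> s \<omega>) j) integrable_on {0..of_rat q}" for j
          using q by (intro integrable_continuous_interval continuous_on_subset[OF rate_cont]) auto
        then have "integral {0..of_rat q} (R \<omega>) = (\<Sum>j\<in>UNIV. integral {0..of_rat q} (\<lambda>s. norm_rate ?N (\<Lambda> s \<omega>) j))"
          unfolding R_def[abs_def] by (intro integral_sum) auto
        also have "\<dots> = V \<omega> (of_rat q) - V \<omega> 0"
          using elim(3) q lt by (simp add: V_def sum_subtractf[symmetric])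
        finally show "V \<omega> (of_rat q) - V \<omega> 0 - integral {0..of_rat q} (R \<omega>) = 0" by simp
      qed
      \<comment> \<open>The fundamental theorem of calculus at the point \<open>t\<close> itself,
        available because \<open>R \<omega>\<close> is continuous.\<close>
      have "((\<lambda>s. V \<omega> 0 + integral {0..s} (R \<omega>)) has_real_derivative 0 + R \<omega> t) (at t within {0..b})"
        using integral_has_real_derivative[OF R_cont, of t] t tb by (intro DERIV_add DERIV_const) auto
      then have "((\<lambda>s. V \<omega> 0 + integral {0..s} (R \<omega>)) has_real_derivative R \<omega> t) (at t within {0..b})" by simp
      then have "(V \<omega> has_real_derivative R \<omega> t) (at t within {0..b})"
      proof (rule has_field_derivative_transform_within)
        show "0 < b - t" "t \<in> {0..b}" using t tb by auto
        fix s assume s: "s \<in> {0..b}" "dist s t < b - t"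
        then have "s < b" by (simp add: dist_real_def abs_less_iff)
        with s V_eq[of s] show "V \<omega> 0 + integral {0..s} (R \<omega>) = V \<omega> s" by simp
      qed
      moreover have "at t within {0..b} = at t within {0..}"
        by (rule at_within_nhd[of _ "{..<b}"]) (use tb in auto)
      moreover have "R \<omega> t \<le> 0"
        unfolding R_def using inj_b[of t] t tb by (intro sum_norm_rate_nonpos) auto
      ultimately show "\<exists>D\<le>0. ((\<lambda>s. \<Sum>j\<in>UNIV. (cmod (\<Lambda> s \<omega> $ j))\<^sup>2) has_real_derivative D) (at t within {0..})"
        unfolding V_def[abs_def] by auto
    qed
  qed
qed

end
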